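(* Let $n\ge1$ be an integer, $l=p>2$ and $\theta>0$, and let $$\Theta_{l,\theta}=\{(x,t)\in\mathbf{R}^{n}\times\mathbf{R}: 0<-t<\theta|x|^l<\theta\}.$$ If $f:\partial\Theta_{l,\theta}\to\mathbf{R}$ is continuous at $(0,0)$ and satisfies $$|f-f(0,0)|\le M_\theta:=\frac{p-2}{p}\biggl(\frac{1}{np\theta}\biggr)^{1/(p-2)}\quad\text{on }\partial\Theta_{l,\theta},$$ then $$\lim_{\Theta_{l,\theta}\ni\xi\to(0,0)}\underline{H}_{\Theta_{l,\theta}}f(\xi)=\lim_{\Theta_{l,\theta}\ni\xi\to(0,0)}\overline{H}_{\Theta_{l,\theta}}f(\xi)=f(0,0).$$
   Context: Let $n\ge1$ be an integer, $1<p<\infty$, and let $\Theta\subset\mathbf{R}^{n+1}$ be a nonempty bounded open set, with points written $(x,t)$, $x\in\mathbf{R}^n$, $t\in\mathbf{R}$. $\nabla$ and $\operatorname{div}$ are taken with respect to $x$ only, and $\partial\Theta$ is the full topological boundary. The $p$-parabolic equation is $\partial_t u-\Delta_p u=0$, where $\Delta_p u=\operatorname{div}(|\nabla u|^{p-2}\nabla u)$. Solutions: $u:\Theta\to[-\infty,\infty]$ is a (weak) solution if for every open cylinder $U_{t_1,t_2}=U\times(t_1,t_2)\Subset\Theta$ we have $u\in C([t_1,t_2];L^2(U))\cap L^p(t_1,t_2;W^{1,p}(U))$ and $$\int_{t_1}^{t_2}\int_U|\nabla u|^{p-2}\nabla u\cdot\nabla\varphi\,dx\,dt-\int_{t_1}^{t_2}\int_U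 u\,\frac{\partial\varphi}{\partial t}\,dx\,dt=0\quad\text{for all }\varphi\in C_0^\infty(U_{t_1,t_2}).$$ A $p$-parabolic function is a continuous solution. Superparabolic functions: $u:\Theta\to(-\infty,\infty]$ is $p$-superparabolic if (i) $u$ is lower semicontinuous; (ii) $u$ is finite in a dense subset of $\Theta$; (iii) for every space-time box $Q_{t_1,t_2}=Q\times(t_1,t_2)\Subset\Theta$, $Q=(a_1,b_1)\times\dots\times(a_n,b_n)$, and every $h$ that is $p$-parabolic in $Q_{t_1,t_2}$, continuous on $\overline{Q_{t_1,t_2}}$ and satisfies $h\le u$ on the parabolic boundary $(\overline{Q}\times\{t_1\})\cup(\partial Q\times(t_1,t_2])$, we have $h\le u$ in $Q_{t_1,t_2}$. A function $v:\Theta\to[-\infty,\infty)$ is $p$-subparabolic if $-v$ is $p$-superparabolic. Perron solutions: for bounded $f:\partial\Theta\to\mathbf{R}$, let $\mathcal{U}_f$ be the set of $p$-superparabolic $u$ on $\Theta$ with $\liminf_{\Theta\ni\eta\to\xi}u(\eta)\ge f(\xi)$ for all $\xi\in\partial\Theta$, and $\mathcal{L}_f$ the set of $p$-subparabolic $u$ on $\Theta$ with $\limsup_{\Theta\ni\eta\to\xi}u(\eta)\le f(\xi)$ for all $\xi\in\partial\Theta$. For $\xi\in\Theta$ set $\overline{H}_\Theta f(\xi)=\inf_{u\in\mathcal{U}_f}u(\xi)$ (upper Perron solution) and $\underline{H}_\Theta f(\xi)=\sup_{u\in\mathcal{L}_f}u(\xi)$ (lower Perron solution). *)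

theory Defs
  imports "HOL-Analysis.Analysis"
begin

text \<open>A point \<open>(x, t)\<close> of space-time $\mathbf{R}^{n+1}$ is a pair in \<open>(real^'n) \<times> real\<close>; thus
  $n$ is \<open>CARD('n)\<close>, which is at least 1.  Functions on a set are total functions whose values
  outside the set are never used.\<close>

definition compactly_contained :: "'a::topological_space set \<Rightarrow> 'a set \<Rightarrow> bool" where
  "compactly_contained A S \<longleftrightarrow> compact (closure A) \<and> closure A \<subseteq> S"

section \<open>Test functions and Sobolev functions\<close>

primrec Ck :: "nat \<Rightarrow> ('a::euclidean_space \<Rightarrow> real) \<Rightarrow> bool" where
  "Ck 0 f \<longleftrightarrow> continuous_on UNIV f"
| "Ck (Suc k) f \<longleftrightarrow> (\<forall>x. f differentiable (at x)) \<and>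
     (\<forall>b\<in>Basis. Ck k (\<lambda>x. frechet_derivative f (at x) b))"

text \<open>$C_0^\infty(S)$, with functions extended by zero to the whole space.\<close>

definition test_function :: "'a::euclidean_space set \<Rightarrow> ('a \<Rightarrow> real) \<Rightarrow> bool" where
  "test_function S \<phi> \<longleftrightarrow> (\<forall>k. Ck k \<phi>) \<and> compactly_contained {x. \<phi> x \<noteq> 0} S"

definition Lp_on :: "real \<Rightarrow> 'a::euclidean_space set \<Rightarrow> ('a \<Rightarrow> 'b::euclidean_space) \<Rightarrow> bool" where
  "Lp_on p S f \<longleftrightarrow> set_borel_measurable lebesgue S f \<and>
     set_integrable lebesgue S (\<lambda>x. norm (f x) powr p)"

text \<open>\<open>v\<close> belongs to $W^{1,p}(U)$ and has the weak gradient \<open>g\<close>.\<close>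

definition W1p_with_gradient ::
    "real \<Rightarrow> (real^'n) set \<Rightarrow> (real^'n \<Rightarrow> real) \<Rightarrow> (real^'n \<Rightarrow> real^'n) \<Rightarrow> bool" where
  "W1p_with_gradient p U v g \<longleftrightarrow> Lp_on p U v \<and> Lp_on p U g \<and>
     (\<forall>\<phi>. test_function U \<phi> \<longrightarrow> (\<forall>i.
        (LINT x:U|lebesgue. v x * frechet_derivative \<phi> (at x) (axis i 1)) =
        - (LINT x:U|lebesgue. g x $ i * \<phi> x)))"

text \<open>\<open>u\<close> belongs to $L^p(t_1,t_2;W^{1,p}(U))$ and has the spatial weak gradient \<open>g\<close>.  As usual,
  $L^p(t_1,t_2;L^p(U))$ is identified with $L^p(U\times(t_1,t_2))$.\<close>

definition parabolic_Sobolev ::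
    "real \<Rightarrow> (real^'n) set \<Rightarrow> real \<Rightarrow> real \<Rightarrow> ((real^'n) \<times> real \<Rightarrow> real) \<Rightarrow>
     ((real^'n) \<times> real \<Rightarrow> real^'n) \<Rightarrow> bool" where
  "parabolic_Sobolev p U t1 t2 u g \<longleftrightarrow>
     Lp_on p (U \<times> {t1<..<t2}) u \<and> Lp_on p (U \<times> {t1<..<t2}) g \<and>
     (AE t in lebesgue. t \<in> {t1<..<t2} \<longrightarrow>
        W1p_with_gradient p U (\<lambda>x. u (x, t)) (\<lambda>x. g (x, t)))"

text \<open>$C([t_1,t_2];L^2(U))$.\<close>

definition continuous_into_L2 ::
    "(real^'n) set \<Rightarrow> real \<Rightarrow> real \<Rightarrow> ((real^'n) \<times> real \<Rightarrow> real) \<Rightarrow> bool" where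
  "continuous_into_L2 U t1 t2 u \<longleftrightarrow>
     (\<forall>t\<in>{t1..t2}. Lp_on 2 U (\<lambda>x. u (x, t))) \<and>
     (\<forall>s\<in>{t1..t2}.
        ((\<lambda>t. LINT x:U|lebesgue. (u (x, t) - u (x, s))\<^sup>2) \<longlongrightarrow> 0) (at s within {t1..t2}))"

section \<open>The p-parabolic equation\<close>

definition spatial_gradient :: "((real^'n) \<times> real \<Rightarrow> real) \<Rightarrow> (real^'n) \<times> real \<Rightarrow> real^'n" where
  "spatial_gradient \<phi> z = (\<chi> i. frechet_derivative \<phi> (at z) (axis i 1, 0))"

definition time_derivative :: "((real^'n) \<times> real \<Rightarrow> real) \<Rightarrow> (real^'n) \<times> real \<Rightarrow> real" where
  "time_derivative \<phi> z = frechet_derivative \<phi> (at z) (0, 1)"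

text \<open>Membership of an extended real valued \<open>u\<close> in $C([t_1,t_2];L^2(U))$ includes
  finiteness almost everywhere on each time slice; this is the second conjunct below.  Since
  \<open>real_of_ereal\<close> sends the infinite values to 0, it then only changes \<open>u\<close> on null sets.
  In the integral equation \<open>g\<close> is the weak gradient of \<open>u\<close>, which is unique up to null sets.\<close>

definition weak_solution ::
    "real \<Rightarrow> ((real^'n) \<times> real) set \<Rightarrow> ((real^'n) \<times> real \<Rightarrow> ereal) \<Rightarrow> bool" where
  "weak_solution p \<Theta> u \<longleftrightarrow>
     (\<forall>U t1 t2. open U \<and> t1 < t2 \<and> compactly_contained (U \<times> {t1<..<t2}) \<Theta> \<longrightarrow>
        continuous_into_L2 U t1 t2 (\<lambda>z. real_of_ereal (u z)) \<and>
        (\<forall>t\<in>{t1..t2}. AE x in lebesgue. x \<in> U \<longrightarrow> \<bar>u (x, t)\<bar> \<noteq> \<infinity>) \<and>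
        (\<exists>g. parabolic_Sobolev p U t1 t2 (\<lambda>z. real_of_ereal (u z)) g \<and>
           (\<forall>\<phi>. test_function (U \<times> {t1<..<t2}) \<phi> \<longrightarrow>
              (LINT z:U \<times> {t1<..<t2}|lebesgue.
                 norm (g z) powr (p - 2) * (g z \<bullet> spatial_gradient \<phi> z)) -
              (LINT z:U \<times> {t1<..<t2}|lebesgue.
                 real_of_ereal (u z) * time_derivative \<phi> z) = 0)))"

text \<open>Continuity is understood as for finite-valued functions.\<close>

definition p_parabolic ::
    "real \<Rightarrow> ((real^'n) \<times> real) set \<Rightarrow> ((real^'n) \<times> real \<Rightarrow> real) \<Rightarrow> bool" where
  "p_parabolic p \<Theta> h \<longleftrightarrow> continuous_on \<Theta> h \<and> weak_solution p \<Theta> (\<lambda>z. ereal (h z))"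

definition parabolic_boundary :: "(real^'n) set \<Rightarrow> real \<Rightarrow> real \<Rightarrow> ((real^'n) \<times> real) set" where
  "parabolic_boundary Q t1 t2 = closure Q \<times> {t1} \<union> frontier Q \<times> {t1<..t2}"

definition p_superparabolic ::
    "real \<Rightarrow> ((real^'n) \<times> real) set \<Rightarrow> ((real^'n) \<times> real \<Rightarrow> ereal) \<Rightarrow> bool" where
  "p_superparabolic p \<Theta> u \<longleftrightarrow>
     (\<forall>z\<in>\<Theta>. u z \<noteq> -\<infinity>) \<and>
     (\<forall>c. openin (top_of_set \<Theta>) {z \<in> \<Theta>. c < u z}) \<and>
     \<Theta> \<subseteq> closure {z \<in> \<Theta>. u z \<noteq> \<infinity>} \<and>
     (\<forall>a b t1 t2 h. (\<forall>i. a $ i < b $ i) \<and> t1 < t2 \<and>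
        compactly_contained (box a b \<times> {t1<..<t2}) \<Theta> \<and>
        p_parabolic p (box a b \<times> {t1<..<t2}) h \<and>
        continuous_on (closure (box a b \<times> {t1<..<t2})) h \<and>
        (\<forall>z\<in>parabolic_boundary (box a b) t1 t2. ereal (h z) \<le> u z) \<longrightarrow>
        (\<forall>z\<in>box a b \<times> {t1<..<t2}. ereal (h z) \<le> u z))"

definition p_subparabolic ::
    "real \<Rightarrow> ((real^'n) \<times> real) set \<Rightarrow> ((real^'n) \<times> real \<Rightarrow> ereal) \<Rightarrow> bool" where
  "p_subparabolic p \<Theta> v \<longleftrightarrow> p_superparabolic p \<Theta> (\<lambda>z. - v z)"

section \<open>Perron solutions\<close>

definition upper_class ::
    "real \<Rightarrow> ((real^'n) \<times> real) set \<Rightarrow> ((real^'n) \<times> real \<Rightarrow> real) \<Rightarrow>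
     ((real^'n) \<times> real \<Rightarrow> ereal) set" where
  "upper_class p \<Theta> f = {u. p_superparabolic p \<Theta> u \<and>
     (\<forall>\<xi>\<in>frontier \<Theta>. Liminf (at \<xi> within \<Theta>) u \<ge> ereal (f \<xi>))}"

definition lower_class ::
    "real \<Rightarrow> ((real^'n) \<times> real) set \<Rightarrow> ((real^'n) \<times> real \<Rightarrow> real) \<Rightarrow>
     ((real^'n) \<times> real \<Rightarrow> ereal) set" where
  "lower_class p \<Theta> f = {v. p_subparabolic p \<Theta> v \<and>
     (\<forall>\<xi>\<in>frontier \<Theta>. Limsup (at \<xi> within \<Theta>) v \<le> ereal (f \<xi>))}"

definition upper_Perron ::
    "real \<Rightarrow> ((real^'n) \<times> real) set \<Rightarrow> ((real^'n) \<times> real \<Rightarrow> real) \<Rightarrow> (real^'n) \<times> real \<Rightarrow> ereal" where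
  "upper_Perron p \<Theta> f \<xi> = (INF u\<in>upper_class p \<Theta> f. u \<xi>)"

definition lower_Perron ::
    "real \<Rightarrow> ((real^'n) \<times> real) set \<Rightarrow> ((real^'n) \<times> real \<Rightarrow> real) \<Rightarrow> (real^'n) \<times> real \<Rightarrow> ereal" where
  "lower_Perron p \<Theta> f \<xi> = (SUP v\<in>lower_class p \<Theta> f. v \<xi>)"

definition Theta_domain :: "real \<Rightarrow> real \<Rightarrow> ((real^'n) \<times> real) set" where
  "Theta_domain l \<theta> = {(x, t). 0 < - t \<and> - t < \<theta> * norm x powr l \<and> \<theta> * norm x powr l < \<theta>}"

end

theory Submission
  imports Defs
begin

text \<open>With \<open>q = p / (p - 1)\<close> and \<open>c = n (k q)\<^sup>p\<^sup>-\<^sup>1\<close> the function \<open>w(x, t) = k |x|\<^sup>q + c t\<close> and its negative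
  solve the equation. On the lateral boundary \<open>- t = \<theta> |x|\<^sup>p\<close> it equals \<open>k |x|\<^sup>q - c \<theta> |x|\<^sup>p\<close>, which is
  nonnegative up to the radius \<open>s\<close> where it attains its maximum; since \<open>p > 2\<close>, this maximum is the
  constant of the theorem for every \<open>k\<close>, while \<open>s\<close> tends to 0 as \<open>k\<close> grows. Hence \<open>min w M\<close>,
  continued by \<open>M\<close> outside \<open>|x| < s\<close>, is a barrier that controls the boundary values away from the
  origin and vanishes at the origin.

  For the upper bound this barrier must be superparabolic, which is the comparison principle for
  weak solutions (mollify the difference of the equations and test with powers of the positive
  part). For the lower bound every superparabolic function in the upper class must lie above the
  negative barrier; there is no comparison between super- and subparabolic functions available, but
  touching from below by radial solutions with a shifted center suffices.\<close>

section \<open>Smooth bump functions\<close>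

text \<open>On the lateral boundary put y = k q |x|^q. Since q (p - 1) = p, the value k |x|^q - c
  \<theta> |x|^p becomes y / q - n \<theta> y^(p-1), in which k occurs only through y. For p > 2 its
  maximum over y is attained at y^(p-2) = 1 / (n p \<theta>) and equals (p - 2) / p times that y.
  This is the constant \<open>M\<close>, and prescribing the radius \<open>s\<close> of the maximum
  merely fixes k. For the upper bound the barrier itself is a competitor. The lower bound concerns
  an arbitrary superparabolic function, which is only lower semicontinuous and has no gradient to
  test with. Its definition permits comparison with parabolic functions in boxes only, so the
  argument is localized at a minimum point, where the radial profile has to be perturbed to gain
  strictness. The lower bound also takes two rounds: the sphere |x| = s can meet the interior of the
  domain, where no boundary data are given, so a crude bound in the whole domain has to come before
  the comparison near the origin. The lower Perron solution is treated by replacing f by -f.\<close>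

definition exp_bump :: "nat \<Rightarrow> real \<Rightarrow> real" where
  "exp_bump n s = (if s > 0 then (1 / s) ^ n * exp (- (1 / s)) else 0)"

lemma exp_bump_tendsto_0: "(exp_bump n \<longlongrightarrow> 0) (at 0)"
proof -
  have "((\<lambda>s::real. inverse s ^ n / exp (inverse s)) \<longlongrightarrow> 0) (at_right 0)"
    using filterlim_compose[OF tendsto_power_div_exp_0 filterlim_inverse_at_top_right] .
  then have r: "(exp_bump n \<longlongrightarrow> 0) (at_right 0)"
  proof (rule Lim_transform_eventually)
    show "\<forall>\<^sub>F s in at_right 0. inverse s ^ n / exp (inverse s) = exp_bump n s"
      by (auto simp: eventually_at_right_less exp_bump_def exp_minus field_simps
          intro!: eventually_at_rightI[of 0 1])
  qed
  have l: "(exp_bump n \<longlongrightarrow> 0) (at_left 0)"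
    by (rule Lim_transform_eventually[OF tendsto_const])
      (auto simp: exp_bump_def intro!: eventually_at_leftI[of "-1" 0])
  show ?thesis using l r by (simp add: filterlim_at_split)
qed

text \<open>Differentiating s^(-n) e^(-1/s) yields terms of the same form with indices n + 2 and n +
  1. This closure lets smoothness of all orders be proved by one induction with \<open>n\<close>
  arbitrary.\<close>

lemma exp_bump_deriv:
  "(exp_bump n has_real_derivative exp_bump (n + 2) s - real n * exp_bump (n + 1) s) (at s)"
proof -
  consider "s < 0" | "s = 0" | "s > 0" by linarith
  then show ?thesis
  proof cases
    case 1
    have "((\<lambda>_. 0) has_real_derivative 0) (at s)" by simp
    then have "(exp_bump n has_real_derivative 0) (at s)"
      by (rule DERIV_cong_ev[THEN iffD1, rotated -1])
        (use 1 in \<open>auto simp: exp_bump_def intro!: eventually_mono[OF order_tendstoD(2)[OF tendsto_ident_at]]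
           eventually_nhds_in_open[of "{..<0}", THEN eventually_mono]\<close>)
    with 1 show ?thesis by (simp add: exp_bump_def)
  next
    case 2
    \<comment> \<open>Dividing by \<open>h\<close> raises the index by one: the difference quotient
      at 0 is \<open>exp_bump (Suc n)\<close>.\<close>
    have "((\<lambda>h. (exp_bump n (0 + h) - exp_bump n 0) / h) \<longlongrightarrow> 0) (at 0)"
      by (rule Lim_transform_eventually[OF exp_bump_tendsto_0[of "Suc n"]])
        (auto simp: exp_bump_def eventually_at_filter)
    with 2 show ?thesis by (simp add: DERIV_def exp_bump_def)
  next
    case 3
    have "((\<lambda>s. (1 / s) ^ n * exp (- (1 / s))) has_real_derivative
        exp_bump (n + 2) s - real n * exp_bump (n + 1) s) (at s)"
    proof (cases n)
      case 0
      then show ?thesis using 3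
        by (auto intro!: derivative_eq_intros simp: exp_bump_def field_simps power2_eq_square)
    next
      case (Suc m)
      show ?thesis unfolding Suc
        by (rule derivative_eq_intros refl | use 3 in \<open>simp; fail\<close>)+
          (use 3 in \<open>simp add: exp_bump_def field_simps power2_eq_square\<close>)
    qed
    then show ?thesis
      by (rule DERIV_cong_ev[THEN iffD1, rotated -1])
        (use 3 in \<open>auto simp: exp_bump_def
           intro!: eventually_nhds_in_open[of "{0<..}", THEN eventually_mono]\<close>)
  qed
qed

lemma exp_bump_continuous: "continuous_on UNIV (exp_bump n)"
  by (meson DERIV_continuous_on exp_bump_deriv has_field_derivative_at_within)

lemma exp_bump_nonneg: "exp_bump n s \<ge> 0"
  by (simp add: exp_bump_def)

section \<open>Calculus of \<open>Ck\<close> functions and smoothness of the bumps\<close>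

lemma Ck_continuous: "Ck k f \<Longrightarrow> continuous_on UNIV f"
  by (cases k) (auto simp: continuous_on_eq_continuous_at intro: differentiable_imp_continuous_within)

lemma Ck_Suc: "Ck (Suc k) f \<Longrightarrow> Ck k f"
proof (induction k arbitrary: f)
  case 0
  then show ?case using Ck_continuous[of 1 f] by simp
next
  case (Suc k)
  have "Ck k (\<lambda>x. frechet_derivative f (at x) b)" if "b \<in> Basis" for b
    by (rule Suc.IH) (use Suc.prems that in simp)
  then show ?case using Suc.prems by simp
qed

lemma Ck_const: "Ck k (\<lambda>x. c)"
  by (induction k arbitrary: c) (auto simp: frechet_derivative_const)

lemma Ck_add: "Ck k f \<Longrightarrow> Ck k g \<Longrightarrow> Ck k (\<lambda>x. f x + g x)"
proof (induction k arbitrary: f g)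
  case 0
  then show ?case by (auto intro: continuous_intros)
next
  case (Suc k)
  have d: "f differentiable (at x)" "g differentiable (at x)" for x
    using Suc.prems by auto
  have fd: "frechet_derivative (\<lambda>x. f x + g x) (at x) b =
      frechet_derivative f (at x) b + frechet_derivative g (at x) b" for x b
    using has_derivative_add[OF d[unfolded frechet_derivative_works], THEN frechet_derivative_at]
    by (metis (no_types, lifting))
  show ?case
    unfolding Ck.simps fd using d Suc by auto
qed

lemma Ck_mult: "Ck k f \<Longrightarrow> Ck k g \<Longrightarrow> Ck k (\<lambda>x. f x * g x)"
proof (induction k arbitrary: f g)
  case 0
  then show ?case by (auto intro: continuous_intros)
next
  case (Suc k)
  have d: "f differentiable (at x)" "g differentiable (at x)" for x
    using Suc.prems by auto
  have "Ck k f" "Ck k g" using Suc.prems Ck_Suc by blast+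
  have fd: "frechet_derivative (\<lambda>x. f x * g x) (at x) b =
      f x * frechet_derivative g (at x) b + frechet_derivative f (at x) b * g x" for x b
    using has_derivative_mult[OF d[unfolded frechet_derivative_works], THEN frechet_derivative_at]
    by (metis (no_types, lifting))
  show ?case
    unfolding Ck.simps fd
    using d Suc.prems \<open>Ck k f\<close> \<open>Ck k g\<close> by (auto intro!: Ck_add Suc.IH differentiable_mult)
qed

lemma Ck_inner: "Ck k (\<lambda>x. (x0 - x) \<bullet> b)"
proof (cases k)
  case 0
  then show ?thesis by (auto intro!: continuous_intros)
next
  case (Suc j)
  have d: "((\<lambda>x. (x0 - x) \<bullet> b) has_derivative (\<lambda>h. - h \<bullet> b)) (at x)" for x
    by (auto intro!: derivative_eq_intros)
  have "frechet_derivative (\<lambda>x. (x0 - x) \<bullet> b) (at x) = (\<lambda>h. - h \<bullet> b)" for x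
    using frechet_derivative_at[OF d] by simp
  then show ?thesis using d by (auto simp: Suc Ck_const differentiable_def)
qed

text \<open>The kernels are tested as functions of the integration variable, hence the reflected
  argument \<open>x0 - x\<close>. The free \<open>a\<close> and \<open>C\<close> cover both the
  space-time kernel and its restriction to a time slice, where the squared radius is reduced by the
  squared time distance.\<close>

lemma exp_bump_comp_deriv:
  fixes x0 x :: "'a::euclidean_space"
  shows "((\<lambda>x. C * exp_bump n (a - (x0 - x) \<bullet> (x0 - x))) has_derivative
    (\<lambda>h. C * ((exp_bump (n + 2) (a - (x0 - x) \<bullet> (x0 - x)) -
        real n * exp_bump (n + 1) (a - (x0 - x) \<bullet> (x0 - x))) * (2 * ((x0 - x) \<bullet> h))))) (at x)"
proof -
  have "((\<lambda>x. a - (x0 - x) \<bullet> (x0 - x)) has_derivative (\<lambda>h. 2 * ((x0 - x) \<bullet> h))) (at x)"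
    by (auto intro!: derivative_eq_intros simp: inner_commute)
  from has_derivative_compose[OF this, of "exp_bump n"] exp_bump_deriv[of n "a - (x0 - x) \<bullet> (x0 - x)"]
  have "((\<lambda>x. exp_bump n (a - (x0 - x) \<bullet> (x0 - x))) has_derivative
    (\<lambda>h. (exp_bump (n + 2) (a - (x0 - x) \<bullet> (x0 - x)) -
        real n * exp_bump (n + 1) (a - (x0 - x) \<bullet> (x0 - x))) * (2 * ((x0 - x) \<bullet> h)))) (at x)"
    by (auto simp: has_field_derivative_def)
  then show ?thesis by (rule has_derivative_mult_right)
qed

text \<open>Each derivative is a combination of bumps of higher index multiplied by an affine
  function, so the induction runs with \<open>n\<close> and \<open>C\<close> arbitrary and
  \<open>Ck_mult\<close> absorbs the products.\<close>

lemma Ck_exp_bump_comp: 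
  fixes x0 :: "'a::euclidean_space"
  shows "Ck k (\<lambda>x. C * exp_bump n (a - (x0 - x) \<bullet> (x0 - x)))"
proof (induction k arbitrary: n C)
  case 0
  have "continuous_on UNIV (exp_bump n \<circ> (\<lambda>x. a - (x0 - x) \<bullet> (x0 - x)))"
    by (intro continuous_on_compose continuous_intros continuous_on_subset[OF exp_bump_continuous]) auto
  then show ?case by (auto intro: continuous_intros simp: o_def)
next
  case (Suc k)
  have fd: "frechet_derivative (\<lambda>x. C * exp_bump n (a - (x0 - x) \<bullet> (x0 - x))) (at x) b =
     (C * exp_bump (n + 2) (a - (x0 - x) \<bullet> (x0 - x)) +
        (- C * real n) * exp_bump (n + 1) (a - (x0 - x) \<bullet> (x0 - x))) * (2 * ((x0 - x) \<bullet> b))" for x b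
    by (subst frechet_derivative_at[OF exp_bump_comp_deriv, symmetric]) (simp add: algebra_simps)
  show ?case
    unfolding Ck.simps fd
    by (intro conjI allI ballI Ck_mult Ck_add Suc.IH Ck_const Ck_inner differentiableI[OF exp_bump_comp_deriv])
qed

lemma frechet_exp_bump_comp:
  fixes x0 :: "'a::euclidean_space"
  shows "frechet_derivative (\<lambda>x. C * exp_bump 0 (a - (x0 - x) \<bullet> (x0 - x))) (at x) h =
     C * (exp_bump 2 (a - (x0 - x) \<bullet> (x0 - x)) * (2 * ((x0 - x) \<bullet> h)))"
  by (subst frechet_derivative_at[OF exp_bump_comp_deriv, symmetric]) (simp add: numeral_2_eq_2)

section \<open>Continuity of translations and integration by parts\<close>

lemma integral_lborel_shift:
  fixes f :: "'a::euclidean_space \<Rightarrow> 'b::{banach, second_countable_topology}"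
  assumes [measurable]: "f \<in> borel_measurable borel"
  shows "integral\<^sup>L lborel (\<lambda>z. f (z + s)) = integral\<^sup>L lborel f"
proof -
  have "integral\<^sup>L lborel f = integral\<^sup>L (distr lborel borel ((+) s)) f"
    by (simp add: lborel_distr_plus)
  also have "\<dots> = integral\<^sup>L lborel (\<lambda>z. f (s + z))"
    by (subst integral_distr) auto
  finally show ?thesis by (simp add: add.commute)
qed

lemma integrable_lborel_shift:
  fixes f :: "'a::euclidean_space \<Rightarrow> 'b::{banach, second_countable_topology}"
  assumes f: "integrable lborel f"
  shows "integrable lborel (\<lambda>z. f (z + s))"
proof -
  have "integrable (distr lborel borel ((+) s)) f"
    using f by (simp add: lborel_distr_plus)
  then have "integrable lborel (\<lambda>z. f (s + z))"
    by (subst (asm) integrable_distr_eq) (use f in auto)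
  then show ?thesis by (simp add: add.commute)
qed

lemma nn_integral_lborel_reflect:
  fixes f :: "'a::euclidean_space \<Rightarrow> ennreal"
  assumes [measurable]: "f \<in> borel_measurable borel"
  shows "(\<integral>\<^sup>+y. f (z - y) \<partial>lborel) = (\<integral>\<^sup>+y. f y \<partial>lborel)"
proof -
  have "(lborel :: 'a measure) = distr lborel borel (\<lambda>y. z + (-1) *\<^sub>R y)"
    using lborel_affine[of "-1" z] by (simp add: density_1)
  then have "(\<integral>\<^sup>+y. f y \<partial>lborel) = (\<integral>\<^sup>+y. f y \<partial>distr lborel borel (\<lambda>y. z + (-1) *\<^sub>R y))"
    by simp
  also have "\<dots> = (\<integral>\<^sup>+y. f (z - y) \<partial>lborel)"
    by (subst nn_integral_distr) auto
  finally show ?thesis by simp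
qed

lemma integral_lborel_reflect:
  fixes f :: "'a::euclidean_space \<Rightarrow> real"
  assumes [measurable]: "f \<in> borel_measurable borel"
  shows "(\<integral>y. f (z - y) \<partial>lborel) = (\<integral>y. f y \<partial>lborel)"
proof -
  have "(lborel :: 'a measure) = distr lborel borel (\<lambda>y. z + (-1) *\<^sub>R y)"
    using lborel_affine[of "-1" z] by (simp add: density_1)
  then have "(\<integral>y. f y \<partial>lborel) = (\<integral>y. f y \<partial>distr lborel borel (\<lambda>y. z + (-1) *\<^sub>R y))"
    by simp
  also have "\<dots> = (\<integral>y. f (z - y) \<partial>lborel)"
    by (subst integral_distr) auto
  finally show ?thesis by simp
qed

text \<open>Continuity of translations in the L1 norm at shift 0. The Bochner integral is 0 by
  default for non-integrable functions, so the property is meant for integrable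
  \<open>f\<close>.\<close>

definition shift_cont :: "('a::euclidean_space \<Rightarrow> real) \<Rightarrow> bool" where
  "shift_cont f \<longleftrightarrow> (\<forall>e>0. \<exists>d>0. \<forall>s. norm s < d \<longrightarrow> (\<integral>z. \<bar>f (z + s) - f z\<bar> \<partial>lborel) \<le> e)"

text \<open>An \<epsilon>/3 argument: by translation invariance the error between the shifted
  \<open>f\<close> and the shifted \<open>g\<close> equals the unshifted one, so it does not depend
  on the shift.\<close>

lemma shift_cont_closed:
  assumes f: "integrable lborel f"
    and appr: "\<And>e. e > 0 \<Longrightarrow> \<exists>g. integrable lborel g \<and> shift_cont g \<and> (\<integral>z. \<bar>f z - g z\<bar> \<partial>lborel) \<le> e"
  shows "shift_cont f"
  unfolding shift_cont_def
proof (intro allI impI)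
  fix e :: real assume "e > 0"
  then obtain g where g: "integrable lborel g" "shift_cont g" "(\<integral>z. \<bar>f z - g z\<bar> \<partial>lborel) \<le> e / 3"
    using appr[of "e/3"] by auto
  obtain d where d: "d > 0" "\<And>s. norm s < d \<Longrightarrow> (\<integral>z. \<bar>g (z + s) - g z\<bar> \<partial>lborel) \<le> e / 3"
    using g(2) \<open>e > 0\<close> unfolding shift_cont_def by (metis divide_pos_pos zero_less_numeral)
  have "(\<integral>z. \<bar>f (z + s) - f z\<bar> \<partial>lborel) \<le> e" if "norm s < d" for s
  proof -
    note [intro] = integrable_lborel_shift f g(1)
    have [measurable]: "f \<in> borel_measurable borel" "g \<in> borel_measurable borel"
      using f g by auto
    have "(\<integral>z. \<bar>f (z + s) - f z\<bar> \<partial>lborel) \<le>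
       (\<integral>z. \<bar>f (z + s) - g (z + s)\<bar> + \<bar>g (z + s) - g z\<bar> + \<bar>f z - g z\<bar> \<partial>lborel)"
      by (rule integral_mono) (auto intro!: integrable_lborel_shift f g Bochner_Integration.integrable_add
          Bochner_Integration.integrable_diff integrable_abs)
    also have "\<dots> = (\<integral>z. \<bar>f (z + s) - g (z + s)\<bar> \<partial>lborel) + (\<integral>z. \<bar>g (z + s) - g z\<bar> \<partial>lborel)
        + (\<integral>z. \<bar>f z - g z\<bar> \<partial>lborel)"
      by (subst Bochner_Integration.integral_add, (auto intro!: integrable_lborel_shift f g Bochner_Integration.integrable_add
          Bochner_Integration.integrable_diff integrable_abs)[2])+ simp
    also have "(\<integral>z. \<bar>f (z + s) - g (z + s)\<bar> \<partial>lborel) = (\<integral>z. \<bar>f z - g z\<bar> \<partial>lborel)"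
      by (rule integral_lborel_shift[where f="\<lambda>z. \<bar>f z - g z\<bar>"]) simp
    finally show ?thesis using g(3) d(2)[OF that] by linarith
  qed
  then show "\<exists>d>0. \<forall>s. norm s < d \<longrightarrow> (\<integral>z. \<bar>f (z + s) - f z\<bar> \<partial>lborel) \<le> e"
    using d(1) by blast
qed

text \<open>A point of an open set remains in it under small shifts, so dominated convergence
  controls the part of \<open>U\<close> lost by the shift. The part gained has the same measure,
  because \<open>U\<close> and its translate have.\<close>

lemma shift_cont_open:
  fixes U :: "'a::euclidean_space set"
  assumes U: "open U" "emeasure lborel U < \<infinity>"
  shows "shift_cont (indicator U)"
proof -
  have [measurable]: "U \<in> sets borel" using U by auto
  have int: "integrable lborel (indicator U :: 'a \<Rightarrow> real)"
    using U by (auto simp: integrable_indicator_iff)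
  have eq: "(\<integral>z. \<bar>indicator U (z + s) - indicator U z :: real\<bar> \<partial>lborel) =
      2 * (\<integral>z. indicator U z * (1 - indicator U (z + s)) \<partial>lborel)" for s :: 'a
  proof -
    have i1: "integrable lborel (\<lambda>z. indicator U (z + s) :: real)"
      by (rule integrable_lborel_shift[OF int])
    have i2: "integrable lborel (\<lambda>z. indicator U z * (1 - indicator U (z + s)) :: real)"
      by (rule Bochner_Integration.integrable_bound[OF int]) (auto simp: indicator_def)
    \<comment> \<open>For a, b in {0, 1} one has |a - b| = 2 b (1 - a) + (a - b), and the last
      bracket integrates to 0 by translation invariance.\<close>
    have "(\<integral>z. \<bar>indicator U (z + s) - indicator U z :: real\<bar> \<partial>lborel) =
      (\<integral>z. 2 * (indicator U z * (1 - indicator U (z + s))) + (indicator U (z + s) - indicator U z) \<partial>lborel)"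
      by (rule Bochner_Integration.integral_cong) (auto simp: indicator_def)
    also have "\<dots> = 2 * (\<integral>z. indicator U z * (1 - indicator U (z + s)) \<partial>lborel)
       + ((\<integral>z. indicator U (z + s) \<partial>lborel) - (\<integral>z. indicator U z \<partial>lborel))"
      using i1 i2 int by simp
    also have "(\<integral>z. indicator U (z + s) \<partial>lborel) = (\<integral>z. indicator U z \<partial>lborel :: real)"
      by (rule integral_lborel_shift) simp
    finally show ?thesis by simp
  qed
  have lim: "((\<lambda>s. \<integral>z. indicator U z * (1 - indicator U (z + s)) \<partial>lborel :: real) \<longlongrightarrow> 0) (at 0)"
  proof (rule tendsto_at_iff_sequentially[THEN iffD2], safe)
    fix X :: "nat \<Rightarrow> 'a" assume "X \<longlonglongrightarrow> 0"
    have "(\<lambda>n. \<integral>z. indicator U z * (1 - indicator U (z + X n)) \<partial>lborel) \<longlonglongrightarrow> (\<integral>z. 0 \<partial>(lborel::'a measure) :: real)"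
    proof (rule integral_dominated_convergence[where w="indicator U"])
      show "AE z in lborel. (\<lambda>n. indicator U z * (1 - indicator U (z + X n))) \<longlonglongrightarrow> (0::real)"
      proof (rule AE_I2)
        fix z
        have "(\<lambda>n. z + X n) \<longlonglongrightarrow> z + 0" by (intro tendsto_intros \<open>X \<longlonglongrightarrow> 0\<close>)
        then have "\<forall>\<^sub>F n in sequentially. z \<in> U \<longrightarrow> z + X n \<in> U"
          using U(1) by (auto dest: topological_tendstoD elim: eventually_mono)
        then show "(\<lambda>n. indicator U z * (1 - indicator U (z + X n))) \<longlonglongrightarrow> (0::real)"
          by (rule tendsto_eventually[OF eventually_mono]) (auto simp: indicator_def)
      qed
    qed (use int in \<open>auto simp: indicator_def\<close>)
    then show "((\<lambda>s. \<integral>z. indicator U z * (1 - indicator U (z + s)) \<partial>lborel) \<circ> X) \<longlonglongrightarrow> (0::real)"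
      by (simp add: o_def)
  qed
  show ?thesis unfolding shift_cont_def
  proof (intro allI impI)
    fix e :: real assume "e > 0"
    from lim[THEN tendstoD, of "e/2"] this obtain d where d: "d > 0"
      "\<And>s. s \<noteq> 0 \<Longrightarrow> norm s < d \<Longrightarrow> \<bar>\<integral>z. indicator U z * (1 - indicator U (z + s)) \<partial>lborel\<bar> < e / 2"
      unfolding eventually_at by (auto simp: dist_norm)
    then have "(\<integral>z. \<bar>indicator U (z + s) - indicator U z\<bar> \<partial>lborel) \<le> e" if "norm s < d" for s
      using that \<open>e > 0\<close> eq[of s] by (cases "s = 0") force+
    then show "\<exists>d>0. \<forall>s. norm s < d \<longrightarrow> (\<integral>z. \<bar>indicator U (z + s) - indicator U z\<bar> \<partial>lborel) \<le> e"
      using d(1) by blast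
  qed
qed

lemma shift_cont_scale: "shift_cont f \<Longrightarrow> shift_cont (\<lambda>x. f x * c)"
proof (cases "c = 0")
  case True
  then show ?thesis by (auto simp: shift_cont_def intro: exI[of _ 1])
next
  case False
  assume f: "shift_cont f"
  show ?thesis unfolding shift_cont_def
  proof (intro allI impI)
    fix e :: real assume "e > 0"
    then have "e / \<bar>c\<bar> > 0" using False by simp
    then obtain d where d: "d > 0" "\<And>s. norm s < d \<Longrightarrow> (\<integral>z. \<bar>f (z + s) - f z\<bar> \<partial>lborel) \<le> e / \<bar>c\<bar>"
      using f unfolding shift_cont_def by blast
    have "(\<integral>z. \<bar>f (z + s) * c - f z * c\<bar> \<partial>lborel) = (\<integral>z. \<bar>f (z + s) - f z\<bar> \<partial>lborel) * \<bar>c\<bar>" for s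
      by (simp add: left_diff_distrib[symmetric] abs_mult)
    then show "\<exists>d>0. \<forall>s. norm s < d \<longrightarrow> (\<integral>z. \<bar>f (z + s) * c - f z * c\<bar> \<partial>lborel) \<le> e"
      using d False by (auto simp: field_simps)
  qed
qed

text \<open>Indicators of measurable sets are approximated by those of open supersets through outer
  regularity; scaling, sums and dominated limits then reach every integrable function.\<close>

lemma integrable_imp_shift_cont:
  fixes f :: "'a::euclidean_space \<Rightarrow> real"
  assumes "integrable lborel f"
  shows "shift_cont f"
  using assms
proof (induction rule: integrable_induct)
  case (base A c)
  have [measurable]: "A \<in> sets borel" using base by simp
  have iA: "integrable lborel (indicator A :: 'a \<Rightarrow> real)"
    using base by (auto simp: integrable_indicator_iff)
  have "shift_cont (indicator A)"
  proof (rule shift_cont_closed[OF iA])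
    fix e :: real assume e: "e > 0"
    then obtain U where U: "open U" "A \<subseteq> U" "emeasure lborel (U - A) < ennreal e"
      using outer_regular_lborel[of A e] by auto
    have [measurable]: "U \<in> sets borel" using U by auto
    have "emeasure lborel U \<le> emeasure lborel A + emeasure lborel (U - A)"
      using emeasure_subadditive[of A lborel "U - A"] U(2) by (simp add: Un_absorb1)
    also have "\<dots> < \<infinity>" using base U(3) e
      by (simp add: ennreal_add_eq_top less_top) (metis ennreal_less_top order_less_trans)
    finally have Uf: "emeasure lborel U < \<infinity>" .
    have iU: "integrable lborel (indicator U :: 'a \<Rightarrow> real)"
      using Uf by (auto simp: integrable_indicator_iff)
    have "(\<integral>z. \<bar>indicator A z - indicator U z\<bar> \<partial>lborel) = (\<integral>z. indicator (U - A) z \<partial>lborel :: real)"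
      by (rule Bochner_Integration.integral_cong) (use U(2) in \<open>auto simp: indicator_def\<close>)
    also have "\<dots> = measure lborel (U - A)" by simp
    also have "\<dots> \<le> e"
      using U(3) e unfolding measure_def by (metis enn2real_leI ennreal_enn2real_if less_imp_le order.strict_implies_order)
    finally show "\<exists>g. integrable lborel g \<and> shift_cont g \<and> (\<integral>z. \<bar>indicator A z - g z\<bar> \<partial>lborel) \<le> e"
      using iU shift_cont_open[OF U(1) Uf] by blast
  qed
  from shift_cont_scale[OF this, of c] show ?case by simp
next
  case (add f g)
  show ?case unfolding shift_cont_def
  proof (intro allI impI)
    fix e :: real assume "e > 0"
    then have "e / 2 > 0" by simp
    then obtain d d' where d: "d > 0" "\<And>s. norm s < d \<Longrightarrow> (\<integral>z. \<bar>f (z + s) - f z\<bar> \<partial>lborel) \<le> e / 2"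
      and d': "d' > 0" "\<And>s. norm s < d' \<Longrightarrow> (\<integral>z. \<bar>g (z + s) - g z\<bar> \<partial>lborel) \<le> e / 2"
      using add.IH unfolding shift_cont_def by blast
    have "(\<integral>z. \<bar>f (z + s) + g (z + s) - (f z + g z)\<bar> \<partial>lborel) \<le> e" if "norm s < min d d'" for s
    proof -
      have i: "integrable lborel (\<lambda>z. \<bar>f (z + s) - f z\<bar>)" "integrable lborel (\<lambda>z. \<bar>g (z + s) - g z\<bar>)"
        "integrable lborel (\<lambda>z. \<bar>f (z + s) + g (z + s) - (f z + g z)\<bar>)"
        using add by (auto intro!: integrable_lborel_shift Bochner_Integration.integrable_add
          Bochner_Integration.integrable_diff integrable_abs)
      have "(\<integral>z. \<bar>f (z + s) + g (z + s) - (f z + g z)\<bar> \<partial>lborel) \<le>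
        (\<integral>z. \<bar>f (z + s) - f z\<bar> + \<bar>g (z + s) - g z\<bar> \<partial>lborel)"
        using i by (intro integral_mono) auto
      also have "\<dots> = (\<integral>z. \<bar>f (z + s) - f z\<bar> \<partial>lborel) + (\<integral>z. \<bar>g (z + s) - g z\<bar> \<partial>lborel)"
        using i by simp
      finally show ?thesis using d(2)[of s] d'(2)[of s] that by simp
    qed
    then show "\<exists>d>0. \<forall>s. norm s < d \<longrightarrow> (\<integral>z. \<bar>f (z + s) + g (z + s) - (f z + g z)\<bar> \<partial>lborel) \<le> e"
      using d(1) d'(1) by (intro exI[of _ "min d d'"]) auto
  qed
next
  case (lim f s)
  have [measurable]: "f \<in> borel_measurable borel" "\<And>i. s i \<in> borel_measurable borel" using lim by auto
  have "(\<lambda>i. \<integral>z. \<bar>f z - s i z\<bar> \<partial>lborel) \<longlonglongrightarrow> (\<integral>z. 0 \<partial>(lborel::'a measure))"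
  \<comment> \<open>The approximants of the induction rule satisfy |s i| \<le> 2 |f|, whence the
    majorant 3 |f| of the difference.\<close>
  proof (rule integral_dominated_convergence[where w="\<lambda>z. 3 * \<bar>f z\<bar>"])
    show "AE x in lborel. (\<lambda>i. \<bar>f x - s i x\<bar>) \<longlonglongrightarrow> 0"
    proof (rule AE_I2)
      fix x
      have "(\<lambda>i. \<bar>f x - s i x\<bar>) \<longlonglongrightarrow> \<bar>f x - f x\<bar>"
        by (intro tendsto_intros) (use lim in auto)
      then show "(\<lambda>i. \<bar>f x - s i x\<bar>) \<longlonglongrightarrow> 0" by simp
    qed
    show "AE x in lborel. norm \<bar>f x - s i x\<bar> \<le> 3 * \<bar>f x\<bar>" for i
    proof (rule AE_I2)
      fix x
      have "norm (s i x) \<le> 2 * norm (f x)" using lim by simp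
      then show "norm \<bar>f x - s i x\<bar> \<le> 3 * \<bar>f x\<bar>" by simp
    qed
  qed (use lim in auto)
  then have l: "(\<lambda>i. \<integral>z. \<bar>f z - s i z\<bar> \<partial>lborel) \<longlonglongrightarrow> 0" by simp
  show ?case
  proof (rule shift_cont_closed)
    fix e :: real assume "e > 0"
    with order_tendstoD(2)[OF l] obtain i where "(\<integral>z. \<bar>f z - s i z\<bar> \<partial>lborel) < e"
      by (meson eventually_sequentially order_refl)
    then show "\<exists>g. integrable lborel g \<and> shift_cont g \<and> (\<integral>z. \<bar>f z - g z\<bar> \<partial>lborel) \<le> e"
      using lim by (intro exI[of _ "s i"]) auto
  qed (use lim in auto)
qed

text \<open>Translation invariance makes the difference quotients integrate to zero.\<close>

lemma integral_directional_derivative_eq_0: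
  fixes F D :: "'a::euclidean_space \<Rightarrow> real"
  assumes deriv: "\<And>z h. ((\<lambda>h. F (z + h *\<^sub>R b)) has_real_derivative D (z + h *\<^sub>R b)) (at h)"
    and cont: "continuous_on UNIV F" "continuous_on UNIV D"
    and supp: "\<And>z. norm z \<ge> R \<Longrightarrow> F z = 0"
  shows "integrable lborel D" "(\<integral>z. D z \<partial>lborel) = 0"
proof -
  have [measurable]: "F \<in> borel_measurable borel" "D \<in> borel_measurable borel"
    using cont by (auto intro: borel_measurable_continuous_onI)
  \<comment> \<open>Difference quotients of step at most 1 in direction \<open>b\<close> vanish
    outside this enlarged ball, so a multiple of its indicator is a common majorant.\<close>
  define R' where "R' = \<bar>R\<bar> + norm b + 1"
  have D0: "D z = 0" if "norm z > R" for z
  proof -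
    have "((\<lambda>h. F (z + h *\<^sub>R b)) has_real_derivative D z) (at 0)" using deriv[of z 0] by simp
    moreover have "((\<lambda>h. F (z + h *\<^sub>R b)) has_real_derivative 0) (at 0)"
    proof (rule DERIV_cong_ev[THEN iffD1, rotated -1, OF DERIV_const[of 0]])
      have "((\<lambda>h. norm (z + h *\<^sub>R b)) \<longlongrightarrow> norm (z + 0 *\<^sub>R b)) (nhds 0)"
        by (intro tendsto_intros filterlim_ident)
      from order_tendstoD(1)[OF this, of R] that 
      show "\<forall>\<^sub>F h in nhds 0. 0 = F (z + h *\<^sub>R b)"
        by (auto elim!: eventually_mono simp: supp)
    qed auto
    ultimately show ?thesis by (rule DERIV_unique)
  qed
  have "bounded (D ` cball 0 \<bar>R\<bar>)"
    by (intro compact_imp_bounded compact_continuous_image continuous_on_subset[OF cont(2)]) auto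
  then obtain B where "\<forall>y\<in>D ` cball 0 \<bar>R\<bar>. norm y \<le> B"
    unfolding bounded_iff by blast
  then have B: "\<bar>D z\<bar> \<le> B" if "z \<in> cball 0 \<bar>R\<bar>" for z
    using that by auto
  have Bp: "0 \<le> B" using B[of 0] abs_ge_zero[of "D 0"] by simp
  have Ball: "\<bar>D z\<bar> \<le> B" for z
    using B[of z] D0[of z] Bp by (cases "norm z \<le> \<bar>R\<bar>") auto
  have "integrable lborel (\<lambda>z. indicator (cball 0 \<bar>R\<bar>) z *\<^sub>R D z)"
    by (rule borel_integrable_compact) (auto intro: continuous_on_subset[OF cont(2)])
  also have "(\<lambda>z. indicator (cball 0 \<bar>R\<bar>) z *\<^sub>R D z) = D"
    by (auto simp: indicator_def D0 fun_eq_iff)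
  finally show "integrable lborel D" .
  have iF: "integrable lborel F"
  proof -
    have "integrable lborel (\<lambda>z. indicator (cball 0 \<bar>R\<bar>) z *\<^sub>R F z)"
      by (rule borel_integrable_compact) (auto intro: continuous_on_subset[OF cont(1)])
    also have "(\<lambda>z. indicator (cball 0 \<bar>R\<bar>) z *\<^sub>R F z) = F"
      by (auto simp: indicator_def supp fun_eq_iff)
    finally show ?thesis .
  qed
  define q where "q n z = (F (z + (1 / Suc n) *\<^sub>R b) - F z) * real (Suc n)" for n :: nat and z
  have q0: "(\<integral>z. q n z \<partial>lborel) = 0" for n
  proof -
    have "(\<integral>z. q n z \<partial>lborel) = ((\<integral>z. F (z + (1 / Suc n) *\<^sub>R b) \<partial>lborel) - (\<integral>z. F z \<partial>lborel)) * real (Suc n)"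
      unfolding q_def
      by (simp only: integral_mult_left_zero Bochner_Integration.integral_diff[OF integrable_lborel_shift[OF iF] iF])
    also have "(\<integral>z. F (z + (1 / Suc n) *\<^sub>R b) \<partial>lborel) = (\<integral>z. F z \<partial>lborel)"
      by (rule integral_lborel_shift) simp
    finally show ?thesis by simp
  qed
  have "(\<lambda>n. \<integral>z. q n z \<partial>lborel) \<longlonglongrightarrow> (\<integral>z. D z \<partial>lborel)"
  proof (rule integral_dominated_convergence[where w="\<lambda>z. B * indicator (cball 0 R') z"])
    show "AE z in lborel. (\<lambda>n. q n z) \<longlonglongrightarrow> D z"
    proof (rule AE_I2)
      fix z
      have "((\<lambda>h. (F (z + h *\<^sub>R b) - F z) / h) \<longlongrightarrow> D z) (at 0)"
        using deriv[of z 0] by (simp add: DERIV_def)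
      moreover have "filterlim (\<lambda>n. 1 / real (Suc n)) (at 0) sequentially"
        using LIMSEQ_inverse_real_of_nat
        by (auto simp: filterlim_at inverse_eq_divide eventually_sequentially)
      ultimately have "(\<lambda>n. (F (z + (1 / real (Suc n)) *\<^sub>R b) - F z) / (1 / real (Suc n))) \<longlonglongrightarrow> D z"
        by (rule filterlim_compose)
      then show "(\<lambda>n. q n z) \<longlonglongrightarrow> D z" by (simp add: q_def)
    qed
    show "AE z in lborel. norm (q n z) \<le> B * indicator (cball 0 R') z" for n
    proof (rule AE_I2)
      fix z :: 'a
      show "norm (q n z) \<le> B * indicator (cball 0 R') z"
      proof (cases "z \<in> cball 0 R'")
        case True
        \<comment> \<open>The mean value theorem turns the quotient into a value of
          \<open>D\<close>, which is bounded independently of \<open>n\<close>.\<close>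
        obtain \<xi> where "F (z + (1 / Suc n) *\<^sub>R b) - F (z + 0 *\<^sub>R b) = (1 / Suc n - 0) * D (z + \<xi> *\<^sub>R b)"
          using MVT2[of 0 "1 / Suc n" "\<lambda>h. F (z + h *\<^sub>R b)" "\<lambda>h. D (z + h *\<^sub>R b)"] deriv by auto
        then have "q n z = D (z + \<xi> *\<^sub>R b)" by (simp add: q_def)
        then show ?thesis using True Ball by simp
      next
        case False
        then have n: "norm z > R'" by simp
        have "norm ((1 / Suc n) *\<^sub>R b) \<le> norm b" by (simp add: field_simps mult_left_le)
        then have "norm (z + (1 / Suc n) *\<^sub>R b) \<ge> norm z - norm b"
          using norm_triangle_ineq2[of z "- ((1 / Suc n) *\<^sub>R b)"] by simp
        with n norm_ge_zero[of b] have "R \<le> norm (z + (1 / Suc n) *\<^sub>R b)" "R \<le> norm z"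
          unfolding R'_def by linarith+
        then have "F (z + (1 / Suc n) *\<^sub>R b) = 0" "F z = 0"
          using supp by blast+
        then show ?thesis using Bp by (simp add: q_def)
      qed
    qed
  qed (auto simp: q_def[abs_def] intro!: integrable_mult_right integrable_real_indicator emeasure_lborel_cball_finite)
  then show "(\<integral>z. D z \<partial>lborel) = 0" using q0 by (simp add: LIMSEQ_const_iff)
qed

section \<open>Mollification\<close>

text \<open>The derivative falls on the kernel, so \<open>f\<close> may be merely integrable. By the
  mean value theorem all difference quotients of \<open>K\<close> are bounded by \<open>B\<close>,
  and B |f| dominates the integrands.\<close>

lemma convolution_has_real_derivative:
  fixes K :: "'a::euclidean_space \<Rightarrow> real" and f :: "'a \<Rightarrow> real"
  assumes f: "integrable lborel f"
    and K: "continuous_on UNIV K" and K': "continuous_on UNIV K'"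
    and bK: "\<And>w. \<bar>K w\<bar> \<le> B" and bK': "\<And>w. \<bar>K' w\<bar> \<le> B"
    and deriv: "\<And>w h. ((\<lambda>h. K (w + h *\<^sub>R b)) has_real_derivative K' (w + h *\<^sub>R b)) (at h)"
  shows "((\<lambda>h. \<integral>y. K (z + h *\<^sub>R b - y) * f y \<partial>lborel) has_real_derivative
      (\<integral>y. K' (z + h *\<^sub>R b - y) * f y \<partial>lborel)) (at h)"
proof -
  have [measurable]: "K \<in> borel_measurable borel" "K' \<in> borel_measurable borel" "f \<in> borel_measurable borel"
    using K K' f by (auto intro: borel_measurable_continuous_onI)
  have iK: "integrable lborel (\<lambda>y. K (z - y) * f y)" for z
    by (rule Bochner_Integration.integrable_bound[OF integrable_mult_right[OF integrable_abs[OF f], of B]])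
      (auto simp: abs_mult intro!: AE_I2 mult_mono order_trans[OF bK])
  have d0: "((\<lambda>h. K (z + h *\<^sub>R b - y)) has_real_derivative K' (z + h *\<^sub>R b - y)) (at h)" for y h
    using deriv[of "z - y" h] by (simp add: algebra_simps)
  show ?thesis unfolding DERIV_def
  proof (rule tendsto_at_iff_sequentially[THEN iffD2], safe)
    fix X :: "nat \<Rightarrow> real" assume X: "\<forall>i. X i \<in> UNIV - {0}" "X \<longlonglongrightarrow> 0"
    let ?q = "\<lambda>n y. (K (z + (h + X n) *\<^sub>R b - y) - K (z + h *\<^sub>R b - y)) / X n * f y"
    have "(\<lambda>n. \<integral>y. ?q n y \<partial>lborel) \<longlonglongrightarrow> (\<integral>y. K' (z + h *\<^sub>R b - y) * f y \<partial>lborel)"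
    proof (rule integral_dominated_convergence[where w="\<lambda>y. B * \<bar>f y\<bar>"])
      show "AE y in lborel. (\<lambda>n. ?q n y) \<longlonglongrightarrow> K' (z + h *\<^sub>R b - y) * f y"
      proof (rule AE_I2)
        fix y
        have "(\<lambda>n. (K (z + (h + X n) *\<^sub>R b - y) - K (z + h *\<^sub>R b - y)) / X n) \<longlonglongrightarrow> K' (z + h *\<^sub>R b - y)"
          using d0[of y h, unfolded DERIV_def tendsto_at_iff_sequentially, rule_format, of X] X
          by (auto simp: o_def)
        then show "(\<lambda>n. ?q n y) \<longlonglongrightarrow> K' (z + h *\<^sub>R b - y) * f y" by (intro tendsto_intros)
      qed
      show "AE y in lborel. norm (?q n y) \<le> B * \<bar>f y\<bar>" for n
      proof (rule AE_I2)
        fix y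
        \<comment> \<open>The increment \<open>X n\<close> can have either sign, whereas
          \<open>MVT2\<close> takes the end points in increasing order.\<close>
        have "\<exists>\<xi>. K (z + (h + X n) *\<^sub>R b - y) - K (z + h *\<^sub>R b - y) = X n * K' (z + \<xi> *\<^sub>R b - y)"
        proof (cases "X n > 0")
          case True
          from MVT2[of h "h + X n" "\<lambda>h. K (z + h *\<^sub>R b - y)" "\<lambda>h. K' (z + h *\<^sub>R b - y)"] True d0
          show ?thesis by (metis add_diff_cancel_left' less_add_same_cancel1)
        next
          case False
          then have "X n < 0" using X(1) by (metis DiffD2 insertI1 linorder_neqE_linordered_idom)
          with MVT2[of "h + X n" h "\<lambda>h. K (z + h *\<^sub>R b - y)" "\<lambda>h. K' (z + h *\<^sub>R b - y)"] d0
          obtain \<xi> where "K (z + h *\<^sub>R b - y) - K (z + (h + X n) *\<^sub>R b - y) = (h - (h + X n)) * K' (z + \<xi> *\<^sub>R b - y)"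
            by (metis add_less_same_cancel1)
          then show ?thesis by (intro exI[of _ \<xi>]) (simp add: algebra_simps)
        qed
        then obtain \<xi> where "K (z + (h + X n) *\<^sub>R b - y) - K (z + h *\<^sub>R b - y) = X n * K' (z + \<xi> *\<^sub>R b - y)"
          by blast
        moreover have "X n \<noteq> 0" using X(1) by auto
        ultimately have "\<bar>(K (z + (h + X n) *\<^sub>R b - y) - K (z + h *\<^sub>R b - y)) / X n\<bar> \<le> B"
          using bK' by simp
        then show "norm (?q n y) \<le> B * \<bar>f y\<bar>"
          unfolding real_norm_def abs_mult by (rule mult_right_mono) simp
      qed
    qed (use f in auto)
    moreover have "(\<integral>y. ?q n y \<partial>lborel) = ((\<integral>y. K (z + (h + X n) *\<^sub>R b - y) * f y \<partial>lborel) -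
        (\<integral>y. K (z + h *\<^sub>R b - y) * f y \<partial>lborel)) / X n" for n
    proof -
      have "(\<integral>y. ?q n y \<partial>lborel) = (\<integral>y. (K (z + (h + X n) *\<^sub>R b - y) * f y - K (z + h *\<^sub>R b - y) * f y) / X n \<partial>lborel)"
        by (rule Bochner_Integration.integral_cong) (auto simp: left_diff_distrib)
      then show ?thesis
        by (simp only: integral_divide_zero Bochner_Integration.integral_diff[OF iK iK])
    qed
    ultimately show "((\<lambda>ha. ((\<integral>y. K (z + (h + ha) *\<^sub>R b - y) * f y \<partial>lborel) -
        (\<integral>y. K (z + h *\<^sub>R b - y) * f y \<partial>lborel)) / ha) \<circ> X) \<longlonglongrightarrow> (\<integral>y. K' (z + h *\<^sub>R b - y) * f y \<partial>lborel)"
      by (simp only: o_def)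
  qed
qed

lemma continuous_on_convolution:
  fixes K :: "'a::euclidean_space \<Rightarrow> real" and f :: "'a \<Rightarrow> real"
  assumes f: "integrable lborel f" and K: "continuous_on UNIV K" and bK: "\<And>w. \<bar>K w\<bar> \<le> B"
  shows "continuous_on UNIV (\<lambda>z. \<integral>y. K (z - y) * f y \<partial>lborel)"
proof (rule continuous_on_sequentiallyI)
  fix X :: "nat \<Rightarrow> 'a" and a assume X: "X \<longlonglongrightarrow> a"
  have [measurable]: "K \<in> borel_measurable borel" "f \<in> borel_measurable borel"
    using K f by (auto intro: borel_measurable_continuous_onI)
  show "(\<lambda>n. \<integral>y. K (X n - y) * f y \<partial>lborel) \<longlonglongrightarrow> (\<integral>y. K (a - y) * f y \<partial>lborel)"
  proof (rule integral_dominated_convergence[where w="\<lambda>y. B * \<bar>f y\<bar>"])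
    show "AE y in lborel. (\<lambda>n. K (X n - y) * f y) \<longlonglongrightarrow> K (a - y) * f y"
    proof (rule AE_I2)
      fix y
      have "(\<lambda>n. X n - y) \<longlonglongrightarrow> a - y" by (intro tendsto_intros X)
      then have "(\<lambda>n. K (X n - y)) \<longlonglongrightarrow> K (a - y)"
        using K by (intro continuous_on_tendsto_compose[OF K]) auto
      then show "(\<lambda>n. K (X n - y) * f y) \<longlonglongrightarrow> K (a - y) * f y" by (intro tendsto_intros)
    qed
    show "AE y in lborel. norm (K (X n - y) * f y) \<le> B * \<bar>f y\<bar>" for n
      by (rule AE_I2) (auto simp: abs_mult intro: mult_right_mono bK)
  qed (use f in auto)
qed

text \<open>The \<open>itself\<close> argument names the space whose Lebesgue measure is used;
  \<sigma> alone does not determine it.\<close>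

definition bump_mass :: "'a::euclidean_space itself \<Rightarrow> real \<Rightarrow> real" where
  "bump_mass _ \<sigma> = (\<integral>w. exp_bump 0 (\<sigma>\<^sup>2 - w \<bullet> w) \<partial>(lborel :: 'a measure))"

text \<open>A smooth mollifier supported in the closed ball of radius \<sigma>. It is normalized by
  its own mass for each \<sigma> instead of being rescaled from radius 1, so no change of variables
  is involved.\<close>

definition kern :: "real \<Rightarrow> 'a::euclidean_space \<Rightarrow> real" where
  "kern \<sigma> w = (1 / bump_mass TYPE('a) \<sigma>) * exp_bump 0 (\<sigma>\<^sup>2 - w \<bullet> w)"

text \<open>The derivative of \<open>kern\<close> in direction \<open>b\<close>; the index is 2
  because \<open>exp_bump 2\<close> is the derivative of \<open>exp_bump 0\<close>.\<close>

definition dkern :: "real \<Rightarrow> 'a \<Rightarrow> 'a::euclidean_space \<Rightarrow> real" where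
  "dkern \<sigma> b w = (1 / bump_mass TYPE('a) \<sigma>) * (exp_bump 2 (\<sigma>\<^sup>2 - w \<bullet> w) * (- 2 * (w \<bullet> b)))"

lemma exp_bump_eq_0:
  fixes w :: "'a::real_inner"
  assumes "norm w \<ge> \<sigma>" "\<sigma> > 0"
  shows "exp_bump n (\<sigma>\<^sup>2 - w \<bullet> w) = 0"
proof -
  have "\<sigma>\<^sup>2 \<le> (norm w)\<^sup>2" using assms by (intro power_mono) auto
  then show ?thesis by (simp add: exp_bump_def power2_norm_eq_inner)
qed

lemma exp_bump_inner_continuous:
  "continuous_on UNIV (\<lambda>w::'a::real_inner. exp_bump n (a - w \<bullet> w))"
proof -
  have "continuous_on UNIV (exp_bump n \<circ> (\<lambda>w::'a. a - w \<bullet> w))"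
    by (intro continuous_on_compose continuous_intros continuous_on_subset[OF exp_bump_continuous]) auto
  then show ?thesis by (simp add: o_def)
qed

lemma integrable_exp_bump:
  assumes "\<sigma> > 0"
  shows "integrable lborel (\<lambda>w::'a::euclidean_space. exp_bump n (\<sigma>\<^sup>2 - w \<bullet> w))"
proof -
  have "integrable lborel (\<lambda>w::'a. indicator (cball 0 \<sigma>) w *\<^sub>R exp_bump n (\<sigma>\<^sup>2 - w \<bullet> w))"
    by (rule borel_integrable_compact) (auto intro: continuous_on_subset[OF exp_bump_inner_continuous])
  also have "(\<lambda>w::'a. indicator (cball 0 \<sigma>) w *\<^sub>R exp_bump n (\<sigma>\<^sup>2 - w \<bullet> w)) = (\<lambda>w. exp_bump n (\<sigma>\<^sup>2 - w \<bullet> w))"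
    using assms by (auto simp: indicator_def fun_eq_iff exp_bump_eq_0)
  finally show ?thesis .
qed

lemma bump_mass_pos:
  assumes "\<sigma> > 0"
  shows "bump_mass TYPE('a::euclidean_space) \<sigma> > 0"
proof -
  let ?f = "\<lambda>w::'a. exp_bump 0 (\<sigma>\<^sup>2 - w \<bullet> w)"
  have "bump_mass TYPE('a) \<sigma> \<noteq> 0"
  proof
    assume "bump_mass TYPE('a) \<sigma> = 0"
    then have "AE w in lborel. ?f w = 0"
      using integral_nonneg_eq_0_iff_AE[OF integrable_exp_bump[OF assms, of 0]] exp_bump_nonneg
      by (auto simp: bump_mass_def)
    then have "AE w in lborel. w \<notin> ball (0::'a) \<sigma>"
    proof (rule AE_mp, intro AE_I2 impI notI)
      fix w :: 'a assume "?f w = 0" "w \<in> ball 0 \<sigma>"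
      moreover have "w \<bullet> w < \<sigma>\<^sup>2" 
        using \<open>w \<in> ball 0 \<sigma>\<close> power_strict_mono[of "norm w" \<sigma> 2] by (simp add: power2_norm_eq_inner)
      ultimately show False by (simp add: exp_bump_def)
    qed
    then have "ball (0::'a) \<sigma> \<in> null_sets lborel"
      by (subst (asm) AE_iff_null_sets[symmetric]) auto
    then have "negligible (ball (0::'a) \<sigma>)"
      by (simp add: negligible_iff_null_sets null_sets_completionI)
    then show False using open_not_negligible[of "ball (0::'a) \<sigma>"] assms by auto
  qed
  moreover have "bump_mass TYPE('a) \<sigma> \<ge> 0"
    unfolding bump_mass_def by (rule Bochner_Integration.integral_nonneg) (simp add: exp_bump_nonneg)
  ultimately show ?thesis by simp
qed

definition mollify :: "real \<Rightarrow> ('a::euclidean_space \<Rightarrow> real) \<Rightarrow> 'a \<Rightarrow> real" where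
  "mollify \<sigma> f z = (\<integral>y. kern \<sigma> (z - y) * f y \<partial>lborel)"

text \<open>The derivative of the mollification, written with the derivative on the kernel. In this
  form it exists for every integrable \<open>f\<close>, and up to sign it is an integral of
  \<open>f\<close> against the derivative of a test function, which is what weak formulations
  evaluate.\<close>

definition dmollify :: "real \<Rightarrow> 'a \<Rightarrow> ('a::euclidean_space \<Rightarrow> real) \<Rightarrow> 'a \<Rightarrow> real" where
  "dmollify \<sigma> b f z = (\<integral>y. dkern \<sigma> b (z - y) * f y \<partial>lborel)"

context
  fixes \<sigma> :: real assumes \<sigma>: "\<sigma> > 0"
begin

lemma kern_nonneg: "kern \<sigma> (w :: 'a::euclidean_space) \<ge> 0"
  using bump_mass_pos[OF \<sigma>, where 'a='a] by (simp add: kern_def exp_bump_nonneg)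

lemma kern_continuous: "continuous_on UNIV (kern \<sigma> :: 'a::euclidean_space \<Rightarrow> real)"
  unfolding kern_def[abs_def] by (intro continuous_intros exp_bump_inner_continuous)

lemma dkern_continuous: "continuous_on UNIV (dkern \<sigma> (b :: 'a::euclidean_space))"
  unfolding dkern_def[abs_def] by (intro continuous_intros exp_bump_inner_continuous)

lemma kern_eq_0: "norm w \<ge> \<sigma> \<Longrightarrow> kern \<sigma> (w :: 'a::euclidean_space) = 0"
  using \<sigma> by (simp add: kern_def exp_bump_eq_0)

lemma dkern_eq_0: "norm w \<ge> \<sigma> \<Longrightarrow> dkern \<sigma> b (w :: 'a::euclidean_space) = 0"
  using \<sigma> by (simp add: dkern_def exp_bump_eq_0)

lemma integral_kern: "(\<integral>w. kern \<sigma> (w :: 'a::euclidean_space) \<partial>lborel) = 1" "integrable lborel (kern \<sigma> :: 'a::euclidean_space \<Rightarrow> real)"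
proof -
  show "(\<integral>w. kern \<sigma> (w::'a::euclidean_space) \<partial>lborel) = 1"
    using bump_mass_pos[OF \<sigma>, where 'a='a] integrable_exp_bump[OF \<sigma>, where 'a='a]
    unfolding kern_def by (subst Bochner_Integration.integral_mult_right) (auto simp: bump_mass_def)
  show "integrable lborel (kern \<sigma> :: 'a::euclidean_space \<Rightarrow> real)"
    unfolding kern_def[abs_def] by (intro integrable_mult_right integrable_exp_bump \<sigma>)
qed

lemma kern_bounded_ex:
  obtains B where "\<And>w :: 'a::euclidean_space. \<bar>kern \<sigma> w\<bar> \<le> B" "\<And>w :: 'a. \<bar>dkern \<sigma> b w\<bar> \<le> B"
proof -
  have *: "\<exists>B\<ge>0. \<forall>w. \<bar>g w\<bar> \<le> B" if "continuous_on UNIV g" "\<And>w. norm w \<ge> \<sigma> \<Longrightarrow> g w = 0" 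
    for g :: "'a \<Rightarrow> real"
  proof -
    have "bounded (g ` cball 0 \<sigma>)"
      by (intro compact_imp_bounded compact_continuous_image continuous_on_subset[OF that(1)]) auto
    then obtain B where "\<forall>y\<in>g ` cball 0 \<sigma>. norm y \<le> B" unfolding bounded_iff by blast
    then have B: "\<bar>g w\<bar> \<le> B" if "norm w \<le> \<sigma>" for w
      using that by auto
    then have "0 \<le> B" using \<sigma> by (metis abs_ge_zero norm_zero order_trans less_imp_le)
    then have "\<bar>g w\<bar> \<le> B" for w
      using B[of w] that(2)[of w] by (cases "norm w \<le> \<sigma>") auto
    then show ?thesis using \<open>0 \<le> B\<close> by blast
  qed
  obtain B1 where B1: "\<And>w :: 'a. \<bar>kern \<sigma> w\<bar> \<le> B1" "B1 \<ge> 0"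
    using *[OF kern_continuous kern_eq_0] by blast
  obtain B2 where B2: "\<And>w :: 'a. \<bar>dkern \<sigma> b w\<bar> \<le> B2" "B2 \<ge> 0"
    using *[OF dkern_continuous dkern_eq_0] by blast
  show ?thesis
  proof (rule that[of "max B1 B2"])
    show "\<bar>kern \<sigma> w\<bar> \<le> max B1 B2" for w :: 'a using B1(1)[of w] by simp
    show "\<bar>dkern \<sigma> b w\<bar> \<le> max B1 B2" for w :: 'a using B2(1)[of w] by simp
  qed
qed

lemma kern_deriv:
  fixes w b :: "'a::euclidean_space"
  shows "((\<lambda>h. kern \<sigma> (w + h *\<^sub>R b)) has_real_derivative dkern \<sigma> b (w + h *\<^sub>R b)) (at h)"
proof -
  have "((\<lambda>h. \<sigma>\<^sup>2 - (w + h *\<^sub>R b) \<bullet> (w + h *\<^sub>R b)) has_real_derivative (- 2 * ((w + h *\<^sub>R b) \<bullet> b))) (at h)"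
    by (auto intro!: derivative_eq_intros simp: has_field_derivative_def inner_add_left inner_add_right inner_commute algebra_simps fun_eq_iff)
  from DERIV_chain2[OF exp_bump_deriv[of 0] this]
  have "((\<lambda>h. exp_bump 0 (\<sigma>\<^sup>2 - (w + h *\<^sub>R b) \<bullet> (w + h *\<^sub>R b))) has_real_derivative
    exp_bump 2 (\<sigma>\<^sup>2 - (w + h *\<^sub>R b) \<bullet> (w + h *\<^sub>R b)) * (- 2 * ((w + h *\<^sub>R b) \<bullet> b))) (at h)"
    by (simp add: numeral_2_eq_2)
  from DERIV_cmult[OF this] show ?thesis
    unfolding kern_def dkern_def .
qed

end

lemma mollify_deriv:
  fixes f :: "'a::euclidean_space \<Rightarrow> real"
  assumes \<sigma>: "\<sigma> > 0" and f: "integrable lborel f"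
  shows "((\<lambda>h. mollify \<sigma> f (z + h *\<^sub>R b)) has_real_derivative dmollify \<sigma> b f (z + h *\<^sub>R b)) (at h)"
proof -
  obtain B where "\<And>w :: 'a. \<bar>kern \<sigma> w\<bar> \<le> B" "\<And>w :: 'a. \<bar>dkern \<sigma> b w\<bar> \<le> B"
    using kern_bounded_ex[OF \<sigma>] by blast
  then show ?thesis unfolding mollify_def dmollify_def
    by (intro convolution_has_real_derivative f kern_continuous dkern_continuous \<sigma> kern_deriv)
qed

lemma mollify_continuous:
  fixes f :: "'a::euclidean_space \<Rightarrow> real"
  assumes \<sigma>: "\<sigma> > 0" and f: "integrable lborel f"
  shows "continuous_on UNIV (mollify \<sigma> f)" "continuous_on UNIV (dmollify \<sigma> b f)"
proof -
  obtain B where "\<And>w :: 'a. \<bar>kern \<sigma> w\<bar> \<le> B" "\<And>w :: 'a. \<bar>dkern \<sigma> b w\<bar> \<le> B"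
    using kern_bounded_ex[OF \<sigma>] by blast
  note B = this
  show "continuous_on UNIV (mollify \<sigma> f)"
    unfolding mollify_def[abs_def] by (rule continuous_on_convolution[OF f kern_continuous[OF \<sigma>] B(1)])
  show "continuous_on UNIV (dmollify \<sigma> b f)"
    unfolding dmollify_def[abs_def] by (rule continuous_on_convolution[OF f dkern_continuous[OF \<sigma>] B(2)])
qed

lemma integrable_kern_mult:
  fixes f :: "'a::euclidean_space \<Rightarrow> real"
  assumes \<sigma>: "\<sigma> > 0" and f: "integrable lborel f"
  shows "integrable lborel (\<lambda>y. kern \<sigma> (z - y) * f y)" "integrable lborel (\<lambda>y. dkern \<sigma> b (z - y) * f y)"
proof -
  obtain B where B: "\<And>w :: 'a. \<bar>kern \<sigma> w\<bar> \<le> B" "\<And>w :: 'a. \<bar>dkern \<sigma> b w\<bar> \<le> B"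
    using kern_bounded_ex[OF \<sigma>] by blast
  have [measurable]: "kern \<sigma> \<in> borel_measurable (borel::'a measure)" "dkern \<sigma> b \<in> borel_measurable (borel::'a measure)"
     "f \<in> borel_measurable borel"
    using f by (auto intro: borel_measurable_continuous_onI kern_continuous dkern_continuous \<sigma>)
  show "integrable lborel (\<lambda>y. kern \<sigma> (z - y) * f y)" "integrable lborel (\<lambda>y. dkern \<sigma> b (z - y) * f y)"
    by (rule Bochner_Integration.integrable_bound[OF integrable_mult_right[OF integrable_abs[OF f], of B]],
      simp, auto simp: abs_mult intro!: AE_I2 mult_right_mono order_trans[OF B(1)] order_trans[OF B(2)])+
qed

lemma integral_kern_reflect:
  assumes \<sigma>: "\<sigma> > 0"
  shows "(\<integral>y. kern \<sigma> (z - y) \<partial>lborel) = (1::real)" "integrable lborel (\<lambda>y. kern \<sigma> (z - y :: 'a::euclidean_space))"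
proof -
  have [measurable]: "kern \<sigma> \<in> borel_measurable (borel::'a measure)"
    by (auto intro: borel_measurable_continuous_onI kern_continuous \<sigma>)
  show *: "(\<integral>y. kern \<sigma> (z - y) \<partial>lborel) = (1::real)"
    by (subst integral_lborel_reflect) (auto simp: integral_kern \<sigma>)
  \<comment> \<open>A non-integrable function would have Bochner integral 0, so the value 1 just
    obtained proves integrability.\<close>
  then show "integrable lborel (\<lambda>y. kern \<sigma> (z - y))"
    using not_integrable_integral_eq by force
qed

text \<open>The error of mollification is an average of f (z - w) - f z over |w| < \<sigma>, and
  Tonelli's theorem exchanges averaging and integration. Nonnegative integrals are used because
  integrability of \<open>mollify \<sigma> f\<close> is derived only afterwards, from this
  bound.\<close>

lemma mollify_L1_bound:
  fixes f :: "'a::euclidean_space \<Rightarrow> real"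
  assumes \<sigma>: "\<sigma> > 0" and f: "integrable lborel f"
    and s: "\<And>s. norm s < \<sigma> \<Longrightarrow> (\<integral>z. \<bar>f (z + s) - f z\<bar> \<partial>lborel) \<le> e" and e: "0 \<le> e"
  shows "(\<integral>\<^sup>+z. ennreal \<bar>mollify \<sigma> f z - f z\<bar> \<partial>lborel) \<le> ennreal e"
proof -
  have [measurable]: "kern \<sigma> \<in> borel_measurable (borel::'a measure)" "f \<in> borel_measurable borel"
    using f by (auto intro: borel_measurable_continuous_onI kern_continuous \<sigma>)
  have kn: "0 \<le> kern \<sigma> w" for w :: 'a by (rule kern_nonneg[OF \<sigma>])
  have pt: "ennreal \<bar>mollify \<sigma> f z - f z\<bar> \<le> (\<integral>\<^sup>+w. ennreal (kern \<sigma> w) * ennreal \<bar>f (z + - w) - f z\<bar> \<partial>lborel)" for z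
  proof -
    have i: "integrable lborel (\<lambda>y. kern \<sigma> (z - y) * f y)" by (rule integrable_kern_mult[OF \<sigma> f])
    have i2: "integrable lborel (\<lambda>y. kern \<sigma> (z - y) * f z)"
      by (intro integrable_mult_left integral_kern_reflect \<sigma>)
    have fz: "(\<integral>y. kern \<sigma> (z - y) * f z \<partial>lborel) = f z"
      using integral_kern_reflect[OF \<sigma>, of z] by simp
    have "mollify \<sigma> f z - f z = (\<integral>y. kern \<sigma> (z - y) * (f y - f z) \<partial>lborel)"
      unfolding right_diff_distrib Bochner_Integration.integral_diff[OF i i2] fz mollify_def ..
    then have "ennreal \<bar>mollify \<sigma> f z - f z\<bar> \<le> (\<integral>\<^sup>+y. ennreal (norm (kern \<sigma> (z - y) * (f y - f z))) \<partial>lborel)"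
      using integral_norm_bound_ennreal[of lborel "\<lambda>y. kern \<sigma> (z - y) * (f y - f z)"] i i2
      by (simp add: right_diff_distrib)
    \<comment> \<open>Writing y as z - (z - y) exhibits the integrand as a function of z - y, to
      which the reflection applies.\<close>
    also have "\<dots> = (\<integral>\<^sup>+y. ennreal (kern \<sigma> (z - y)) * ennreal \<bar>f (z - (z - y)) - f z\<bar> \<partial>lborel)"
      by (intro nn_integral_cong) (simp add: abs_mult kn ennreal_mult)
    also have "\<dots> = (\<integral>\<^sup>+w. ennreal (kern \<sigma> w) * ennreal \<bar>f (z - w) - f z\<bar> \<partial>lborel)"
      by (rule nn_integral_lborel_reflect) simp
    finally show ?thesis by simp
  qed
  have "(\<integral>\<^sup>+z. ennreal \<bar>mollify \<sigma> f z - f z\<bar> \<partial>lborel) \<le>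
     (\<integral>\<^sup>+z. (\<integral>\<^sup>+w. ennreal (kern \<sigma> w) * ennreal \<bar>f (z + - w) - f z\<bar> \<partial>lborel) \<partial>lborel)"
    by (rule nn_integral_mono) (rule pt)
  also have "\<dots> = (\<integral>\<^sup>+w. (\<integral>\<^sup>+z. ennreal (kern \<sigma> w) * ennreal \<bar>f (z + - w) - f z\<bar> \<partial>lborel) \<partial>lborel)"
    by (rule lborel_pair.Fubini') simp
  also have "\<dots> \<le> (\<integral>\<^sup>+w. ennreal (kern \<sigma> w) * ennreal e \<partial>(lborel :: 'a measure))"
  proof (rule nn_integral_mono)
    fix w :: 'a
    have "(\<integral>\<^sup>+z. ennreal (kern \<sigma> w) * ennreal \<bar>f (z + - w) - f z\<bar> \<partial>lborel) =
      ennreal (kern \<sigma> w) * (\<integral>\<^sup>+z. ennreal \<bar>f (z + - w) - f z\<bar> \<partial>lborel)"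
      by (rule nn_integral_cmult) simp
    also have "\<dots> \<le> ennreal (kern \<sigma> w) * ennreal e"
    proof (cases "norm w < \<sigma>")
      case True
      have "(\<integral>\<^sup>+z. ennreal \<bar>f (z + - w) - f z\<bar> \<partial>lborel) = ennreal (\<integral>z. \<bar>f (z + - w) - f z\<bar> \<partial>lborel)"
        by (rule nn_integral_eq_integral)
          (auto intro!: integrable_abs Bochner_Integration.integrable_diff f integrable_lborel_shift simp del: add_uminus_conv_diff)
      also have "\<dots> \<le> ennreal e" using s[of "-w"] True by (intro ennreal_leI) simp
      finally show ?thesis by (intro mult_left_mono) auto
    next
      case False
      then have "kern \<sigma> w = 0" by (intro kern_eq_0 \<sigma>) simp
      then show ?thesis by simp
    qed
    finally show "(\<integral>\<^sup>+z. ennreal (kern \<sigma> w) * ennreal \<bar>f (z + - w) - f z\<bar> \<partial>lborel) \<le> ennreal (kern \<sigma> w) * ennreal e" .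
  qed
  also have "\<dots> = (\<integral>\<^sup>+w. ennreal (kern \<sigma> w) \<partial>(lborel :: 'a measure)) * ennreal e"
    by (rule nn_integral_multc) simp
  also have "(\<integral>\<^sup>+w. ennreal (kern \<sigma> w) \<partial>(lborel :: 'a measure)) = 1"
    using nn_integral_eq_integral[OF integral_kern(2)[OF \<sigma>, where 'a='a]] kn integral_kern(1)[OF \<sigma>, where 'a='a] by simp
  finally show ?thesis by simp
qed

text \<open>The trivial bound by twice the L1 norm of \<open>f\<close>, valid for all shifts, gives
  integrability; continuity of translations gives the limit.\<close>

lemma mollify_L1_tendsto:
  fixes f :: "'a::euclidean_space \<Rightarrow> real"
  assumes f: "integrable lborel f" and \<sigma>: "\<And>j. \<sigma> j > 0" "\<sigma> \<longlonglongrightarrow> 0"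
  shows "\<And>j. integrable lborel (mollify (\<sigma> j) f)" 
    "(\<lambda>j. \<integral>z. \<bar>mollify (\<sigma> j) f z - f z\<bar> \<partial>lborel) \<longlonglongrightarrow> 0"
proof -
  have [measurable]: "mollify (\<sigma> j) f \<in> borel_measurable borel" "f \<in> borel_measurable borel" for j
    using f by (auto intro!: borel_measurable_continuous_onI mollify_continuous \<sigma>)
  show int: "integrable lborel (mollify (\<sigma> j) f)" for j
  proof -
    let ?e = "2 * (\<integral>z. \<bar>f z\<bar> \<partial>lborel)"
    have "(\<integral>\<^sup>+z. ennreal \<bar>mollify (\<sigma> j) f z - f z\<bar> \<partial>lborel) \<le> ennreal ?e"
    proof (rule mollify_L1_bound[OF \<sigma>(1) f])
      fix s
      have "(\<integral>z. \<bar>f (z + s) - f z\<bar> \<partial>lborel) \<le> (\<integral>z. \<bar>f (z + s)\<bar> + \<bar>f z\<bar> \<partial>lborel)"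
        by (rule integral_mono) (auto intro!: integrable_abs Bochner_Integration.integrable_diff 
            Bochner_Integration.integrable_add f integrable_lborel_shift)
      also have "\<dots> = (\<integral>z. \<bar>f (z + s)\<bar> \<partial>lborel) + (\<integral>z. \<bar>f z\<bar> \<partial>lborel)"
        by (rule Bochner_Integration.integral_add) (auto intro!: integrable_abs f integrable_lborel_shift)
      also have "(\<integral>z. \<bar>f (z + s)\<bar> \<partial>lborel) = (\<integral>z. \<bar>f z\<bar> \<partial>lborel)"
        by (rule integral_lborel_shift[where f="\<lambda>z. \<bar>f z\<bar>"]) simp
      finally show "(\<integral>z. \<bar>f (z + s) - f z\<bar> \<partial>lborel) \<le> ?e" by simp
    qed simp
    also have "\<dots> < \<infinity>" by simp
    finally have "integrable lborel (\<lambda>z. mollify (\<sigma> j) f z - f z)"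
      by (intro integrableI_bounded) auto
    from Bochner_Integration.integrable_add[OF this f] show ?thesis by simp
  qed
  show "(\<lambda>j. \<integral>z. \<bar>mollify (\<sigma> j) f z - f z\<bar> \<partial>lborel) \<longlonglongrightarrow> 0"
  proof (rule LIMSEQ_I)
    fix e :: real assume "e > 0"
    then obtain d where d: "d > 0" "\<And>s. norm s < d \<Longrightarrow> (\<integral>z. \<bar>f (z + s) - f z\<bar> \<partial>lborel) \<le> e / 2"
      using integrable_imp_shift_cont[OF f] unfolding shift_cont_def by (metis half_gt_zero)
    obtain J where J: "\<And>j. j \<ge> J \<Longrightarrow> \<sigma> j < d"
      using order_tendstoD(2)[OF \<sigma>(2) d(1)] by (auto simp: eventually_sequentially)
    have "norm ((\<integral>z. \<bar>mollify (\<sigma> j) f z - f z\<bar> \<partial>lborel) - 0) < e" if "j \<ge> J" for j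
    proof -
      have "ennreal (\<integral>z. \<bar>mollify (\<sigma> j) f z - f z\<bar> \<partial>lborel) = (\<integral>\<^sup>+z. ennreal \<bar>mollify (\<sigma> j) f z - f z\<bar> \<partial>lborel)"
        by (rule nn_integral_eq_integral[symmetric]) (auto intro!: integrable_abs Bochner_Integration.integrable_diff int f)
      also have "\<dots> \<le> ennreal (e / 2)"
        using J[OF that] \<open>e > 0\<close> by (intro mollify_L1_bound[OF \<sigma>(1) f] d(2)) auto
      finally have "(\<integral>z. \<bar>mollify (\<sigma> j) f z - f z\<bar> \<partial>lborel) \<le> e / 2"
        using \<open>e > 0\<close> by (simp add: ennreal_le_iff)
      then show ?thesis using \<open>e > 0\<close> by (simp add: Bochner_Integration.integral_nonneg)
    qed
    then show "\<exists>J. \<forall>j\<ge>J. norm ((\<integral>z. \<bar>mollify (\<sigma> j) f z - f z\<bar> \<partial>lborel) - 0) < e" by blast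
  qed
qed

section \<open>Energy estimate for mollified equations\<close>

text \<open>Powers of the positive part with exponent at least 2 are continuously differentiable
  across 0, so truncations of mollified functions can be differentiated classically.\<close>

lemma pos_part_power_deriv:
  "((\<lambda>s::real. (max 0 s) ^ (k + 2)) has_real_derivative (real k + 2) * (max 0 s) ^ (k + 1)) (at s)"
proof -
  consider "s < 0" | "s = 0" | "s > 0" by linarith
  then show ?thesis
  proof cases
    case 1
    have "((\<lambda>s::real. (max 0 s) ^ (k + 2)) has_real_derivative 0) (at s)"
      by (rule DERIV_cong_ev[THEN iffD1, rotated -1, OF DERIV_const[of 0]])
        (use 1 in \<open>auto intro!: eventually_nhds_in_open[of "{..<0}", THEN eventually_mono]\<close>)
    then show ?thesis using 1 by simp
  next
    case 2
    have "((\<lambda>h::real. (max 0 h) ^ (k + 1)) \<longlongrightarrow> (max 0 0) ^ (k + 1)) (at 0)"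
      by (intro tendsto_intros)
    then have "((\<lambda>h::real. ((max 0 (0 + h)) ^ (k + 2) - (max 0 0) ^ (k + 2)) / h) \<longlongrightarrow> 0) (at 0)"
      by (rule Lim_transform_eventually[rotated, OF _ _, THEN tendsto_eq_rhs, rotated])
        (auto simp: eventually_at_filter max_def)
    then show ?thesis using 2 by (simp add: DERIV_def)
  next
    case 3
    have "((\<lambda>s::real. s ^ (k + 2)) has_real_derivative (real k + 2) * s ^ (k + 1)) (at s)"
      using DERIV_pow[of "k + 2" s UNIV] by (simp add: add.commute)
    then have "((\<lambda>s::real. (max 0 s) ^ (k + 2)) has_real_derivative (real k + 2) * s ^ (k + 1)) (at s)"
      by (rule DERIV_cong_ev[THEN iffD1, rotated -1])
        (use 3 in \<open>auto intro!: eventually_nhds_in_open[of "{0<..}", THEN eventually_mono]\<close>)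
    then show ?thesis using 3 by simp
  qed
qed

lemma mollify_le_on_ball:
  fixes f :: "'a::euclidean_space \<Rightarrow> real"
  assumes \<sigma>: "\<sigma> > 0" and f: "integrable lborel f" and le: "\<And>y. dist z y < \<sigma> \<Longrightarrow> f y \<le> c"
  shows "mollify \<sigma> f z \<le> c"
proof -
  have "mollify \<sigma> f z \<le> (\<integral>y. kern \<sigma> (z - y) * c \<partial>lborel)"
    unfolding mollify_def
  proof (rule Bochner_Integration.integral_mono)
    show "integrable lborel (\<lambda>y. kern \<sigma> (z - y) * f y)" by (rule integrable_kern_mult[OF \<sigma> f])
    show "integrable lborel (\<lambda>y. kern \<sigma> (z - y) * c)"
      by (intro integrable_mult_left integral_kern_reflect \<sigma>)
    fix y
    show "kern \<sigma> (z - y) * f y \<le> kern \<sigma> (z - y) * c"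
      using kern_nonneg[OF \<sigma>, of "z - y"] kern_eq_0[OF \<sigma>, of "z - y"] le[of y]
      by (cases "dist z y < \<sigma>") (auto simp: dist_norm mult_left_mono)
  qed
  also have "\<dots> = c" using integral_kern_reflect[OF \<sigma>, of z] by simp
  finally show ?thesis .
qed

text \<open>A product of two averages is a double average of the products B i y * V i y' over
  independent points \<open>y\<close> and \<open>y'\<close>. For this reason \<open>bd\<close> is a
  bound at two different points, and each of the two averages of \<open>E\<close> yields one
  \<open>mollify \<sigma> E z\<close>.\<close>

lemma mollify_sum_bound:
  fixes V B :: "'n::finite \<Rightarrow> 'a::euclidean_space \<Rightarrow> real"
  assumes \<sigma>: "\<sigma> > 0" and V: "\<And>i. integrable lborel (V i)" and B: "\<And>i. integrable lborel (B i)"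
    and E: "integrable lborel E" and bd: "\<And>y y'. \<bar>\<Sum>i\<in>UNIV. B i y * V i y'\<bar> \<le> E y + E y'"
  shows "\<bar>\<Sum>i\<in>UNIV. mollify \<sigma> (B i) z * mollify \<sigma> (V i) z\<bar> \<le> 2 * mollify \<sigma> E z"
proof -
  note k = integrable_kern_mult(1)[OF \<sigma>]
  have k1: "integrable lborel (\<lambda>y. kern \<sigma> (z - y) * c)" for c
    by (intro integrable_mult_left integral_kern_reflect \<sigma>)
  have kc: "(\<integral>y. kern \<sigma> (z - y) * c \<partial>lborel) = c" for c
    using integral_kern_reflect[OF \<sigma>, of z] by simp
  have kn: "0 \<le> kern \<sigma> w" for w :: 'a by (rule kern_nonneg[OF \<sigma>])
  have 1: "\<bar>\<Sum>i\<in>UNIV. B i y * mollify \<sigma> (V i) z\<bar> \<le> E y + mollify \<sigma> E z" for y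
  proof -
    have "(\<Sum>i\<in>UNIV. B i y * mollify \<sigma> (V i) z) = (\<integral>y'. kern \<sigma> (z - y') * (\<Sum>i\<in>UNIV. B i y * V i y') \<partial>lborel)"
    proof -
      have "(\<Sum>i\<in>UNIV. B i y * mollify \<sigma> (V i) z) = (\<Sum>i\<in>UNIV. (\<integral>y'. B i y * (kern \<sigma> (z - y') * V i y') \<partial>lborel))"
        by (simp add: mollify_def)
      also have "\<dots> = (\<integral>y'. (\<Sum>i\<in>UNIV. B i y * (kern \<sigma> (z - y') * V i y')) \<partial>lborel)"
        by (rule Bochner_Integration.integral_sum[symmetric]) (intro integrable_mult_right k V)
      finally show ?thesis by (simp add: sum_distrib_left algebra_simps)
    qed
    also have "\<bar>\<dots>\<bar> \<le> (\<integral>y'. kern \<sigma> (z - y') * E y + kern \<sigma> (z - y') * E y' \<partial>lborel)"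
      unfolding real_norm_def[symmetric]
    proof (rule Bochner_Integration.integral_norm_bound_integral)
      have "integrable lborel (\<lambda>y'. \<Sum>i\<in>UNIV. B i y * (kern \<sigma> (z - y') * V i y'))"
        by (intro Bochner_Integration.integrable_sum integrable_mult_right k V)
      then show "integrable lborel (\<lambda>y'. kern \<sigma> (z - y') * (\<Sum>i\<in>UNIV. B i y * V i y'))"
        by (simp add: sum_distrib_left algebra_simps)
      show "integrable lborel (\<lambda>y'. kern \<sigma> (z - y') * E y + kern \<sigma> (z - y') * E y')"
        by (intro Bochner_Integration.integrable_add k1 k E)
      show "norm (kern \<sigma> (z - y') * (\<Sum>i\<in>UNIV. B i y * V i y')) \<le> kern \<sigma> (z - y') * E y + kern \<sigma> (z - y') * E y'" for y'
        using mult_left_mono[OF bd[of y y'] kn[of "z - y'"]] by (simp add: abs_mult kn distrib_left)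
    qed
    also have "\<dots> = E y + mollify \<sigma> E z"
      by (simp only: Bochner_Integration.integral_add[OF k1 k[OF E]] kc mollify_def)
    finally show ?thesis .
  qed
  have "(\<Sum>i\<in>UNIV. mollify \<sigma> (B i) z * mollify \<sigma> (V i) z) = (\<integral>y. kern \<sigma> (z - y) * (\<Sum>i\<in>UNIV. B i y * mollify \<sigma> (V i) z) \<partial>lborel)"
  proof -
    have "(\<Sum>i\<in>UNIV. mollify \<sigma> (B i) z * mollify \<sigma> (V i) z) = (\<Sum>i\<in>UNIV. (\<integral>y. (kern \<sigma> (z - y) * B i y) * mollify \<sigma> (V i) z \<partial>lborel))"
      by (simp add: mollify_def[of _ "B _"])
    also have "\<dots> = (\<integral>y. (\<Sum>i\<in>UNIV. (kern \<sigma> (z - y) * B i y) * mollify \<sigma> (V i) z) \<partial>lborel)"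
      by (rule Bochner_Integration.integral_sum[symmetric]) (intro integrable_mult_left k B)
    finally show ?thesis by (simp add: sum_distrib_left algebra_simps)
  qed
  also have "\<bar>\<dots>\<bar> \<le> (\<integral>y. kern \<sigma> (z - y) * E y + kern \<sigma> (z - y) * mollify \<sigma> E z \<partial>lborel)"
    unfolding real_norm_def[symmetric]
  proof (rule Bochner_Integration.integral_norm_bound_integral)
    have "integrable lborel (\<lambda>y. \<Sum>i\<in>UNIV. (kern \<sigma> (z - y) * B i y) * mollify \<sigma> (V i) z)"
      by (intro Bochner_Integration.integrable_sum integrable_mult_left k B)
    then show "integrable lborel (\<lambda>y. kern \<sigma> (z - y) * (\<Sum>i\<in>UNIV. B i y * mollify \<sigma> (V i) z))"
      by (simp add: sum_distrib_left algebra_simps)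
    show "integrable lborel (\<lambda>y. kern \<sigma> (z - y) * E y + kern \<sigma> (z - y) * mollify \<sigma> E z)"
      by (intro Bochner_Integration.integrable_add k1 k E)
    show "norm (kern \<sigma> (z - y) * (\<Sum>i\<in>UNIV. B i y * mollify \<sigma> (V i) z)) \<le> kern \<sigma> (z - y) * E y + kern \<sigma> (z - y) * mollify \<sigma> E z" for y
      using mult_left_mono[OF 1[of y] kn[of "z - y"]] by (simp add: abs_mult kn distrib_left)
  qed
  also have "\<dots> = 2 * mollify \<sigma> E z"
    by (simp only: Bochner_Integration.integral_add[OF k[OF E] k1] kc mollify_def[symmetric])
  finally show ?thesis .
qed

text \<open>The equation for the mollified difference is tested with
  \<open>(max 0 (u - \<epsilon>))\<^sup>2 (max 0 (\<tau> - t))\<^sup>2\<close>.\<close>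

lemma mollified_energy_identity:
  fixes C :: "'a::euclidean_space set" and V B :: "'n::finite \<Rightarrow> 'a \<Rightarrow> real" and b :: "'n \<Rightarrow> 'a"
  assumes e: "e \<bullet> e = 1" "\<And>i. b i \<bullet> e = 0"
    and v: "integrable lborel v" "\<And>z. z \<notin> C \<Longrightarrow> v z = 0"
    and V: "\<And>i. integrable lborel (V i)" and B: "\<And>i. integrable lborel (B i)"
    and grad: "\<And>z i. cball z \<sigma> \<subseteq> C \<Longrightarrow> dmollify \<sigma> (b i) v z = mollify \<sigma> (V i) z"
    and eqn: "\<And>z. cball z \<sigma> \<subseteq> C \<Longrightarrow> dmollify \<sigma> e v z = (\<Sum>i\<in>UNIV. dmollify \<sigma> (b i) (B i) z)"
    and K: "bounded K" "K = {z \<in> C. v z \<ge> \<epsilon> \<and> z \<bullet> e \<le> \<tau>'}"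
    and d: "\<And>z. z \<in> K \<Longrightarrow> cball z d \<subseteq> C"
    and \<epsilon>: "\<epsilon> > 0" and \<sigma>: "\<sigma> > 0" "2 * \<sigma> \<le> d" "\<tau> + \<sigma> \<le> \<tau>'"
  defines "\<alpha> \<equiv> \<lambda>z. max 0 (mollify \<sigma> v z - \<epsilon>)" and "m \<equiv> \<lambda>z. max 0 (\<tau> - z \<bullet> e)"
  defines "G \<equiv> \<lambda>z. 2/3 * \<alpha> z ^ 3 * m z + 2 * \<alpha> z * m z ^ 2 * (\<Sum>i\<in>UNIV. mollify \<sigma> (B i) z * mollify \<sigma> (V i) z)"
  shows "\<And>z. \<alpha> z > 0 \<Longrightarrow> m z > 0 \<Longrightarrow> z \<in> C" "integrable lborel G" "(\<integral>z. G z \<partial>lborel) = 0"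
proof -
  \<comment> \<open>Where both cutoffs are positive the mollification exceeds \<epsilon>, so the
    \<sigma>-ball contains points with v > \<epsilon>. These lie in \<open>C\<close> because
    \<open>v\<close> vanishes elsewhere, and not above \<tau>' because time changes by less than
    \<sigma>; hence they belong to \<open>K\<close>.\<close>
  have near: "\<exists>y\<in>K. dist z y < \<sigma>" if "\<alpha> z > 0" "m z > 0" for z
  proof (rule ccontr)
    assume n: "\<not> (\<exists>y\<in>K. dist z y < \<sigma>)"
    have "mollify \<sigma> v z \<le> \<epsilon>"
    proof (rule mollify_le_on_ball[OF \<sigma>(1) v(1)])
      fix y assume y: "dist z y < \<sigma>"
      show "v y \<le> \<epsilon>"
      proof (cases "y \<in> C")
        case True
        have "norm e = 1" using e(1) by (simp add: norm_eq_1)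
        then have "(y - z) \<bullet> e \<le> norm (y - z)" using norm_cauchy_schwarz[of "y - z" e] by simp
        then have "y \<bullet> e \<le> \<tau>'"
          using y that(2) \<sigma>(3) by (auto simp: m_def inner_diff_left dist_norm norm_minus_commute split: if_splits)
        then show ?thesis using n y True K(2) by force
      next
        case False
        then show ?thesis using v(2) \<epsilon> by simp
      qed
    qed
    then show False using that by (simp add: \<alpha>_def)
  qed
  have deep: "cball z \<sigma> \<subseteq> C" if z: "\<alpha> z > 0" "m z > 0" for z
  proof -
    obtain y where y: "y \<in> K" "dist z y < \<sigma>" using near[OF z] by blast
    have "cball z \<sigma> \<subseteq> cball y d"
    proof
      fix w assume "w \<in> cball z \<sigma>"
      then show "w \<in> cball y d"
        using y(2) \<sigma>(2) dist_triangle[of y w z] by (simp add: dist_commute)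
    qed
    then show ?thesis using d[OF y(1)] by blast
  qed
  show "z \<in> C" if "\<alpha> z > 0" "m z > 0" for z
    using deep[OF that] \<sigma>(1) by auto
  obtain R0 where R0: "\<And>z. z \<in> K \<Longrightarrow> norm z \<le> R0" using K(1) unfolding bounded_iff by blast
  have supp: "\<alpha> z = 0 \<or> m z = 0" if "norm z \<ge> R0 + \<sigma>" for z
  proof (rule ccontr)
    assume "\<not> (\<alpha> z = 0 \<or> m z = 0)"
    then have "\<alpha> z > 0" "m z > 0" by (auto simp: \<alpha>_def m_def split: if_splits)
    then obtain y where y: "y \<in> K" "dist z y < \<sigma>" using near by blast
    have "norm z \<le> norm y + dist z y" by (simp add: dist_norm norm_triangle_sub)
    then show False using y R0[of y] that by simp
  qed
  note cc = mollify_continuous[OF \<sigma>(1)]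
  have c\<alpha>: "continuous_on UNIV \<alpha>" unfolding \<alpha>_def by (intro continuous_intros cc v)
  have cm: "continuous_on UNIV m" unfolding m_def by (intro continuous_intros)
  have d\<alpha>: "((\<lambda>h. \<alpha> (z + h *\<^sub>R x) ^ (k + 2)) has_real_derivative
      (real k + 2) * \<alpha> (z + h *\<^sub>R x) ^ (k + 1) * dmollify \<sigma> x v (z + h *\<^sub>R x)) (at h)" for z x h k
  proof -
    have "((\<lambda>h. mollify \<sigma> v (z + h *\<^sub>R x) - \<epsilon>) has_real_derivative dmollify \<sigma> x v (z + h *\<^sub>R x)) (at h)"
      using DERIV_diff[OF mollify_deriv[OF \<sigma>(1) v(1)] DERIV_const] by simp
    from DERIV_chain2[OF pos_part_power_deriv this]
    show ?thesis by (simp add: \<alpha>_def)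
  qed
  have dm: "((\<lambda>h. m (z + h *\<^sub>R e) ^ 2) has_real_derivative - 2 * m (z + h *\<^sub>R e)) (at h)" for z h
  proof -
    have "((\<lambda>h. \<tau> - (z + h *\<^sub>R e) \<bullet> e) has_real_derivative - 1) (at h)"
      using e(1) by (auto intro!: derivative_eq_intros simp: inner_add_left has_field_derivative_def fun_eq_iff)
    from DERIV_chain2[OF pos_part_power_deriv[of 0] this]
    show ?thesis by (simp add: m_def power2_eq_square)
  qed
  have mb: "m (z + h *\<^sub>R b i) = m z" for z h i
    using e(2) by (simp add: m_def inner_add_left)
  \<comment> \<open>\<open>D\<close> is the derivative of \<alpha>^3 m^2 in the time direction
    \<open>e\<close>; \<open>Di i\<close> below is the derivative of \<alpha>^2 m^2
    \<open>mollify \<sigma> (B i)\<close> in direction \<open>b i\<close>. Both are derivatives of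
    functions with bounded support and integrate to 0.\<close>
  define D where "D z = 3 * \<alpha> z ^ 2 * dmollify \<sigma> e v z * m z ^ 2 + \<alpha> z ^ 3 * (- 2 * m z)" for z
  have D: "integrable lborel D" "(\<integral>z. D z \<partial>lborel) = 0"
  proof -
    have "((\<lambda>h. \<alpha> (z + h *\<^sub>R e) ^ 3 * m (z + h *\<^sub>R e) ^ 2) has_real_derivative D (z + h *\<^sub>R e)) (at h)" for z h
      using DERIV_mult[OF d\<alpha>[where k=1 and x=e] dm]
      by (simp add: D_def numeral_2_eq_2 numeral_3_eq_3 algebra_simps)
    note * = integral_directional_derivative_eq_0[of "\<lambda>z. \<alpha> z ^ 3 * m z ^ 2", OF this]
    have c1: "continuous_on UNIV (\<lambda>z. \<alpha> z ^ 3 * m z ^ 2)"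
      by (intro continuous_intros c\<alpha> cm cc v)
    have c2: "continuous_on UNIV D"
      unfolding D_def[abs_def] by (intro continuous_intros c\<alpha> cm cc v)
    have "\<alpha> z ^ 3 * m z ^ 2 = 0" if "norm z \<ge> R0 + \<sigma>" for z
      using supp[OF that] by auto
    note ** = *[OF c1 c2 this]
    show "integrable lborel D" "(\<integral>z. D z \<partial>lborel) = 0"
      by (rule **; assumption)+
  qed
  define Di where "Di i z = 2 * \<alpha> z * dmollify \<sigma> (b i) v z * m z ^ 2 * mollify \<sigma> (B i) z
     + \<alpha> z ^ 2 * m z ^ 2 * dmollify \<sigma> (b i) (B i) z" for i z
  have Di: "integrable lborel (Di i)" "(\<integral>z. Di i z \<partial>lborel) = 0" for i
  proof -
    have "((\<lambda>h. \<alpha> (z + h *\<^sub>R b i) ^ 2 * m (z + h *\<^sub>R b i) ^ 2 * mollify \<sigma> (B i) (z + h *\<^sub>R b i)) has_real_derivative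
       Di i (z + h *\<^sub>R b i)) (at h)" for z h
      using DERIV_mult[OF DERIV_cmult_right[OF d\<alpha>[where k=0 and x="b i"], where c="m z ^ 2"] mollify_deriv[OF \<sigma>(1) B[of i], where b="b i"]]
      by (simp add: Di_def mb algebra_simps numeral_2_eq_2)
    note * = integral_directional_derivative_eq_0[of "\<lambda>z. \<alpha> z ^ 2 * m z ^ 2 * mollify \<sigma> (B i) z", OF this]
    have c1: "continuous_on UNIV (\<lambda>z. \<alpha> z ^ 2 * m z ^ 2 * mollify \<sigma> (B i) z)"
      by (intro continuous_intros c\<alpha> cm cc v B)
    have c2: "continuous_on UNIV (Di i)"
      unfolding Di_def[abs_def] by (intro continuous_intros c\<alpha> cm cc v B)
    have "\<alpha> z ^ 2 * m z ^ 2 * mollify \<sigma> (B i) z = 0" if "norm z \<ge> R0 + \<sigma>" for z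
      using supp[OF that] by auto
    note ** = *[OF c1 c2 this]
    show "integrable lborel (Di i)" "(\<integral>z. Di i z \<partial>lborel) = 0"
      by (rule **; assumption)+
  qed
  \<comment> \<open>The factor 1/3 offsets the 3 from differentiating \<alpha>^3. By the equation
    the terms with derivatives of \<open>B\<close> cancel, leaving the energy density and the term
    from the time cutoff.\<close>
  have G: "G z = (\<Sum>i\<in>UNIV. Di i z) - D z / 3" for z
  proof (cases "\<alpha> z > 0 \<and> m z > 0")
    case True
    then have "cball z \<sigma> \<subseteq> C" using deep by blast
    then have D: "D z = 3 * \<alpha> z ^ 2 * (\<Sum>i\<in>UNIV. dmollify \<sigma> (b i) (B i) z) * m z ^ 2 + \<alpha> z ^ 3 * (- 2 * m z)"
      and Di: "Di i z = 2 * \<alpha> z * m z ^ 2 * (mollify \<sigma> (B i) z * mollify \<sigma> (V i) z)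
        + \<alpha> z ^ 2 * m z ^ 2 * dmollify \<sigma> (b i) (B i) z" for i
      by (simp_all add: D_def Di_def grad eqn)
    have "(\<Sum>i\<in>UNIV. Di i z) = 2 * \<alpha> z * m z ^ 2 * (\<Sum>i\<in>UNIV. mollify \<sigma> (B i) z * mollify \<sigma> (V i) z)
        + \<alpha> z ^ 2 * m z ^ 2 * (\<Sum>i\<in>UNIV. dmollify \<sigma> (b i) (B i) z)"
      unfolding Di by (simp only: sum.distrib sum_distrib_left)
    then show ?thesis by (simp add: G_def D field_simps)
  next
    case False
    then have "\<alpha> z = 0 \<or> m z = 0" by (auto simp: \<alpha>_def m_def split: if_splits)
    then show ?thesis by (auto simp: G_def D_def Di_def)
  qed
  show "integrable lborel G"
    unfolding G[abs_def] by (intro Bochner_Integration.integrable_diff Bochner_Integration.integrable_sum Di D integrable_divide)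
  show "(\<integral>z. G z \<partial>lborel) = 0"
    unfolding G
    by (subst Bochner_Integration.integral_diff) (auto intro!: Bochner_Integration.integrable_sum simp: Di D)
qed

text \<open>The mollified energy densities need not be nonnegative; by \<open>mollify_sum_bound\<close> a multiple of
  \<open>mollify E\<close> bounds them from below, so that Fatou's lemma applies.\<close>

lemma energy_comparison:
  fixes C :: "'a::euclidean_space set" and V B :: "'n::finite \<Rightarrow> 'a \<Rightarrow> real" and b :: "'n \<Rightarrow> 'a"
  assumes C: "open C" "bounded C"
    and e: "e \<bullet> e = 1" "\<And>i. b i \<bullet> e = 0"
    and v: "integrable lborel v" "\<And>z. z \<notin> C \<Longrightarrow> v z = 0" "continuous_on C v" "\<And>z. v z \<le> M"
    and V: "\<And>i. integrable lborel (V i)" and B: "\<And>i. integrable lborel (B i)"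
    and E: "integrable lborel E" "\<And>y y'. \<bar>\<Sum>i\<in>UNIV. B i y * V i y'\<bar> \<le> E y + E y'"
    and mono: "\<And>y. (\<Sum>i\<in>UNIV. B i y * V i y) \<ge> 0"
    and grad: "\<And>\<sigma> z i. \<sigma> > 0 \<Longrightarrow> cball z \<sigma> \<subseteq> C \<Longrightarrow> dmollify \<sigma> (b i) v z = mollify \<sigma> (V i) z"
    and eqn: "\<And>\<sigma> z. \<sigma> > 0 \<Longrightarrow> cball z \<sigma> \<subseteq> C \<Longrightarrow> dmollify \<sigma> e v z = (\<Sum>i\<in>UNIV. dmollify \<sigma> (b i) (B i) z)"
    and K: "compact {z \<in> C. v z \<ge> \<epsilon> \<and> z \<bullet> e \<le> \<tau>'}" and \<epsilon>: "\<epsilon> > 0" and \<tau>: "\<tau> < \<tau>'"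
    and z0: "z0 \<in> C" "z0 \<bullet> e < \<tau>"
  shows "v z0 \<le> \<epsilon>"
proof -
  define K where "K = {z \<in> C. v z \<ge> \<epsilon> \<and> z \<bullet> e \<le> \<tau>'}"
  obtain d where d: "d > 0" "\<And>z. z \<in> K \<Longrightarrow> cball z d \<subseteq> C"
  proof (cases "K = {}")
    case True
    then show ?thesis using that[of 1] by auto
  next
    case False
    have "C \<noteq> UNIV" using C(2) not_bounded_UNIV by blast
    then have "- C \<noteq> {}" by auto
    have "setdist K (- C) > 0"
      using K[folded K_def] False \<open>- C \<noteq> {}\<close> C(1) unfolding K_def
      by (subst setdist_gt_0_compact_closed) auto
    moreover have "cball z (setdist K (- C) / 2) \<subseteq> C" if "z \<in> K" for z
    proof (rule ccontr)
      assume "\<not> cball z (setdist K (- C) / 2) \<subseteq> C"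
      then have "\<exists>w. w \<in> - C \<and> dist z w \<le> setdist K (- C) / 2"
        by (auto simp: subset_iff)
      then obtain w where "w \<in> - C" "dist z w \<le> setdist K (- C) / 2" by blast
      with setdist_le_dist[OF that \<open>w \<in> - C\<close>] \<open>setdist K (- C) > 0\<close> show False by simp
    qed
    ultimately show ?thesis using that[of "setdist K (- C) / 2"] by simp
  qed
  obtain R where R: "\<And>z. z \<in> C \<Longrightarrow> norm z \<le> R" using C(2) unfolding bounded_iff by blast
  \<comment> \<open>The two terms ensure \<open>2 * \<sigma> j \<le> d\<close> and
    \<open>\<tau> + \<sigma> j \<le> \<tau>'\<close>, as the energy identity requires.\<close>
  define s0 where "s0 = min (d / 2) (\<tau>' - \<tau>)"
  have s0: "s0 > 0" using d \<tau> by (simp add: s0_def)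
  define \<sigma> where "\<sigma> j = s0 / real (Suc j)" for j
  have \<sigma>: "\<sigma> j > 0" "\<sigma> j \<le> s0" for j
    using s0 by (auto simp: \<sigma>_def field_simps)
  have \<sigma>0: "\<sigma> \<longlonglongrightarrow> 0"
    unfolding \<sigma>_def using LIMSEQ_Suc[OF tendsto_divide_0[OF tendsto_const[of s0] filterlim_at_top_imp_at_infinity[OF filterlim_real_sequentially]]]
    by simp
  define m where "m z = max 0 (\<tau> - z \<bullet> e)" for z
  define \<alpha> where "\<alpha> j z = max 0 (mollify (\<sigma> j) v z - \<epsilon>)" for j z
  define G where "G j z = 2/3 * \<alpha> j z ^ 3 * m z + 2 * \<alpha> j z * m z ^ 2 *
      (\<Sum>i\<in>UNIV. mollify (\<sigma> j) (B i) z * mollify (\<sigma> j) (V i) z)" for j z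
  have s2: "2 * \<sigma> j \<le> d" "\<tau> + \<sigma> j \<le> \<tau>'" for j
    using \<sigma>(2)[of j] by (auto simp: s0_def)
  note id = mollified_energy_identity[OF e v(1,2) V B grad[OF \<sigma>(1)] eqn[OF \<sigma>(1)] compact_imp_bounded[OF K] refl
      d(2)[unfolded K_def] \<epsilon> \<sigma>(1) s2, folded m_def \<alpha>_def, folded G_def]
  have E0: "0 \<le> E y" for y using E(2)[of y y] by simp
  have cE0: "0 \<le> mollify (\<sigma> j) E z" for j z
    unfolding mollify_def by (intro Bochner_Integration.integral_nonneg mult_nonneg_nonneg kern_nonneg \<sigma>(1) E0)
  \<comment> \<open>A bound for the time cutoff on \<open>C\<close>, where |z \<bullet> e| \<le> R.
    In \<open>c\<close> the factor 4 is the 2 in the density \<open>G\<close> times the 2 of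
    \<open>mollify_sum_bound\<close>.\<close>
  define m0 where "m0 = \<bar>\<tau>\<bar> + R"
  define c where "c = 4 * \<bar>M\<bar> * m0\<^sup>2"
  have c0: "c \<ge> 0" by (simp add: c_def)
  have mpos: "0 \<le> m z" "0 \<le> \<alpha> j z" for j z by (simp_all add: m_def \<alpha>_def)
  have lower: "0 \<le> G j z + c * mollify (\<sigma> j) E z" for j z
  proof (cases "\<alpha> j z > 0 \<and> m z > 0")
    case True
    then have zC: "z \<in> C" using id(1) by blast
    have ne: "norm e = 1" using e(1) by (simp add: norm_eq_1)
    have "\<bar>z \<bullet> e\<bar> \<le> R" using Cauchy_Schwarz_ineq2[of z e] ne R[OF zC] by simp
    then have "m z \<le> m0" using True by (auto simp: m_def m0_def)
    then have m2: "m z ^ 2 \<le> m0 ^ 2" using mpos by (intro power_mono)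
    have "mollify (\<sigma> j) v z \<le> M" using v(4) by (intro mollify_le_on_ball \<sigma> v(1))
    then have a: "\<alpha> j z \<le> \<bar>M\<bar>" using \<epsilon> by (auto simp: \<alpha>_def)
    have "\<bar>2 * \<alpha> j z * m z ^ 2 * (\<Sum>i\<in>UNIV. mollify (\<sigma> j) (B i) z * mollify (\<sigma> j) (V i) z)\<bar> =
       (2 * \<alpha> j z * m z ^ 2) * \<bar>\<Sum>i\<in>UNIV. mollify (\<sigma> j) (B i) z * mollify (\<sigma> j) (V i) z\<bar>"
      using mpos by (simp add: abs_mult)
    also have "\<dots> \<le> (2 * \<bar>M\<bar> * m0 ^ 2) * (2 * mollify (\<sigma> j) E z)"
      using mpos a m2 cE0 mollify_sum_bound[OF \<sigma>(1) V B E, where z=z]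
      by (intro mult_mono) auto
    also have "\<dots> = c * mollify (\<sigma> j) E z" by (simp add: c_def)
    finally have "- (c * mollify (\<sigma> j) E z) \<le> 2 * \<alpha> j z * m z ^ 2 * (\<Sum>i\<in>UNIV. mollify (\<sigma> j) (B i) z * mollify (\<sigma> j) (V i) z)"
      by linarith
    moreover have "0 \<le> 2/3 * \<alpha> j z ^ 3 * m z" using mpos by simp
    ultimately show ?thesis unfolding G_def by linarith
  next
    case False
    then have "\<alpha> j z = 0 \<or> m z = 0" using mpos(1)[of z] mpos(2)[of j z] by linarith
    then show ?thesis using cE0 c0 by (auto simp: G_def)
  qed
  define F where "F z = max 0 (v z - \<epsilon>) ^ 3 * m z" for z
  \<comment> \<open>All L1 errors are summed into one sequence, so that a single subsequence
    converges almost everywhere for \<open>v\<close>, \<open>E\<close> and every component of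
    \<open>V\<close> and \<open>B\<close>.\<close>
  define u where "u j z = \<bar>mollify (\<sigma> j) v z - v z\<bar> + ((\<Sum>i\<in>UNIV. \<bar>mollify (\<sigma> j) (V i) z - V i z\<bar>) +
    ((\<Sum>i\<in>UNIV. \<bar>mollify (\<sigma> j) (B i) z - B i z\<bar>) + \<bar>mollify (\<sigma> j) E z - E z\<bar>))" for j z
  note ct = mollify_L1_tendsto[of _ \<sigma>, OF _ \<sigma>(1) \<sigma>0]
  have iu: "integrable lborel (\<lambda>z. \<bar>mollify (\<sigma> j) f z - f z\<bar>)" if "integrable lborel f" for f j
    using that by (intro integrable_abs Bochner_Integration.integrable_diff ct)
  have u_int: "integrable lborel (u j)" for j
    unfolding u_def[abs_def]
    by (intro Bochner_Integration.integrable_add Bochner_Integration.integrable_sum iu v V B E)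
  have u_val: "(\<integral>z. norm (u j z) \<partial>lborel) = (\<integral>z. \<bar>mollify (\<sigma> j) v z - v z\<bar> \<partial>lborel) + ((\<Sum>i\<in>UNIV. \<integral>z. \<bar>mollify (\<sigma> j) (V i) z - V i z\<bar> \<partial>lborel) +
    ((\<Sum>i\<in>UNIV. \<integral>z. \<bar>mollify (\<sigma> j) (B i) z - B i z\<bar> \<partial>lborel) + (\<integral>z. \<bar>mollify (\<sigma> j) E z - E z\<bar> \<partial>lborel)))" for j
  proof -
    have "norm (u j z) = u j z" for z
      by (simp add: u_def sum_nonneg)
    then have "(\<integral>z. norm (u j z) \<partial>lborel) = (\<integral>z. u j z \<partial>lborel)" by simp
    also have "\<dots> = (\<integral>z. \<bar>mollify (\<sigma> j) v z - v z\<bar> \<partial>lborel) + ((\<Sum>i\<in>UNIV. \<integral>z. \<bar>mollify (\<sigma> j) (V i) z - V i z\<bar> \<partial>lborel) +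
    ((\<Sum>i\<in>UNIV. \<integral>z. \<bar>mollify (\<sigma> j) (B i) z - B i z\<bar> \<partial>lborel) + (\<integral>z. \<bar>mollify (\<sigma> j) E z - E z\<bar> \<partial>lborel)))"
      unfolding u_def
      by (simp add: iu v V B E Bochner_Integration.integrable_add Bochner_Integration.integrable_sum
          Bochner_Integration.integral_add Bochner_Integration.integral_sum)
    finally show ?thesis .
  qed
  have "(\<lambda>j. \<integral>z. norm (u j z) \<partial>lborel) \<longlonglongrightarrow> 0 + ((\<Sum>i\<in>(UNIV::'n set). 0) + ((\<Sum>i\<in>(UNIV::'n set). 0) + 0))"
    unfolding u_val by (intro tendsto_add tendsto_sum ct v V B E)
  then have "(\<lambda>j. \<integral>z. norm (u j z) \<partial>lborel) \<longlonglongrightarrow> 0" by simp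
  from tendsto_L1_AE_subseq[OF u_int this]
  obtain r where r: "strict_mono r" "AE z in lborel. (\<lambda>j. u (r j) z) \<longlonglongrightarrow> 0" by blast
  have [measurable]: "v \<in> borel_measurable borel" "E \<in> borel_measurable borel" "\<And>j. G j \<in> borel_measurable borel"
    "\<And>j. mollify (\<sigma> j) E \<in> borel_measurable borel"
    using v(1) E(1) id(2) ct(1)[OF E(1)] by (auto dest: borel_measurable_integrable)
  have [measurable]: "m \<in> borel_measurable borel" unfolding m_def[abs_def] by measurable
  have [measurable]: "F \<in> borel_measurable borel" unfolding F_def[abs_def] by measurable
  \<comment> \<open>In the pointwise limit the sum of the products of \<open>B i z\<close> and
    \<open>V i z\<close> is nonnegative by \<open>mono\<close>, and its term is dropped.\<close>
  have ae: "AE z in lborel. ennreal (2/3 * F z + c * E z) \<le>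
      liminf (\<lambda>j. ennreal (G (r j) z + c * mollify (\<sigma> (r j)) E z))"
    using r(2)
  proof eventually_elim
    fix z assume u0: "(\<lambda>j. u (r j) z) \<longlonglongrightarrow> 0"
    have lim: "(\<lambda>j. mollify (\<sigma> (r j)) f z) \<longlonglongrightarrow> f z" if "\<And>j. \<bar>mollify (\<sigma> j) f z - f z\<bar> \<le> u j z" for f
    proof -
      have "(\<lambda>j. mollify (\<sigma> (r j)) f z - f z) \<longlonglongrightarrow> 0"
        by (rule tendsto_rabs_zero_cancel, rule tendsto_sandwich[OF _ _ tendsto_const u0]) (auto simp: that)
      then show ?thesis by (simp add: LIM_zero_iff)
    qed
    have "(\<lambda>j. mollify (\<sigma> (r j)) v z) \<longlonglongrightarrow> v z" "(\<lambda>j. mollify (\<sigma> (r j)) E z) \<longlonglongrightarrow> E z"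
      by (rule lim; simp add: u_def add_nonneg_nonneg sum_nonneg)+
    moreover have "(\<lambda>j. mollify (\<sigma> (r j)) (V i) z) \<longlonglongrightarrow> V i z" for i
    proof (rule lim)
      fix j
      have "\<bar>mollify (\<sigma> j) (V i) z - V i z\<bar> \<le> (\<Sum>i\<in>UNIV. \<bar>mollify (\<sigma> j) (V i) z - V i z\<bar>)"
        by (rule member_le_sum) auto
      also have "\<dots> \<le> u j z" by (simp add: u_def add_nonneg_nonneg sum_nonneg)
      finally show "\<bar>mollify (\<sigma> j) (V i) z - V i z\<bar> \<le> u j z" .
    qed
    moreover have "(\<lambda>j. mollify (\<sigma> (r j)) (B i) z) \<longlonglongrightarrow> B i z" for i
    proof (rule lim)
      fix j
      have "\<bar>mollify (\<sigma> j) (B i) z - B i z\<bar> \<le> (\<Sum>i\<in>UNIV. \<bar>mollify (\<sigma> j) (B i) z - B i z\<bar>)"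
        by (rule member_le_sum) auto
      also have "\<dots> \<le> u j z" by (simp add: u_def add_nonneg_nonneg sum_nonneg)
      finally show "\<bar>mollify (\<sigma> j) (B i) z - B i z\<bar> \<le> u j z" .
    qed
    ultimately have "(\<lambda>j. ennreal (G (r j) z + c * mollify (\<sigma> (r j)) E z)) \<longlonglongrightarrow>
       ennreal ((2/3 * max 0 (v z - \<epsilon>) ^ 3 * m z + 2 * max 0 (v z - \<epsilon>) * m z ^ 2 * (\<Sum>i\<in>UNIV. B i z * V i z)) + c * E z)"
      unfolding G_def \<alpha>_def by (intro tendsto_intros)
    then have "liminf (\<lambda>j. ennreal (G (r j) z + c * mollify (\<sigma> (r j)) E z)) =
       ennreal ((2/3 * max 0 (v z - \<epsilon>) ^ 3 * m z + 2 * max 0 (v z - \<epsilon>) * m z ^ 2 * (\<Sum>i\<in>UNIV. B i z * V i z)) + c * E z)"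
      by (rule lim_imp_Liminf[OF sequentially_bot])
    moreover have "0 \<le> 2 * max 0 (v z - \<epsilon>) * m z ^ 2 * (\<Sum>i\<in>UNIV. B i z * V i z)"
      using mono[of z] by simp
    ultimately show "ennreal (2/3 * F z + c * E z) \<le> liminf (\<lambda>j. ennreal (G (r j) z + c * mollify (\<sigma> (r j)) E z))"
      unfolding F_def by (simp add: ennreal_leI)
  qed
  \<comment> \<open>Fatou's lemma for the nonnegative functions built from \<open>G\<close> and a
    multiple of the mollified \<open>E\<close>. Since \<open>G\<close> has integral 0, only the
    integral of \<open>c * E\<close> survives on the right; it also occurs on the left and cancels,
    which forces \<open>F\<close> to vanish almost everywhere.\<close>
  have "(\<integral>\<^sup>+z. ennreal (2/3 * F z + c * E z) \<partial>lborel) \<le> (\<integral>\<^sup>+z. liminf (\<lambda>j. ennreal (G (r j) z + c * mollify (\<sigma> (r j)) E z)) \<partial>lborel)"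
    by (rule nn_integral_mono_AE[OF ae])
  also have "\<dots> \<le> liminf (\<lambda>j. \<integral>\<^sup>+z. ennreal (G (r j) z + c * mollify (\<sigma> (r j)) E z) \<partial>lborel)"
    by (rule nn_integral_liminf) simp
  also have "\<dots> = ennreal (c * (\<integral>z. E z \<partial>lborel))"
  proof -
    have "(\<integral>\<^sup>+z. ennreal (G j z + c * mollify (\<sigma> j) E z) \<partial>lborel) = ennreal (c * (\<integral>z. mollify (\<sigma> j) E z \<partial>lborel))" for j
    proof -
      have "(\<integral>\<^sup>+z. ennreal (G j z + c * mollify (\<sigma> j) E z) \<partial>lborel) = ennreal (\<integral>z. G j z + c * mollify (\<sigma> j) E z \<partial>lborel)"
        by (rule nn_integral_eq_integral) (auto intro!: id(2) ct(1) E(1) integrable_mult_right simp: lower)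
      also have "(\<integral>z. G j z + c * mollify (\<sigma> j) E z \<partial>lborel) = c * (\<integral>z. mollify (\<sigma> j) E z \<partial>lborel)"
        using id(3)[of j] by (subst Bochner_Integration.integral_add) (auto intro!: id(2) ct(1) E(1) integrable_mult_right)
      finally show ?thesis .
    qed
    moreover have "(\<lambda>j. \<integral>z. mollify (\<sigma> j) E z \<partial>lborel) \<longlonglongrightarrow> (\<integral>z. E z \<partial>lborel)"
    proof -
      have "(\<lambda>j. (\<integral>z. mollify (\<sigma> j) E z \<partial>lborel) - (\<integral>z. E z \<partial>lborel)) \<longlonglongrightarrow> 0"
      proof (rule tendsto_rabs_zero_cancel, rule tendsto_sandwich[OF _ _ tendsto_const ct(2)[OF E(1)]])
        show "\<forall>\<^sub>F j in sequentially. \<bar>(\<integral>z. mollify (\<sigma> j) E z \<partial>lborel) - (\<integral>z. E z \<partial>lborel)\<bar> \<le> (\<integral>z. \<bar>mollify (\<sigma> j) E z - E z\<bar> \<partial>lborel)"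
          using integral_abs_bound[of lborel "\<lambda>z. mollify (\<sigma> j) E z - E z" for j]
          by (simp add: Bochner_Integration.integral_diff ct(1) E(1))
      qed simp
      then show ?thesis by (simp add: LIM_zero_iff)
    qed
    then have "(\<lambda>j. ennreal (c * (\<integral>z. mollify (\<sigma> (r j)) E z \<partial>lborel))) \<longlonglongrightarrow> ennreal (c * (\<integral>z. E z \<partial>lborel))"
      using LIMSEQ_subseq_LIMSEQ[OF _ r(1)] by (intro tendsto_intros) (auto simp: o_def)
    ultimately show ?thesis by (simp add: lim_imp_Liminf)
  qed
  finally have fin: "(\<integral>\<^sup>+z. ennreal (2/3 * F z + c * E z) \<partial>lborel) \<le> ennreal (c * (\<integral>z. E z \<partial>lborel))" .
  have F0: "0 \<le> F z" for z using mpos by (simp add: F_def)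
  have "(\<integral>\<^sup>+z. ennreal (2/3 * F z + c * E z) \<partial>lborel) = (\<integral>\<^sup>+z. ennreal (2/3 * F z) \<partial>lborel) + (\<integral>\<^sup>+z. ennreal (c * E z) \<partial>lborel)"
    using F0 E0 c0 by (subst nn_integral_add[symmetric]) (auto intro!: nn_integral_cong simp: ennreal_plus)
  also have "(\<integral>\<^sup>+z. ennreal (c * E z) \<partial>lborel) = ennreal (c * (\<integral>z. E z \<partial>lborel))"
    using E0 c0 by (subst nn_integral_eq_integral) (auto intro!: E(1))
  finally have "ennreal (c * (\<integral>z. E z \<partial>lborel)) + (\<integral>\<^sup>+z. ennreal (2/3 * F z) \<partial>lborel) \<le> ennreal (c * (\<integral>z. E z \<partial>lborel)) + 0"
    using fin by (simp only: add.commute[of "ennreal (c * (\<integral>z. E z \<partial>lborel))"] add_0)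
  then have "(\<integral>\<^sup>+z. ennreal (2/3 * F z) \<partial>lborel) \<le> 0"
    unfolding ennreal_add_left_cancel_le by (auto simp del: ennreal_eq_0_iff)
  then have "(\<integral>\<^sup>+z. ennreal (2/3 * F z) \<partial>lborel) = 0" by simp
  then have "AE z in lborel. ennreal (2/3 * F z) = 0"
    by (subst (asm) nn_integral_0_iff_AE) auto
  then have aeF: "AE z in lborel. F z = 0"
    by eventually_elim (use F0 in \<open>simp add: ennreal_eq_0_iff antisym\<close>)
  show ?thesis
  proof (rule ccontr)
    assume n: "\<not> v z0 \<le> \<epsilon>"
    \<comment> \<open>If \<open>v z0\<close> exceeded \<epsilon>, then \<open>F\<close> would be
      positive on this nonempty open set, which is not a null set.\<close>
    define O' where "O' = (C \<inter> v -` {\<epsilon><..}) \<inter> {z. z \<bullet> e < \<tau>}"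
    have "open O'" unfolding O'_def
    proof (rule open_Int)
      show "open (C \<inter> v -` {\<epsilon><..})"
        by (rule continuous_open_preimage[OF v(3) C(1)]) simp
      show "open {z. z \<bullet> e < \<tau>}" by (rule open_Collect_less) (intro continuous_intros)+
    qed
    have "AE z in lborel. z \<notin> O'"
      using aeF by eventually_elim (auto simp: O'_def F_def m_def)
    then have "O' \<in> null_sets lborel"
      using \<open>open O'\<close> by (subst (asm) AE_iff_null_sets[symmetric]) auto
    then have "negligible O'"
      by (simp add: negligible_iff_null_sets null_sets_completionI)
    moreover have "z0 \<in> O'" using n z0 by (auto simp: O'_def)
    ultimately show False using open_not_negligible[OF \<open>open O'\<close>] by blast
  qed
qed

section \<open>Comparison principle for weak solutions\<close>

lemma kern_test_function:
  assumes "\<sigma> > 0" "open S" "cball z \<sigma> \<subseteq> S"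
  shows "test_function S (\<lambda>q. kern \<sigma> (z - q))"
proof -
  have "Ck k (\<lambda>q. kern \<sigma> (z - q))" for k
    unfolding kern_def by (rule Ck_exp_bump_comp)
  moreover have c: "closure {q. kern \<sigma> (z - q) \<noteq> 0} \<subseteq> cball z \<sigma>"
  proof (rule closure_minimal)
    show "{q. kern \<sigma> (z - q) \<noteq> 0} \<subseteq> cball z \<sigma>"
    proof
      fix q assume "q \<in> {q. kern \<sigma> (z - q) \<noteq> 0}"
      then have "norm (z - q) < \<sigma>"
        using kern_eq_0[OF assms(1)] by (metis (mono_tags) mem_Collect_eq not_le)
      then show "q \<in> cball z \<sigma>" by (simp add: dist_norm)
    qed
  qed simp
  moreover have "compact (closure {q. kern \<sigma> (z - q) \<noteq> 0})"
    using c bounded_subset[OF bounded_cball] by (simp add: compact_eq_bounded_closed)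
  ultimately show ?thesis
    using assms unfolding test_function_def compactly_contained_def by blast
qed

lemma kern_frechet:
  "frechet_derivative (\<lambda>q. kern \<sigma> (z - q)) (at q) b = - dkern \<sigma> b (z - q)"
  unfolding kern_def dkern_def frechet_exp_bump_comp by simp

text \<open>A slice of the space-time kernel is again a bump in space; if the squared time distance
  exceeds the squared radius it is simply zero. So the general results on \<open>exp_bump\<close>
  also serve for the weak gradient on time slices.\<close>

lemma kern_slice:
  fixes x y :: "'a::euclidean_space" and s t :: real
  shows "kern \<sigma> ((x, t) - (y, s)) = (1 / bump_mass TYPE('a \<times> real) \<sigma>) * exp_bump 0 ((\<sigma>\<^sup>2 - (t - s)\<^sup>2) - (x - y) \<bullet> (x - y))"
  by (simp add: kern_def inner_prod_def power2_eq_square algebra_simps)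

lemma kern_slice_frechet:
  fixes x y h :: "'a::euclidean_space" and s t :: real
  shows "frechet_derivative (\<lambda>y. kern \<sigma> ((x, t) - (y, s))) (at y) h = - dkern \<sigma> (h, 0) ((x, t) - (y, s))"
  unfolding kern_slice dkern_def frechet_exp_bump_comp
  by (simp add: inner_prod_def power2_eq_square algebra_simps)

lemma kern_slice_test_function:
  fixes x :: "'a::euclidean_space" and s t :: real
  assumes \<sigma>: "\<sigma> > 0" "cball (x, t) \<sigma> \<subseteq> U \<times> I"
  shows "test_function U (\<lambda>y. kern \<sigma> ((x, t) - (y, s)))"
proof -
  have "Ck k (\<lambda>y. kern \<sigma> ((x, t) - (y, s)))" for k
    unfolding kern_slice by (rule Ck_exp_bump_comp)
  moreover have c: "closure {y. kern \<sigma> ((x, t) - (y, s)) \<noteq> 0} \<subseteq> cball x \<sigma>"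
  proof (rule closure_minimal)
    show "{y. kern \<sigma> ((x, t) - (y, s)) \<noteq> 0} \<subseteq> cball x \<sigma>"
    proof
      fix y assume "y \<in> {y. kern \<sigma> ((x, t) - (y, s)) \<noteq> 0}"
      then have "norm ((x, t) - (y, s)) < \<sigma>"
        using kern_eq_0[OF \<sigma>(1)] by (metis (mono_tags) mem_Collect_eq not_le)
      moreover have "norm (x - y) \<le> norm ((x, t) - (y, s))"
        using norm_fst_le[of "x - y" "t - s"] by simp
      ultimately show "y \<in> cball x \<sigma>" by (simp add: dist_norm)
    qed
  qed simp
  moreover have "cball x \<sigma> \<subseteq> U"
  proof
    fix y assume "y \<in> cball x \<sigma>"
    then have "(y, t) \<in> cball (x, t) \<sigma>" by (simp add: dist_Pair_Pair)
    then show "y \<in> U" using \<sigma>(2) by auto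
  qed
  moreover have "compact (closure {y. kern \<sigma> ((x, t) - (y, s)) \<noteq> 0})"
    using c bounded_subset[OF bounded_cball] by (simp add: compact_eq_bounded_closed)
  ultimately show ?thesis
    unfolding test_function_def compactly_contained_def by blast
qed

text \<open>Weak gradients are only Lebesgue measurable, while Fubini's theorem and the
  mollification are carried out for Borel functions. The representative is built componentwise from
  Borel versions of real functions.\<close>

lemma borel_version_on:
  fixes g :: "'a::euclidean_space \<Rightarrow> real^'n"
  assumes g: "set_borel_measurable lebesgue S g" and S: "S \<in> sets borel"
  obtains g0 where "g0 \<in> borel_measurable borel" "\<And>z. z \<notin> S \<Longrightarrow> g0 z = 0" "AE z in lborel. z \<in> S \<longrightarrow> g z = g0 z"
proof -
  have "\<exists>f\<in>borel_measurable lborel. AE z in lborel. (indicator S z *\<^sub>R g z) $ i = f z" for i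
  proof (rule completion_ex_borel_measurable_real)
    have "(\<lambda>z. indicator S z *\<^sub>R g z) \<in> borel_measurable lebesgue"
      using g by (simp add: set_borel_measurable_def)
    then show "(\<lambda>z. (indicator S z *\<^sub>R g z) $ i) \<in> borel_measurable lebesgue"
      by (rule measurable_compose) (intro borel_measurable_continuous_onI continuous_intros)
  qed
  then obtain f where f: "\<And>i. f i \<in> borel_measurable lborel" "\<And>i. AE z in lborel. (indicator S z *\<^sub>R g z) $ i = f i z"
    by metis
  have [measurable]: "f i \<in> borel_measurable borel" for i using f(1) by simp
  have [measurable]: "S \<in> sets borel" by (rule S)
  define g0 where "g0 z = (\<chi> i. indicator S z * f i z)" for z
  have "g0 \<in> borel_measurable borel"
    unfolding g0_def[abs_def] by (subst borel_measurable_euclidean_space) (auto simp: Basis_vec_def inner_axis)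
  moreover have "AE z in lborel. z \<in> S \<longrightarrow> g z = g0 z"
  proof -
    have "AE z in lborel. \<forall>i\<in>UNIV. (indicator S z *\<^sub>R g z) $ i = f i z"
      using f(2) by (subst AE_finite_all) auto
    then show ?thesis
      by eventually_elim (auto simp: g0_def vec_eq_iff)
  qed
  ultimately show ?thesis by (intro that[of g0]) (auto simp: g0_def vec_eq_iff)
qed

text \<open>Every power |g|^r with 0 < r \<le> p is dominated by 1 + |g|^p, which is integrable over
  a bounded set; the exponents needed are r = 1 for the gradient and r = p - 1 for the flux.\<close>

lemma integrable_p_laplace_flux:
  fixes g :: "'a::euclidean_space \<Rightarrow> real^'n"
  assumes p: "p > 2" and g: "g \<in> borel_measurable borel" "\<And>z. z \<notin> S \<Longrightarrow> g z = 0"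
    and ip: "integrable lborel (\<lambda>z. norm (g z) powr p)" and S: "S \<in> sets borel" "bounded S"
  shows "integrable lborel (\<lambda>z. g z $ i)" "integrable lborel (\<lambda>z. (norm (g z) powr (p - 2) *\<^sub>R g z) $ i)"
proof -
  note [measurable] = g(1) S(1)
  have iS: "integrable lborel (indicator S :: 'a \<Rightarrow> real)"
    using S emeasure_bounded_finite[of S] by (auto simp: integrable_indicator_iff)
  have ib: "integrable lborel (\<lambda>z. indicator S z + norm (g z) powr p)"
    by (intro Bochner_Integration.integrable_add iS ip)
  have m: "(\<lambda>x. x $ i) \<in> borel_measurable (borel :: (real^'n) measure)"
    by (intro borel_measurable_continuous_onI continuous_intros)
  have q: "a powr q \<le> 1 + a powr p" if "a \<ge> 0" "0 < q" "q \<le> p" for a q :: real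
  proof (cases "a \<le> 1")
    case True
    then have "a powr q \<le> 1" using that powr_mono2[of q a 1] by simp
    then show ?thesis by (simp add: add_increasing2)
  next
    case False
    then show ?thesis using that powr_mono[of q p a] by (simp add: add_increasing)
  qed
  show "integrable lborel (\<lambda>z. g z $ i)"
  proof (rule Bochner_Integration.integrable_bound[OF ib])
    show "(\<lambda>z. g z $ i) \<in> borel_measurable lborel"
      using measurable_compose[OF g(1) m] by simp
    show "AE z in lborel. norm (g z $ i) \<le> norm (indicator S z + norm (g z) powr p)"
    proof (rule AE_I2)
      fix z
      have "norm (g z $ i) \<le> norm (g z)" by (simp only: real_norm_def component_le_norm_cart)
      also have "\<dots> \<le> indicator S z + norm (g z) powr p"
        using q[of "norm (g z)" 1] p g(2)[of z] by (cases "z \<in> S") auto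
      finally show "norm (g z $ i) \<le> norm (indicator S z + norm (g z) powr p)" by simp
    qed
  qed
  show "integrable lborel (\<lambda>z. (norm (g z) powr (p - 2) *\<^sub>R g z) $ i)"
  proof (rule Bochner_Integration.integrable_bound[OF ib])
    have "(\<lambda>z. g z $ i) \<in> borel_measurable borel"
      using measurable_compose[OF g(1) m] by simp
    then show "(\<lambda>z. (norm (g z) powr (p - 2) *\<^sub>R g z) $ i) \<in> borel_measurable lborel"
      by simp
    show "AE z in lborel. norm ((norm (g z) powr (p - 2) *\<^sub>R g z) $ i) \<le> norm (indicator S z + norm (g z) powr p)"
    proof (rule AE_I2)
      fix z
      have "norm ((norm (g z) powr (p - 2) *\<^sub>R g z) $ i) \<le> norm (norm (g z) powr (p - 2) *\<^sub>R g z)"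
        by (simp only: real_norm_def component_le_norm_cart)
      also have "\<dots> = norm (g z) powr (p - 1)"
        using powr_mult_base[of "norm (g z)" "p - 2"] by (simp add: mult.commute)
      also have "\<dots> \<le> indicator S z + norm (g z) powr p"
        using q[of "norm (g z)" "p - 1"] p g(2)[of z] by (cases "z \<in> S") auto
      finally show "norm ((norm (g z) powr (p - 2) *\<^sub>R g z) $ i) \<le> norm (indicator S z + norm (g z) powr p)" by simp
    qed
  qed
qed

text \<open>Inserting the reflected kernel as test function turns the weak identities into pointwise
  identities between mollifications wherever the \<sigma>-ball lies in \<open>C\<close>. Cutting
  \<open>u\<close> off outside \<open>C\<close> does not affect these values.\<close>

lemma weak_solution_mollified:
  fixes u :: "(real^'n) \<times> real \<Rightarrow> real" and U :: "(real^'n) set" and s1 s2 p :: real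
  assumes p: "p > 2" and U: "open U" "bounded U"
  defines "C \<equiv> U \<times> {s1<..<s2}"
  assumes sob: "parabolic_Sobolev p U s1 s2 u g"
    and eq: "\<And>\<phi>. test_function C \<phi> \<Longrightarrow>
      (LINT z:C|lebesgue. norm (g z) powr (p - 2) * (g z \<bullet> spatial_gradient \<phi> z)) -
      (LINT z:C|lebesgue. u z * time_derivative \<phi> z) = 0"
    and u0: "integrable lborel u0" "\<And>z. z \<in> C \<Longrightarrow> u0 z = u z" "\<And>z. z \<notin> C \<Longrightarrow> u0 z = 0"
  obtains g0 where "g0 \<in> borel_measurable borel" "\<And>z. z \<notin> C \<Longrightarrow> g0 z = 0"
    "integrable lborel (\<lambda>z. norm (g0 z) powr p)"
    "\<And>\<sigma> z i. \<sigma> > 0 \<Longrightarrow> cball z \<sigma> \<subseteq> C \<Longrightarrow> dmollify \<sigma> (axis i 1, 0) u0 z = mollify \<sigma> (\<lambda>z. g0 z $ i) z"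
    "\<And>\<sigma> z. \<sigma> > 0 \<Longrightarrow> cball z \<sigma> \<subseteq> C \<Longrightarrow> dmollify \<sigma> (0, 1) u0 z =
       (\<Sum>i\<in>UNIV. dmollify \<sigma> (axis i 1, 0) (\<lambda>z. (norm (g0 z) powr (p - 2) *\<^sub>R g0 z) $ i) z)"
proof -
  have Cop: "open C" unfolding C_def by (intro open_Times U) simp
  have Cbd: "bounded C" unfolding C_def 
    by (intro bounded_Times U bounded_subset[OF compact_imp_bounded[OF compact_Icc[of s1 s2]]]) auto
  have [measurable]: "C \<in> sets borel" using Cop by simp
  have LpG: "Lp_on p C g" and slices: "AE t in lebesgue. t \<in> {s1<..<s2} \<longrightarrow>
        W1p_with_gradient p U (\<lambda>x. u (x, t)) (\<lambda>x. g (x, t))"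
    using sob unfolding parabolic_Sobolev_def C_def by auto
  obtain g0 where g0: "g0 \<in> borel_measurable borel" "\<And>z. z \<notin> C \<Longrightarrow> g0 z = 0" "AE z in lborel. z \<in> C \<longrightarrow> g z = g0 z"
    using borel_version_on[of C g] LpG unfolding Lp_on_def by auto
  note [measurable] = g0(1)
  have u0m[measurable]: "u0 \<in> borel_measurable borel" using u0(1) by simp
  have gi_m: "(\<lambda>z. g0 z $ i) \<in> borel_measurable borel" for i
    by (rule measurable_compose[OF g0(1)]) (intro borel_measurable_continuous_onI continuous_intros)
  note [measurable] = gi_m
  have ip: "integrable lborel (\<lambda>z. norm (g0 z) powr p)"
  proof -
    have "integrable lebesgue (\<lambda>z. indicator C z *\<^sub>R (norm (g z) powr p))"
      using LpG unfolding Lp_on_def set_integrable_def by simp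
    moreover have ae: "AE z in lebesgue. indicator C z *\<^sub>R (norm (g z) powr p) = norm (g0 z) powr p"
      using AE_completion[OF g0(3)] by eventually_elim (use g0(2) p in \<open>auto simp: indicator_def\<close>)
    ultimately have "integrable lebesgue (\<lambda>z. norm (g0 z) powr p)"
      by (subst integrable_cong_AE[symmetric, OF borel_measurable_integrable _ ae]) (auto intro!: measurable_completion)
    then show ?thesis by (subst (asm) integrable_completion) auto
  qed
  have gi: "integrable lborel (\<lambda>z. g0 z $ i)" "integrable lborel (\<lambda>z. (norm (g0 z) powr (p - 2) *\<^sub>R g0 z) $ i)" for i
    using integrable_p_laplace_flux[OF p g0(1,2) ip _ Cbd] by auto
  \<comment> \<open>The null set is enlarged to a measurable set \<open>N\<close>, because
    exchanging the two almost-everywhere quantifiers requires measurability.\<close>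
  have slice_ae: "AE s in lborel. AE y in lborel. (y, s) \<in> C \<longrightarrow> g (y, s) = g0 (y, s)"
  proof -
    obtain N where N: "N \<in> null_sets lborel" "{z. \<not> (z \<in> C \<longrightarrow> g z = g0 z)} \<subseteq> N"
      using g0(3) by (auto elim: AE_E simp: null_sets_def)
    have Ns: "N \<in> sets (lborel \<Otimes>\<^sub>M lborel)" unfolding lborel_prod using N(1) by blast
    have "AE z in lborel \<Otimes>\<^sub>M lborel. z \<notin> N"
      using N(1) by (simp add: lborel_prod AE_not_in)
    then have "AE y in lborel. AE s in lborel. (y, s) \<notin> N"
      by (rule lborel_pair.AE_pair)
    moreover have "{x \<in> space (lborel \<Otimes>\<^sub>M lborel). (fst x, snd x) \<notin> N} \<in> sets (lborel \<Otimes>\<^sub>M lborel)"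
    proof -
      have "{x \<in> space (lborel \<Otimes>\<^sub>M lborel). (fst x, snd x) \<notin> N} = space (lborel \<Otimes>\<^sub>M lborel) - N" by auto
      then show ?thesis using sets.compl_sets[OF Ns] by (simp only:)
    qed
    ultimately have "AE s in lborel. AE y in lborel. (y, s) \<notin> N"
      using lborel_pair.AE_commute[of "\<lambda>y s. (y, s) \<notin> N"] by simp
    then show ?thesis
    proof eventually_elim
      fix s assume "AE y in lborel. (y, s) \<notin> N"
      then show "AE y in lborel. (y, s) \<in> C \<longrightarrow> g (y, s) = g0 (y, s)"
        by eventually_elim (use N(2) in blast)
    qed
  qed
  have grad: "dmollify \<sigma> (axis i 1, 0) u0 z = mollify \<sigma> (\<lambda>z. g0 z $ i) z" if \<sigma>: "\<sigma> > 0" "cball z \<sigma> \<subseteq> C" for \<sigma> z i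
  proof -
    obtain x t where z: "z = (x, t)" by (cases z)
    let ?b = "(axis i 1, 0) :: (real^'n) \<times> real"
    have km[measurable]: "kern \<sigma> \<in> borel_measurable (borel::((real^'n) \<times> real) measure)"
      "dkern \<sigma> ?b \<in> borel_measurable (borel::((real^'n) \<times> real) measure)"
      using kern_continuous[OF \<sigma>(1)] dkern_continuous[OF \<sigma>(1)] by (auto intro: borel_measurable_continuous_onI)
    have fub: "integral\<^sup>L lborel f = (\<integral>s. (\<integral>y. f (y, s) \<partial>lborel) \<partial>lborel)" if "integrable lborel f"
      for f :: "(real^'n) \<times> real \<Rightarrow> real"
      using lborel_pair.integral_snd[of "\<lambda>y s. f (y, s)"] that by (simp add: lborel_prod split_def)
    have slm: "(\<lambda>y. f (y, s)) \<in> borel_measurable borel" if "f \<in> borel_measurable borel" 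
      for f :: "(real^'n) \<times> real \<Rightarrow> real" and s
      using measurable_compose[OF _ that, of "\<lambda>y. (y, s)" borel] by (simp add: borel_prod[symmetric])
    \<comment> \<open>The weak gradient identity is available only slice by slice, for almost every
      time. It is applied to the slice of the kernel and then integrated in time by Fubini's
      theorem.\<close>
    have "AE s in lborel. (\<integral>y. dkern \<sigma> ?b (z - (y, s)) * u0 (y, s) \<partial>lborel) = (\<integral>y. kern \<sigma> (z - (y, s)) * g0 (y, s) $ i \<partial>lborel)"
      using slice_ae slices[unfolded AE_completion_iff]
    proof eventually_elim
      fix s assume ae: "AE y in lborel. (y, s) \<in> C \<longrightarrow> g (y, s) = g0 (y, s)"
        and W: "s \<in> {s1<..<s2} \<longrightarrow> W1p_with_gradient p U (\<lambda>x. u (x, s)) (\<lambda>x. g (x, s))"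
      show "(\<integral>y. dkern \<sigma> ?b (z - (y, s)) * u0 (y, s) \<partial>lborel) = (\<integral>y. kern \<sigma> (z - (y, s)) * g0 (y, s) $ i \<partial>lborel)"
      proof (cases "s \<in> {s1<..<s2}")
        case False
        then have "(y, s) \<notin> C" for y by (auto simp: C_def)
        then show ?thesis using u0(3) g0(2) by simp
      next
        case True
        let ?\<phi> = "\<lambda>y. kern \<sigma> ((x, t) - (y, s))"
        have "test_function U ?\<phi>"
          using kern_slice_test_function[OF \<sigma>(1)] \<sigma>(2) z by (simp add: C_def)
        then have *: "(LINT y:U|lebesgue. u (y, s) * frechet_derivative ?\<phi> (at y) (axis i 1)) =
          - (LINT y:U|lebesgue. g (y, s) $ i * ?\<phi> y)"
          using W True unfolding W1p_with_gradient_def by blast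
        have "(LINT y:U|lebesgue. u (y, s) * frechet_derivative ?\<phi> (at y) (axis i 1)) =
          (\<integral>y. - (dkern \<sigma> ?b (z - (y, s)) * u0 (y, s)) \<partial>lebesgue)"
          unfolding set_lebesgue_integral_def
          by (rule Bochner_Integration.integral_cong)
            (use True u0(2,3) in \<open>auto simp: indicator_def C_def z kern_slice_frechet[unfolded diff_Pair]\<close>)
        also have "\<dots> = - (\<integral>y. dkern \<sigma> ?b (z - (y, s)) * u0 (y, s) \<partial>lborel)"
          using slm[of "\<lambda>q. dkern \<sigma> ?b (z - q) * u0 q" s] by (simp add: integral_completion)
        finally have 1: "(LINT y:U|lebesgue. u (y, s) * frechet_derivative ?\<phi> (at y) (axis i 1)) =
           - (\<integral>y. dkern \<sigma> ?b (z - (y, s)) * u0 (y, s) \<partial>lborel)" .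
        have aeq: "AE y in lebesgue. kern \<sigma> (z - (y, s)) * g0 (y, s) $ i = indicator U y *\<^sub>R (g (y, s) $ i * ?\<phi> y)"
          using AE_completion[OF ae]
          by eventually_elim (use True g0(2) in \<open>auto simp: indicator_def C_def z\<close>)
        have mm: "(\<lambda>y. kern \<sigma> (z - (y, s)) * g0 (y, s) $ i) \<in> borel_measurable lborel"
          using slm[of "\<lambda>q. kern \<sigma> (z - q) * g0 q $ i" s] by simp
        have "(LINT y:U|lebesgue. g (y, s) $ i * ?\<phi> y) = (\<integral>y. kern \<sigma> (z - (y, s)) * g0 (y, s) $ i \<partial>lebesgue)"
          unfolding set_lebesgue_integral_def
        proof (rule integral_cong_AE[symmetric, OF measurable_completion[OF mm] _ aeq])
          show "(\<lambda>y. indicator U y *\<^sub>R (g (y, s) $ i * ?\<phi> y)) \<in> borel_measurable lebesgue"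
            by (rule borel_measurable_AE[OF measurable_completion[OF mm] aeq])
        qed
        also have "\<dots> = (\<integral>y. kern \<sigma> (z - (y, s)) * g0 (y, s) $ i \<partial>lborel)"
          by (rule integral_completion[OF mm])
        finally show ?thesis using * 1 by simp
      qed
    qed
    then have "(\<integral>s. (\<integral>y. dkern \<sigma> ?b (z - (y, s)) * u0 (y, s) \<partial>lborel) \<partial>lborel) = (\<integral>s. (\<integral>y. kern \<sigma> (z - (y, s)) * g0 (y, s) $ i \<partial>lborel) \<partial>lborel)"
      by (rule integral_cong_AE[rotated 2]) (use u0m km gi_m in \<open>auto intro!: lborel.borel_measurable_lebesgue_integral\<close>)
    then show ?thesis
      unfolding dmollify_def mollify_def
      by (simp only: fub[OF integrable_kern_mult(2)[OF \<sigma>(1) u0(1)]] fub[OF integrable_kern_mult(1)[OF \<sigma>(1) gi(1)]])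
  qed
  have eqn: "dmollify \<sigma> (0, 1) u0 z = (\<Sum>i\<in>UNIV. dmollify \<sigma> (axis i 1, 0) (\<lambda>z. (norm (g0 z) powr (p - 2) *\<^sub>R g0 z) $ i) z)"
    if \<sigma>: "\<sigma> > 0" "cball z \<sigma> \<subseteq> C" for \<sigma> z
  proof -
    let ?\<phi> = "\<lambda>q. kern \<sigma> (z - q)"
    have km[measurable]: "dkern \<sigma> b \<in> borel_measurable (borel::((real^'n) \<times> real) measure)" for b
      using dkern_continuous[OF \<sigma>(1)] by (auto intro: borel_measurable_continuous_onI)
    note E = eq[OF kern_test_function[OF \<sigma>(1) Cop \<sigma>(2)]]
    have "(LINT q:C|lebesgue. u q * time_derivative ?\<phi> q) = (\<integral>q. - (dkern \<sigma> (0, 1) (z - q) * u0 q) \<partial>lebesgue)"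
      unfolding set_lebesgue_integral_def
      by (rule Bochner_Integration.integral_cong) (use u0(2,3) in \<open>auto simp: indicator_def time_derivative_def kern_frechet\<close>)
    also have "\<dots> = - dmollify \<sigma> (0, 1) u0 z"
      by (simp add: integral_completion dmollify_def)
    finally have 1: "(LINT q:C|lebesgue. u q * time_derivative ?\<phi> q) = - dmollify \<sigma> (0, 1) u0 z" .
    \<comment> \<open>A Borel version of the flux integrand. The minus sign comes from
      differentiating the reflected kernel.\<close>
    define J where "J q = - (\<Sum>i\<in>UNIV. dkern \<sigma> (axis i 1, 0) (z - q) * (norm (g0 q) powr (p - 2) *\<^sub>R g0 q) $ i)" for q
    have Jm: "J \<in> borel_measurable lborel"
      unfolding J_def[abs_def] by (simp add: gi_m)
    have aeq: "AE q in lebesgue. J q = indicator C q *\<^sub>R (norm (g q) powr (p - 2) * (g q \<bullet> spatial_gradient ?\<phi> q))"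
      using AE_completion[OF g0(3)]
    proof eventually_elim
      fix q assume *: "q \<in> C \<longrightarrow> g q = g0 q"
      show "J q = indicator C q *\<^sub>R (norm (g q) powr (p - 2) * (g q \<bullet> spatial_gradient ?\<phi> q))"
        using * g0(2)[of q]
        by (cases "q \<in> C") (auto simp: J_def inner_vec_def spatial_gradient_def kern_frechet sum_distrib_left sum_negf algebra_simps)
    qed
    have "(LINT q:C|lebesgue. norm (g q) powr (p - 2) * (g q \<bullet> spatial_gradient ?\<phi> q)) = (\<integral>q. J q \<partial>lebesgue)"
      unfolding set_lebesgue_integral_def
      by (rule integral_cong_AE[symmetric, OF measurable_completion[OF Jm] _ aeq])
       (rule borel_measurable_AE[OF measurable_completion[OF Jm] aeq])
    also have "\<dots> = (\<integral>q. J q \<partial>lborel)" by (rule integral_completion[OF Jm])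
    also have "\<dots> = - (\<Sum>i\<in>UNIV. dmollify \<sigma> (axis i 1, 0) (\<lambda>z. (norm (g0 z) powr (p - 2) *\<^sub>R g0 z) $ i) z)"
      unfolding J_def dmollify_def
      by (subst Bochner_Integration.integral_minus, subst Bochner_Integration.integral_sum)
        (auto intro!: integrable_kern_mult(2)[OF \<sigma>(1)] gi simp del: vector_scaleR_component)
    finally show ?thesis using E 1 by simp
  qed
  show ?thesis by (rule that[OF g0(1,2) ip grad eqn])
qed

text \<open>Cauchy-Schwarz replaces the inner product of \<open>a\<close> and \<open>b\<close> by
  the product of their norms, which reduces the claim to the monotonicity of s^(p-1) for s \<ge>
  0.\<close>

lemma p_laplace_flux_monotone:
  fixes a b :: "'a::real_inner"
  assumes "p > 2"
  shows "((norm a powr (p - 2)) *\<^sub>R a - (norm b powr (p - 2)) *\<^sub>R b) \<bullet> (a - b) \<ge> 0"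
proof -
  let ?s = "norm a" and ?t = "norm b"
  have "(?s powr (p - 2) * ?s - ?t powr (p - 2) * ?t) * (?s - ?t) \<ge> 0"
  proof (cases "?s \<le> ?t")
    case True
    then have "?s powr (p - 2) * ?s \<le> ?t powr (p - 2) * ?t"
      using assms by (intro mult_mono powr_mono2) auto
    with True show ?thesis by (simp add: mult_nonpos_nonpos)
  next
    case False
    then have "?t powr (p - 2) * ?t \<le> ?s powr (p - 2) * ?s"
      using assms by (intro mult_mono powr_mono2) auto
    with False show ?thesis by simp
  qed
  also have "(?s powr (p - 2) * ?s - ?t powr (p - 2) * ?t) * (?s - ?t) =
     ?s powr (p - 2) * (a \<bullet> a) + ?t powr (p - 2) * (b \<bullet> b) - (?s powr (p - 2) + ?t powr (p - 2)) * (?s * ?t)"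
    by (simp add: power2_norm_eq_inner[symmetric] power2_eq_square algebra_simps)
  also have "\<dots> \<le> ?s powr (p - 2) * (a \<bullet> a) + ?t powr (p - 2) * (b \<bullet> b) - (?s powr (p - 2) + ?t powr (p - 2)) * (a \<bullet> b)"
    using norm_cauchy_schwarz[of a b] by (intro diff_left_mono mult_left_mono) auto
  also have "\<dots> = ((norm a powr (p - 2)) *\<^sub>R a - (norm b powr (p - 2)) *\<^sub>R b) \<bullet> (a - b)"
    by (simp add: inner_diff_left inner_diff_right inner_commute algebra_simps)
  finally show ?thesis .
qed

text \<open>A crude form of Young's inequality: the smaller of the two numbers is replaced by the
  larger.\<close>

lemma powr_mult_le_add:
  fixes x y :: real
  assumes "x \<ge> 0" "y \<ge> 0" "p > 2"
  shows "x powr (p - 1) * y \<le> x powr p + y powr p"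
proof -
  have pb: "z powr (p - 1) * z = z powr p" if "z \<ge> 0" for z :: real
    using powr_mult_base[OF that, of "p - 1"] by (simp add: mult.commute)
  show ?thesis
  proof (cases "x \<le> y")
    case True
    then have "x powr (p - 1) * y \<le> y powr (p - 1) * y"
      using assms by (intro mult_right_mono powr_mono2) auto
    then show ?thesis using pb[OF assms(2)] by (simp add: add_increasing)
  next
    case False
    then have "x powr (p - 1) * y \<le> x powr (p - 1) * x"
      using assms by (intro mult_left_mono) auto
    then show ?thesis using pb[OF assms(1)] by (simp add: add_increasing2)
  qed
qed

text \<open>Fluxes and gradients are taken at unrelated arguments, so that this is the two-point
  hypothesis of \<open>mollify_sum_bound\<close>, with \<open>E\<close> twice the sum of the p-th
  powers of the two gradients.\<close>

lemma p_laplace_flux_bound: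
  fixes a b a' b' :: "'a::real_inner"
  assumes "p > 2"
  shows "\<bar>((norm a powr (p - 2)) *\<^sub>R a - (norm b powr (p - 2)) *\<^sub>R b) \<bullet> (a' - b')\<bar> \<le>
    2 * (norm a powr p + norm b powr p) + 2 * (norm a' powr p + norm b' powr p)"
proof -
  have n: "norm x powr (p - 2) * norm x = norm x powr (p - 1)" for x :: 'a
    using powr_mult_base[of "norm x" "p - 2"] by (simp add: mult.commute)
  have "\<bar>((norm a powr (p - 2)) *\<^sub>R a - (norm b powr (p - 2)) *\<^sub>R b) \<bullet> (a' - b')\<bar> \<le>
    norm ((norm a powr (p - 2)) *\<^sub>R a - (norm b powr (p - 2)) *\<^sub>R b) * norm (a' - b')"
    by (rule Cauchy_Schwarz_ineq2)
  also have "\<dots> \<le> (norm a powr (p - 1) + norm b powr (p - 1)) * (norm a' + norm b')"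
    by (intro mult_mono order_trans[OF norm_triangle_ineq4]) (auto simp: n)
  also have "\<dots> = norm a powr (p - 1) * norm a' + norm a powr (p - 1) * norm b' + norm b powr (p - 1) * norm a' + norm b powr (p - 1) * norm b'"
    by (simp add: algebra_simps)
  also have "\<dots> \<le> (norm a powr p + norm a' powr p) + (norm a powr p + norm b' powr p) + (norm b powr p + norm a' powr p) + (norm b powr p + norm b' powr p)"
    using assms by (intro add_mono powr_mult_le_add) auto
  finally show ?thesis by simp
qed

lemma mollify_diff:
  fixes f g :: "'a::euclidean_space \<Rightarrow> real"
  assumes "\<sigma> > 0" "integrable lborel f" "integrable lborel g"
  shows "mollify \<sigma> (\<lambda>z. f z - g z) z = mollify \<sigma> f z - mollify \<sigma> g z"
    "dmollify \<sigma> b (\<lambda>z. f z - g z) z = dmollify \<sigma> b f z - dmollify \<sigma> b g z"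
  unfolding mollify_def dmollify_def right_diff_distrib
  by (rule Bochner_Integration.integral_diff; rule integrable_kern_mult[OF assms(1)]; fact)+

text \<open>A weak solution provides its integrability and its equation only on compactly contained
  cylinders, so a cylinder is shrunk around a given compact set. The base \<open>U'\<close> is the
  interior of a closed neighbourhood of the projection of \<open>K\<close>, and the new final time
  stays above \<open>T\<close>.\<close>

lemma compact_in_times_open_interval:
  fixes U :: "(real^'n) set" and t1 t2 T :: real
  assumes K: "compact K" "K \<subseteq> U \<times> {t1<..<t2}" and U: "open U" and T: "T < t2" "\<And>x t. (x, t) \<in> K \<Longrightarrow> t \<le> T"
    and t: "t1 < t2"
  obtains U' s1 s2 where "open U'" "bounded U'" "closure U' \<subseteq> U" "t1 < s1" "s1 < s2" "s2 < t2" "T < s2"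
    "K \<subseteq> U' \<times> {s1<..<s2}"
proof -
  have "open (U \<times> {t1<..<t2})" using U by (intro open_Times) auto
  from compact_subset_open_imp_ball_epsilon_subset[OF K(1) this K(2)]
  obtain e where e: "e > 0" "(\<Union>z\<in>K. ball z e) \<subseteq> U \<times> {t1<..<t2}" by blast
  \<comment> \<open>Less than \<open>e\<close>, so that shifting points of \<open>K\<close> by
    \<open>d\<close> stays in the cylinder; at most a quarter of the time interval, so that t1 + d
    precedes \<open>s2\<close>, which lies beyond the midpoint.\<close>
  define d where "d = min (e / 2) ((t2 - t1) / 4)"
  have d: "d > 0" "d < e" using e t by (auto simp: d_def)
  define S where "S = (\<Union>x\<in>fst ` K. \<Union>y\<in>cball 0 d. {x + y})"
  have "compact (fst ` K)" by (intro compact_continuous_image K continuous_on_fst continuous_on_id)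
  then have S: "compact S" unfolding S_def by (intro compact_sums') auto
  have SU: "S \<subseteq> U"
  proof
    fix w assume "w \<in> S"
    then obtain x t y where "(x, t) \<in> K" "norm y \<le> d" "w = x + y" unfolding S_def by auto
    then have "(w, t) \<in> ball (x, t) e" using d by (simp add: dist_Pair_Pair dist_norm)
    then show "w \<in> U" using e(2) \<open>(x, t) \<in> K\<close> by blast
  qed
  define s2 where "s2 = (max ((t1 + t2) / 2) T + t2) / 2"
  show ?thesis
  proof (rule that[of "interior S" "t1 + d" s2])
    show "bounded (interior S)" using S interior_subset bounded_subset compact_imp_bounded by blast
    have "closure (interior S) \<subseteq> S" using S compact_imp_closed closure_minimal interior_subset by blast
    then show "closure (interior S) \<subseteq> U" using SU by blast
    show "t1 < t1 + d" using d by simp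
    show "s2 < t2" "T < s2" using T t by (auto simp: s2_def)
    have "d \<le> (t2 - t1) / 4" unfolding d_def by (rule min.cobounded2)
    then show "t1 + d < s2" using t T by (auto simp: s2_def max_def field_simps)
    show "K \<subseteq> interior S \<times> {t1 + d<..<s2}"
    proof
      fix z assume z: "z \<in> K"
      obtain x t' where xt: "z = (x, t')" by (cases z)
      have "ball x d \<subseteq> S"
      proof
        fix w assume "w \<in> ball x d"
        then have "w - x \<in> cball 0 d" "w = x + (w - x)" by (auto simp: dist_norm norm_minus_commute)
        moreover have "x \<in> fst ` K" using z xt by force
        ultimately show "w \<in> S" unfolding S_def by blast
      qed
      then have "x \<in> interior S" using d by (meson centre_in_ball interior_maximal open_ball subsetD)
      moreover have "(x, t' - d) \<in> ball z e" using d xt by (simp add: dist_Pair_Pair dist_norm)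
      then have "t' - d > t1" using e(2) z by force
      moreover have "t' < s2" using T(2)[of x t'] z xt T(1) by (auto simp: s2_def)
      ultimately show "z \<in> interior S \<times> {t1 + d<..<s2}" using xt by auto
    qed
  qed simp
qed

lemma closure_times_interval:
  fixes U :: "(real^'n) set" and t1 t2 :: real
  assumes "t1 < t2"
  shows "closure (U \<times> {t1<..<t2}) = closure U \<times> {t1..t2}"
  using assms by (simp add: closure_Times)

text \<open>The set where h - w \<ge> \<epsilon> avoids the parabolic boundary, so it can reach the
  boundary of the cylinder only at the final time. Cut off at a time before \<open>t2\<close> it is
  compact inside the open cylinder, and the energy estimate applies in a smaller cylinder containing
  it.\<close>

theorem p_parabolic_comparison:
  fixes U :: "(real^'n) set" and h w :: "(real^'n) \<times> real \<Rightarrow> real"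
  assumes p: "p > 2" and U: "open U" "bounded U"
    and h: "p_parabolic p (U \<times> {t1<..<t2::real}) h" and w: "p_parabolic p (U \<times> {t1<..<t2}) w"
    and hc: "continuous_on (closure U \<times> {t1..t2}) h" and wc: "continuous_on (closure U \<times> {t1..t2}) w"
    and le: "\<And>z. z \<in> parabolic_boundary U t1 t2 \<Longrightarrow> h z \<le> w z"
    and z0: "z0 \<in> U \<times> {t1<..<t2}"
  shows "h z0 \<le> w z0"
proof -
  have *: "h z0 - w z0 \<le> \<epsilon>" if \<epsilon>: "\<epsilon> > 0" for \<epsilon>
  proof -
    obtain x0 t0 where x0: "z0 = (x0, t0)" by (cases z0)
    have t: "t1 < t0" "t0 < t2" "x0 \<in> U" using z0 x0 by auto
    \<comment> \<open>Two times with t0 < \<tau> < \<tau>' < t2: the compact set is cut at \<tau>',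
      the test function at \<tau>, and the gap leaves room for mollification.\<close>
    define \<tau>' where "\<tau>' = (t0 + t2) / 2"
    define \<tau> where "\<tau> = (t0 + \<tau>') / 2"
    have \<tau>: "t0 < \<tau>" "\<tau> < \<tau>'" "\<tau>' < t2" using t by (auto simp: \<tau>_def \<tau>'_def)
    let ?C0 = "closure U \<times> {t1..t2}"
    define K0 where "K0 = {z \<in> ?C0. \<epsilon> \<le> h z - w z} \<inter> {z. snd z \<le> \<tau>'}"
    have cC0: "compact ?C0" using U by (intro compact_Times) (auto simp: compact_eq_bounded_closed)
    have "compact K0"
    proof -
      have "closed {z \<in> ?C0. \<epsilon> \<le> h z - w z}"
        by (intro continuous_on_closed_Collect_le continuous_intros hc wc compact_imp_closed cC0)
      then have "closed K0" unfolding K0_def by (intro closed_Int closed_Collect_le continuous_intros)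
      then show ?thesis using cC0 by (metis (no_types, lifting) Int_lower1 K0_def closed_Int_compact compact_Int_closed inf.absorb_iff2 mem_Collect_eq subsetI Int_iff)
    qed
    have K0: "K0 \<subseteq> U \<times> {t1<..<t2}"
    proof
      fix z assume z: "z \<in> K0"
      obtain x s where xs: "z = (x, s)" by (cases z)
      have 1: "x \<in> closure U" "t1 \<le> s" "s \<le> \<tau>'" "\<not> h z \<le> w z" using z xs \<epsilon> by (auto simp: K0_def)
      then have 2: "z \<notin> parabolic_boundary U t1 t2" using le by blast
      have "s \<noteq> t1" using 1 2 xs by (auto simp: parabolic_boundary_def)
      moreover have "x \<in> U"
      proof (rule ccontr)
        assume "x \<notin> U"
        then have "x \<in> frontier U" using 1 U by (simp add: frontier_def interior_open)
        then show False using 2 1 xs \<tau> \<open>s \<noteq> t1\<close> by (auto simp: parabolic_boundary_def)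
      qed
      ultimately show "z \<in> U \<times> {t1<..<t2}" using 1 \<tau> xs by auto
    qed
    \<comment> \<open>\<open>z0\<close> is adjoined so that the smaller cylinder contains it even
      when it is not in \<open>K0\<close>.\<close>
    have cK: "compact (insert z0 K0)" using \<open>compact K0\<close> by simp
    have iK: "insert z0 K0 \<subseteq> U \<times> {t1<..<t2}" using K0 z0 by simp
    have lK: "s \<le> \<tau>'" if "(x, s) \<in> insert z0 K0" for x s
      using that \<tau> x0 by (auto simp: K0_def)
    have "t1 < t2" using t by simp
    from compact_in_times_open_interval[OF cK iK U(1) \<tau>(3) lK this]
    obtain U' s1 s2 where U': "open U'" "bounded U'" "closure U' \<subseteq> U" and s: "t1 < s1" "s1 < s2" "s2 < t2" "\<tau>' < s2"
      and K': "insert z0 K0 \<subseteq> U' \<times> {s1<..<s2}" .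
    define C where "C = U' \<times> {s1<..<s2}"
    have clC: "closure C \<subseteq> U \<times> {t1<..<t2}" unfolding C_def closure_times_interval[OF s(2)]
      using U' s by auto
    have CC0: "C \<subseteq> ?C0"
    proof -
      have "C \<subseteq> U \<times> {t1<..<t2}" using clC closure_subset by blast
      then show ?thesis using closure_subset[of U] by fastforce
    qed
    have Cop: "open C" and Cbd: "bounded C"
      unfolding C_def using U' by (auto intro!: open_Times bounded_Times bounded_subset[OF compact_imp_bounded[OF compact_Icc[of s1 s2]]])
    have "compact (closure C)" using Cbd by (simp add: compact_eq_bounded_closed bounded_closure)
    then have cc: "compactly_contained (U' \<times> {s1<..<s2}) (U \<times> {t1<..<t2})"
      using clC unfolding compactly_contained_def C_def by blast
    have get: "\<exists>g. parabolic_Sobolev p U' s1 s2 f g \<and> (\<forall>\<phi>. test_function C \<phi> \<longrightarrow>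
      (LINT z:C|lebesgue. norm (g z) powr (p - 2) * (g z \<bullet> spatial_gradient \<phi> z)) -
      (LINT z:C|lebesgue. f z * time_derivative \<phi> z) = 0)" if "p_parabolic p (U \<times> {t1<..<t2}) f" for f
      using that cc U'(1) s(2) unfolding p_parabolic_def weak_solution_def C_def by auto
    define cut where "cut f z = indicator C z * f z" for f :: "(real^'n) \<times> real \<Rightarrow> real" and z
    have cut: "cut f z = (if z \<in> C then f z else 0)" for f z by (simp add: cut_def)
    have bdd: "\<exists>M. \<forall>z\<in>?C0. \<bar>f z\<bar> \<le> M" if "continuous_on ?C0 f" for f :: "(real^'n) \<times> real \<Rightarrow> real"
      using compact_imp_bounded[OF compact_continuous_image[OF that cC0]] unfolding bounded_iff by auto
    have icut: "integrable lborel (cut f)" if fc: "continuous_on ?C0 f" for f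
    proof -
      obtain M where M: "\<And>z. z \<in> ?C0 \<Longrightarrow> \<bar>f z\<bar> \<le> M" using bdd[OF fc] by blast
      have iC: "integrable lborel (indicator C :: _ \<Rightarrow> real)"
        using Cop emeasure_bounded_finite[OF Cbd] by (auto simp: integrable_indicator_iff)
      have m: "cut f \<in> borel_measurable borel"
        unfolding cut_def[abs_def]
        using borel_measurable_continuous_on_indicator[OF _ continuous_on_subset[OF fc CC0]] Cop
        by (simp add: scaleR_conv_of_real[where 'a=real])
      show ?thesis
        by (rule Bochner_Integration.integrable_bound[OF integrable_mult_right[OF iC, of M]])
          (use m M CC0 in \<open>auto simp: cut subset_iff intro!: AE_I2 order_trans[OF _ abs_ge_self]\<close>)
    qed
    obtain gh where gh: "parabolic_Sobolev p U' s1 s2 h gh" "\<And>\<phi>. test_function C \<phi> \<Longrightarrow>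
      (LINT z:C|lebesgue. norm (gh z) powr (p - 2) * (gh z \<bullet> spatial_gradient \<phi> z)) -
      (LINT z:C|lebesgue. h z * time_derivative \<phi> z) = 0" using get[OF h] by blast
    obtain gw where gw: "parabolic_Sobolev p U' s1 s2 w gw" "\<And>\<phi>. test_function C \<phi> \<Longrightarrow>
      (LINT z:C|lebesgue. norm (gw z) powr (p - 2) * (gw z \<bullet> spatial_gradient \<phi> z)) -
      (LINT z:C|lebesgue. w z * time_derivative \<phi> z) = 0" using get[OF w] by blast
    have c1: "cut f z = f z" if "z \<in> C" for f z using that by (simp add: cut)
    have c0: "cut f z = 0" if "z \<notin> C" for f z using that by (simp add: cut)
    obtain G where G: "G \<in> borel_measurable borel" "\<And>z. z \<notin> C \<Longrightarrow> G z = 0"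
    "integrable lborel (\<lambda>z. norm (G z) powr p)"
    "\<And>\<sigma> z i. \<sigma> > 0 \<Longrightarrow> cball z \<sigma> \<subseteq> C \<Longrightarrow> dmollify \<sigma> (axis i 1, 0) (cut h) z = mollify \<sigma> (\<lambda>z. G z $ i) z"
    "\<And>\<sigma> z. \<sigma> > 0 \<Longrightarrow> cball z \<sigma> \<subseteq> C \<Longrightarrow> dmollify \<sigma> (0, 1) (cut h) z =
       (\<Sum>i\<in>UNIV. dmollify \<sigma> (axis i 1, 0) (\<lambda>z. (norm (G z) powr (p - 2) *\<^sub>R G z) $ i) z)"
      by (rule weak_solution_mollified[OF p U'(1,2) gh(1) gh(2)[unfolded C_def] icut[OF hc] c1[unfolded C_def] c0[unfolded C_def], folded C_def]) blast+
    obtain H where H: "H \<in> borel_measurable borel" "\<And>z. z \<notin> C \<Longrightarrow> H z = 0"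
    "integrable lborel (\<lambda>z. norm (H z) powr p)"
    "\<And>\<sigma> z i. \<sigma> > 0 \<Longrightarrow> cball z \<sigma> \<subseteq> C \<Longrightarrow> dmollify \<sigma> (axis i 1, 0) (cut w) z = mollify \<sigma> (\<lambda>z. H z $ i) z"
    "\<And>\<sigma> z. \<sigma> > 0 \<Longrightarrow> cball z \<sigma> \<subseteq> C \<Longrightarrow> dmollify \<sigma> (0, 1) (cut w) z =
       (\<Sum>i\<in>UNIV. dmollify \<sigma> (axis i 1, 0) (\<lambda>z. (norm (H z) powr (p - 2) *\<^sub>R H z) $ i) z)"
      by (rule weak_solution_mollified[OF p U'(1,2) gw(1) gw(2)[unfolded C_def] icut[OF wc] c1[unfolded C_def] c0[unfolded C_def], folded C_def]) blast+
    have Cs: "C \<in> sets borel" using Cop by simp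
    note Gi = integrable_p_laplace_flux[OF p G(1,2,3) Cs Cbd]
    note Hi = integrable_p_laplace_flux[OF p H(1,2,3) Cs Cbd]
    obtain Mh Mw where M: "\<And>z. z \<in> ?C0 \<Longrightarrow> \<bar>h z\<bar> \<le> Mh" "\<And>z. z \<in> ?C0 \<Longrightarrow> \<bar>w z\<bar> \<le> Mw"
      using bdd[OF hc] bdd[OF wc] by metis
    let ?v = "\<lambda>z. cut h z - cut w z"
    let ?V = "\<lambda>i z. G z $ i - H z $ i"
    let ?B = "\<lambda>i z. (norm (G z) powr (p - 2) *\<^sub>R G z) $ i - (norm (H z) powr (p - 2) *\<^sub>R H z) $ i"
    have BV: "(\<Sum>i\<in>UNIV. ?B i y * ?V i y') = (norm (G y) powr (p - 2) *\<^sub>R G y - norm (H y) powr (p - 2) *\<^sub>R H y) \<bullet> (G y' - H y')" for y y'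
      by (simp add: inner_vec_def)
    have "?v z0 \<le> \<epsilon>"
    proof (rule energy_comparison[of C "(0, 1)" "\<lambda>i. (axis i 1, 0)" ?v "Mh + Mw" ?V ?B
          "\<lambda>z. 2 * (norm (G z) powr p + norm (H z) powr p)" \<epsilon> \<tau>' \<tau> z0])
      show "open C" "bounded C" by (fact Cop Cbd)+
      show "(0::real^'n, 1::real) \<bullet> (0, 1) = 1" "(axis i 1 :: real^'n, 0::real) \<bullet> (0, 1) = 0" for i by simp_all
      show "integrable lborel ?v" by (intro Bochner_Integration.integrable_diff icut hc wc)
      show "?v z = 0" if "z \<notin> C" for z using that by (simp add: cut)
      show "continuous_on C ?v"
        by (subst continuous_on_cong[OF refl, where g="\<lambda>z. h z - w z"])
          (auto simp: cut intro!: continuous_intros continuous_on_subset[OF hc CC0] continuous_on_subset[OF wc CC0])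
      show "?v z \<le> Mh + Mw" for z
      proof (cases "z \<in> C")
        case True
        then have "z \<in> ?C0" using CC0 by blast
        from M(1)[OF this] M(2)[OF this] True show ?thesis by (simp add: cut)
      next
        case False
        \<comment> \<open>Outside \<open>C\<close> the cut-off difference is 0; that Mh + Mw \<ge> 0
          is seen from the bounds at \<open>z0\<close>.\<close>
        have "z0 \<in> ?C0" using K' CC0 by (auto simp: C_def)
        from M(1)[OF this] M(2)[OF this] False show ?thesis by (simp add: cut)
      qed
      show "integrable lborel (?V i)" for i
        by (intro Bochner_Integration.integrable_diff Gi(1) Hi(1))
      show "integrable lborel (?B i)" for i
        by (intro Bochner_Integration.integrable_diff Gi(2) Hi(2))
      show "integrable lborel (\<lambda>z. 2 * (norm (G z) powr p + norm (H z) powr p))"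
        by (intro integrable_mult_right Bochner_Integration.integrable_add G H)
      show "\<bar>\<Sum>i\<in>UNIV. ?B i y * ?V i y'\<bar> \<le> 2 * (norm (G y) powr p + norm (H y) powr p) + 2 * (norm (G y') powr p + norm (H y') powr p)" for y y'
        unfolding BV by (rule p_laplace_flux_bound[OF p])
      show "0 \<le> (\<Sum>i\<in>UNIV. ?B i y * ?V i y)" for y
        unfolding BV by (rule p_laplace_flux_monotone[OF p])
      show "dmollify \<sigma> (axis i 1, 0) ?v z = mollify \<sigma> (?V i) z" if "\<sigma> > 0" "cball z \<sigma> \<subseteq> C" for \<sigma> z i
        unfolding mollify_diff(2)[OF that(1) icut[OF hc] icut[OF wc]] G(4)[OF that] H(4)[OF that]
        by (rule mollify_diff(1)[OF that(1) Gi(1) Hi(1), symmetric])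
      show "dmollify \<sigma> (0, 1) ?v z = (\<Sum>i\<in>UNIV. dmollify \<sigma> (axis i 1, 0) (?B i) z)" if "\<sigma> > 0" "cball z \<sigma> \<subseteq> C" for \<sigma> z
        unfolding mollify_diff(2)[OF that(1) icut[OF hc] icut[OF wc]] G(5)[OF that] H(5)[OF that] sum_subtractf[symmetric]
        by (rule sum.cong[OF refl]) (rule mollify_diff(2)[OF that(1) Gi(2) Hi(2), symmetric])
      have "{z \<in> C. \<epsilon> \<le> ?v z \<and> z \<bullet> (0, 1) \<le> \<tau>'} = K0"
      proof (intro equalityI subsetI)
        fix z assume "z \<in> {z \<in> C. \<epsilon> \<le> ?v z \<and> z \<bullet> (0, 1) \<le> \<tau>'}"
        then show "z \<in> K0" using CC0 by (cases z) (auto simp: K0_def cut)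
      next
        fix z assume "z \<in> K0"
        moreover then have "z \<in> C" using K' by (auto simp: C_def)
        ultimately show "z \<in> {z \<in> C. \<epsilon> \<le> ?v z \<and> z \<bullet> (0, 1) \<le> \<tau>'}" by (cases z) (auto simp: K0_def cut)
      qed
      then show "compact {z \<in> C. \<epsilon> \<le> ?v z \<and> z \<bullet> (0, 1) \<le> \<tau>'}" using \<open>compact K0\<close> by simp
      show "\<epsilon> > 0" "\<tau> < \<tau>'" by (fact \<epsilon> \<tau>)+
      show "z0 \<in> C" using K' by (simp add: C_def)
      show "z0 \<bullet> (0, 1) < \<tau>" using x0 \<tau> by simp
    qed
    moreover have "z0 \<in> C" using K' by (simp add: C_def)
    ultimately show ?thesis by (simp add: cut)
  qed
  show ?thesis
  proof (rule field_le_epsilon)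
    fix \<epsilon> :: real assume "0 < \<epsilon>"
    from *[OF this] show "h z0 \<le> w z0 + \<epsilon>" by simp
  qed
qed

section \<open>Radial solutions\<close>

text \<open>Where the argument vanishes, the difference quotient is of order |d|^(q-1), which tends
  to 0 because q > 1. The formula gives 0 there as well, even for negative q - 2, since
  \<open>powr\<close> with base 0 is 0.\<close>

lemma norm_powr_deriv:
  fixes y b :: "'a::real_inner"
  assumes q: "q > 1"
  shows "((\<lambda>h. norm (y + h *\<^sub>R b) powr q) has_real_derivative
     q * norm (y + h *\<^sub>R b) powr (q - 2) * ((y + h *\<^sub>R b) \<bullet> b)) (at h)"
proof (cases "y + h *\<^sub>R b = 0")
  case False
  let ?y = "y + h *\<^sub>R b"
  have "((\<lambda>h. y + h *\<^sub>R b) has_derivative (\<lambda>h. h *\<^sub>R b)) (at h)"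
    by (auto intro!: derivative_eq_intros)
  from has_derivative_compose[OF this has_derivative_norm[OF False]]
  moreover have "(\<lambda>k. (k *\<^sub>R b) \<bullet> sgn ?y) = (*) (b \<bullet> sgn ?y)" by (auto simp: fun_eq_iff)
  ultimately have "((\<lambda>h. norm (y + h *\<^sub>R b)) has_real_derivative b \<bullet> sgn ?y) (at h)"
    unfolding has_field_derivative_def by simp
  from DERIV_chain2[OF has_real_derivative_powr this, of q]
  have "((\<lambda>h. norm (y + h *\<^sub>R b) powr q) has_real_derivative q * norm ?y powr (q - 1) * (b \<bullet> sgn ?y)) (at h)"
    using False by simp
  moreover have "norm ?y powr (q - 1) = norm ?y powr (q - 2) * norm ?y"
    using powr_mult_base[of "norm ?y" "q - 2"] by (simp add: mult.commute)
  moreover have "norm ?y * (b \<bullet> sgn ?y) = ?y \<bullet> b"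
    using False by (simp add: sgn_div_norm inner_commute)
  ultimately show ?thesis by (simp add: mult.assoc)
next
  case True
  then have e: "y + (h + d) *\<^sub>R b = d *\<^sub>R b" for d by (simp add: scaleR_add_left add.assoc[symmetric])
  have "((\<lambda>d. (norm (d *\<^sub>R b) powr q - 0) / d) \<longlongrightarrow> 0) (at 0)"
  proof (rule Lim_null_comparison)
    show "\<forall>\<^sub>F d in at 0. norm ((norm (d *\<^sub>R b) powr q - 0) / d) \<le> norm b powr q * \<bar>d\<bar> powr (q - 1)"
    proof (rule eventually_at_filter[THEN iffD2, OF always_eventually], intro allI impI)
      fix d :: real assume d: "d \<noteq> 0"
      have "\<bar>d\<bar> powr q = \<bar>d\<bar> powr (q - 1) * \<bar>d\<bar>"
        using powr_mult_base[of "\<bar>d\<bar>" "q - 1"] by (simp add: mult.commute)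
      then show "norm ((norm (d *\<^sub>R b) powr q - 0) / d) \<le> norm b powr q * \<bar>d\<bar> powr (q - 1)"
        using d by (simp add: powr_mult abs_mult)
    qed
    have "((\<lambda>d. norm b powr q * \<bar>d\<bar> powr (q - 1)) \<longlongrightarrow> norm b powr q * \<bar>0::real\<bar> powr (q - 1)) (at 0)"
      using q by (intro tendsto_intros) auto
    then show "((\<lambda>d. norm b powr q * \<bar>d\<bar> powr (q - 1)) \<longlongrightarrow> 0) (at (0::real))" using q by simp
  qed
  then show ?thesis using True e q by (simp add: DERIV_def)
qed

text \<open>The exponent q - 2 is negative in the application; near 0 the field has norm |y|^(q-1),
  which still tends to 0.\<close>

lemma norm_powr_scaleR_continuous:
  assumes q: "q > 1"
  shows "continuous_on UNIV (\<lambda>y::'a::real_inner. norm y powr (q - 2) *\<^sub>R y)"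
proof (intro continuous_at_imp_continuous_on ballI)
  fix y :: 'a
  show "isCont (\<lambda>y. norm y powr (q - 2) *\<^sub>R y) y"
  proof (cases "y = 0")
    case False
    then show ?thesis by (intro continuous_intros) auto
  next
    case True
    have "((\<lambda>y::'a. norm y powr (q - 2) *\<^sub>R y) \<longlongrightarrow> 0) (at 0)"
    proof (rule Lim_null_comparison)
      show "\<forall>\<^sub>F y in at 0. norm (norm y powr (q - 2) *\<^sub>R y) \<le> norm (y::'a) powr (q - 1)"
      proof (rule always_eventually, intro allI)
        fix y :: 'a
        show "norm (norm y powr (q - 2) *\<^sub>R y) \<le> norm y powr (q - 1)"
          using powr_mult_base[of "norm y" "q - 2"] by (simp add: mult.commute)
      qed
      have "((\<lambda>y::'a. norm y powr (q - 1)) \<longlongrightarrow> norm (0::'a) powr (q - 1)) (at 0)"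
        using q by (intro tendsto_intros) auto
      then show "((\<lambda>y::'a. norm y powr (q - 1)) \<longlongrightarrow> 0) (at 0)" using q by simp
    qed
    then show ?thesis using True by (simp add: isCont_def)
  qed
qed

lemma norm_powr_continuous:
  assumes "q > 1"
  shows "continuous_on UNIV (\<lambda>y::'a::real_normed_vector. norm y powr q)"
proof (rule continuous_on_powr')
  show "\<forall>y\<in>UNIV. 0 \<le> norm (y::'a) \<and> (norm y = 0 \<longrightarrow> 0 < q)" using assms by simp
qed (intro continuous_intros)+

lemma test_function_facts:
  fixes \<phi> :: "'a::euclidean_space \<Rightarrow> real"
  assumes \<phi>: "test_function S \<phi>" and b: "b \<in> Basis"
  shows "continuous_on UNIV \<phi>" "continuous_on UNIV (\<lambda>z. frechet_derivative \<phi> (at z) b)"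
    "\<And>z. z \<notin> S \<Longrightarrow> \<phi> z = 0" "\<And>z. z \<notin> S \<Longrightarrow> frechet_derivative \<phi> (at z) b = 0"
    "\<exists>R. \<forall>z. norm z \<ge> R \<longrightarrow> \<phi> z = 0"
    "((\<lambda>h. \<phi> (z + h *\<^sub>R b)) has_real_derivative frechet_derivative \<phi> (at (z + h *\<^sub>R b)) b) (at h)"
proof -
  have C: "Ck k \<phi>" for k using \<phi> by (simp add: test_function_def)
  have cl: "compact (closure {x. \<phi> x \<noteq> 0})" "closure {x. \<phi> x \<noteq> 0} \<subseteq> S"
    using \<phi> by (auto simp: test_function_def compactly_contained_def)
  show "continuous_on UNIV \<phi>" using C[of 0] by simp
  show "continuous_on UNIV (\<lambda>z. frechet_derivative \<phi> (at z) b)"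
    using C[of "Suc 0"] b by simp
  show "\<phi> z = 0" if "z \<notin> S" for z
    using that cl(2) closure_subset[of "{x. \<phi> x \<noteq> 0}"] by blast
  show "frechet_derivative \<phi> (at z) b = 0" if "z \<notin> S" for z
  proof -
    define T where "T = closure {x. \<phi> x \<noteq> 0}"
    have "open (- T)" unfolding T_def by (intro open_Compl closed_closure)
    moreover have "z \<in> - T" using cl(2) that unfolding T_def by (meson ComplI subsetD)
    moreover have "0 = \<phi> x" if "x \<in> - T" for x
      using that closure_subset[of "{x. \<phi> x \<noteq> 0}"] unfolding T_def by (metis (mono_tags) ComplD mem_Collect_eq subsetD)
    ultimately have "(\<phi> has_derivative (\<lambda>h. 0)) (at z)"
      by (rule has_derivative_transform_within_open[OF has_derivative_const[of 0]])
    from fun_cong[OF frechet_derivative_at[OF this], of b] show ?thesis by simp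
  qed
  obtain R where R: "\<And>z. z \<in> closure {x. \<phi> x \<noteq> 0} \<Longrightarrow> norm z \<le> R"
    using compact_imp_bounded[OF cl(1)] unfolding bounded_iff by blast
  have "\<phi> z = 0" if "norm z \<ge> R + 1" for z
  proof (rule ccontr)
    assume "\<phi> z \<noteq> 0"
    then have "z \<in> closure {x. \<phi> x \<noteq> 0}" using closure_subset[of "{x. \<phi> x \<noteq> 0}"] by blast
    from R[OF this] that show False by simp
  qed
  then show "\<exists>R. \<forall>z. norm z \<ge> R \<longrightarrow> \<phi> z = 0" by blast
  have "\<phi> differentiable (at x)" for x using C[of "Suc 0"] by simp
  then have d: "(\<phi> has_derivative frechet_derivative \<phi> (at x)) (at x)" for x
    using frechet_derivative_works by blast
  have "((\<lambda>h. z + h *\<^sub>R b) has_derivative (\<lambda>h. h *\<^sub>R b)) (at h)"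
    by (auto intro!: derivative_eq_intros)
  from has_derivative_compose[OF this d]
  have "((\<lambda>h. \<phi> (z + h *\<^sub>R b)) has_derivative (\<lambda>k. frechet_derivative \<phi> (at (z + h *\<^sub>R b)) (k *\<^sub>R b))) (at h)" .
  moreover have "frechet_derivative \<phi> (at (z + h *\<^sub>R b)) (k *\<^sub>R b) = frechet_derivative \<phi> (at (z + h *\<^sub>R b)) b * k" for k
    using linear_scale[OF has_derivative_linear[OF d]] by (simp add: mult.commute)
  ultimately show "((\<lambda>h. \<phi> (z + h *\<^sub>R b)) has_real_derivative frechet_derivative \<phi> (at (z + h *\<^sub>R b)) b) (at h)"
    by (simp add: has_field_derivative_def)
qed

lemma set_integral_eq_lborel:
  fixes f :: "'a::euclidean_space \<Rightarrow> real"
  assumes "continuous_on UNIV f" "\<And>z. z \<notin> S \<Longrightarrow> f z = 0"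
  shows "(LINT z:S|lebesgue. f z) = integral\<^sup>L lborel f"
proof -
  have "(LINT z:S|lebesgue. f z) = integral\<^sup>L lebesgue f"
    unfolding set_lebesgue_integral_def
    by (rule Bochner_Integration.integral_cong) (use assms(2) in \<open>auto simp: indicator_def\<close>)
  also have "\<dots> = integral\<^sup>L lborel f"
    by (rule integral_completion) (use assms(1) in \<open>simp add: borel_measurable_continuous_onI\<close>)
  finally show ?thesis .
qed

lemma integrable_continuous_compact_support:
  fixes f :: "'a::euclidean_space \<Rightarrow> real"
  assumes c: "continuous_on UNIV f" and "\<And>z. norm z \<ge> R \<Longrightarrow> f z = 0"
  shows "integrable lborel f"
proof -
  have "integrable lborel (\<lambda>z. indicator (cball 0 \<bar>R\<bar>) z *\<^sub>R f z)"
    by (rule borel_integrable_compact) (auto intro: continuous_on_subset[OF c])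
  also have "(\<lambda>z. indicator (cball 0 \<bar>R\<bar>) z *\<^sub>R f z) = f"
    using assms(2) by (auto simp: indicator_def fun_eq_iff)
  finally show ?thesis .
qed

text \<open>The product of \<open>F\<close> and the test function has compact support, so its
  derivative integrates to 0. One continuous derivative of \<open>F\<close> along \<open>b\<close>
  suffices, as needed for radial profiles, whose second derivatives blow up at the center.\<close>

lemma test_function_by_parts:
  fixes F D \<phi> :: "'a::euclidean_space \<Rightarrow> real"
  assumes \<phi>: "test_function S \<phi>" and b: "b \<in> Basis"
    and F: "continuous_on UNIV F" "continuous_on UNIV D"
    and d: "\<And>z h. ((\<lambda>h. F (z + h *\<^sub>R b)) has_real_derivative D (z + h *\<^sub>R b)) (at h)"
  shows "integrable lborel (\<lambda>z. F z * frechet_derivative \<phi> (at z) b)" "integrable lborel (\<lambda>z. D z * \<phi> z)"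
    "(\<integral>z. F z * frechet_derivative \<phi> (at z) b \<partial>lborel) = - (\<integral>z. D z * \<phi> z \<partial>lborel)"
proof -
  note tf = test_function_facts[OF \<phi> b]
  obtain R where R: "\<And>z. norm z \<ge> R \<Longrightarrow> \<phi> z = 0" using tf(5) by blast
  show i2: "integrable lborel (\<lambda>z. D z * \<phi> z)"
    by (rule integrable_continuous_compact_support[where R=R]) (auto intro!: continuous_intros F tf simp: R)
  have "((\<lambda>h. F (z + h *\<^sub>R b) * \<phi> (z + h *\<^sub>R b)) has_real_derivative
     D (z + h *\<^sub>R b) * \<phi> (z + h *\<^sub>R b) + F (z + h *\<^sub>R b) * frechet_derivative \<phi> (at (z + h *\<^sub>R b)) b) (at h)" for z h
    using DERIV_mult[OF d[of z h] tf(6)[of z h]] by (simp add: algebra_simps)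
  moreover have "continuous_on UNIV (\<lambda>z. F z * \<phi> z)"
    "continuous_on UNIV (\<lambda>z. D z * \<phi> z + F z * frechet_derivative \<phi> (at z) b)"
    by (intro continuous_intros F tf)+
  moreover have "F z * \<phi> z = 0" if "norm z \<ge> R" for z using R[OF that] by simp
  ultimately have *: "integrable lborel (\<lambda>z. D z * \<phi> z + F z * frechet_derivative \<phi> (at z) b)"
    "(\<integral>z. D z * \<phi> z + F z * frechet_derivative \<phi> (at z) b \<partial>lborel) = 0"
    using integral_directional_derivative_eq_0[of "\<lambda>z. F z * \<phi> z" b
        "\<lambda>z. D z * \<phi> z + F z * frechet_derivative \<phi> (at z) b" R]
    by blast+
  show i1: "integrable lborel (\<lambda>z. F z * frechet_derivative \<phi> (at z) b)"
    using Bochner_Integration.integrable_diff[OF *(1) i2] by simp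
  show "(\<integral>z. F z * frechet_derivative \<phi> (at z) b \<partial>lborel) = - (\<integral>z. D z * \<phi> z \<partial>lborel)"
    using *(2) by (simp add: Bochner_Integration.integral_add[OF i2 i1])
qed

lemma Lp_on_continuous:
  fixes f :: "'a::euclidean_space \<Rightarrow> 'b::euclidean_space"
  assumes S: "open S" "bounded S" and f: "continuous_on UNIV f" and p: "p > 0"
  shows "Lp_on p S f"
proof -
  have [measurable]: "S \<in> sets borel" using S by simp
  have fm[measurable]: "f \<in> borel_measurable borel" using f by (rule borel_measurable_continuous_onI)
  have "compact (closure S)" using S by (simp add: compact_eq_bounded_closed bounded_closure)
  from compact_imp_bounded[OF compact_continuous_image[OF continuous_on_subset[OF f subset_UNIV] this]]
  obtain M where M: "\<And>z. z \<in> S \<Longrightarrow> norm (f z) \<le> M"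
    unfolding bounded_iff using closure_subset by (metis image_eqI subsetD)
  have iS: "integrable lborel (\<lambda>z. M powr p * indicator S z :: real)"
    using S emeasure_bounded_finite[of S] by (auto simp: integrable_indicator_iff intro!: integrable_mult_right)
  have "integrable lborel (\<lambda>z. indicator S z *\<^sub>R (norm (f z) powr p))"
    by (rule Bochner_Integration.integrable_bound[OF iS])
      (use M p in \<open>auto simp: indicator_def intro!: AE_I2 powr_mono2\<close>)
  then have "set_integrable lebesgue S (\<lambda>x. norm (f x) powr p)"
    unfolding set_integrable_def by (subst integrable_completion) auto
  moreover have "set_borel_measurable lebesgue S f"
    unfolding set_borel_measurable_def by (rule measurable_completion) simp
  ultimately show ?thesis by (simp add: Lp_on_def)
qed

text \<open>With q = p / (p - 1) the flux of this function is the linear field e (k q)^(p-1) (x -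
  x1), whose divergence e n (k q)^(p-1) is the time derivative. \<open>x1\<close> shifts the center,
  \<open>d\<close> the values, e = 1 or -1 selects the sign, and k = 0 gives constants.\<close>

definition radial_solution :: "real \<Rightarrow> real \<Rightarrow> real^'n \<Rightarrow> real \<Rightarrow> real \<Rightarrow> (real^'n) \<times> real \<Rightarrow> real" where
  "radial_solution p k x1 d e z = d + e * (k * norm (fst z - x1) powr (p / (p - 1)) +
     real CARD('n) * (k * (p / (p - 1))) powr (p - 1) * snd z)"

lemma continuous_radial_solution:
  assumes p: "p > 2"
  shows "continuous_on UNIV (radial_solution p k x1 d e)"
proof -
  have "p / (p - 1) > 1" using p by (simp add: field_simps)
  then show ?thesis
    unfolding radial_solution_def[abs_def]
    by (intro continuous_intros continuous_on_compose2[OF norm_powr_continuous]) auto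
qed

theorem p_parabolic_radial_solution:
  fixes x1 :: "real^'n"
  assumes p: "p > 2" and k: "k \<ge> 0" and e: "e = 1 \<or> e = -1"
  shows "p_parabolic p \<Theta> (radial_solution p k x1 d e)"
proof -
  define q where "q = p / (p - 1)"
  have q: "q > 1" using p by (simp add: q_def field_simps)
  define c where "c = real CARD('n) * (k * q) powr (p - 1)"
  define H where "H = radial_solution p k x1 d e"
  have H: "H z = d + e * (k * norm (fst z - x1) powr q + c * snd z)" for z
    by (simp add: H_def radial_solution_def q_def c_def)
  have Hc: "continuous_on UNIV H" unfolding H_def by (rule continuous_radial_solution[OF p])
  define g where "g z = (e * k * q) *\<^sub>R (norm (fst z - x1) powr (q - 2) *\<^sub>R (fst z - x1))" for z :: "(real^'n) \<times> real"
  have gc: "continuous_on UNIV g"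
    unfolding g_def[abs_def]
    by (intro continuous_intros continuous_on_compose2[OF norm_powr_scaleR_continuous[OF q]]) auto
  have gic: "continuous_on UNIV (\<lambda>z. g z $ i)" for i by (intro continuous_intros gc)
  have flux: "norm (g z) powr (p - 2) *\<^sub>R g z = (e * (k * q) powr (p - 1)) *\<^sub>R (fst z - x1)" for z
  proof (cases "k = 0 \<or> fst z = x1")
    case True
    then show ?thesis using p by (auto simp: g_def)
  next
    case False
    then have k': "k > 0" and y: "norm (fst z - x1) > 0" using k by auto
    let ?r = "norm (fst z - x1)"
    have ng: "norm (g z) = (k * q) * ?r powr (q - 1)"
      using e k' q powr_mult_base[of ?r "q - 2"] by (auto simp: g_def abs_mult mult.commute)
    have "norm (g z) powr (p - 2) * (e * k * q) * ?r powr (q - 2) =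
      e * ((k * q) powr (p - 2) * (k * q)) * (?r powr ((q - 1) * (p - 2)) * ?r powr (q - 2))"
      unfolding ng using k' q y by (simp add: powr_mult powr_powr)
    also have "(k * q) powr (p - 2) * (k * q) = (k * q) powr (p - 1)"
      using powr_mult_base[of "k * q" "p - 2"] k' q by (simp add: mult.commute)
    also have "?r powr ((q - 1) * (p - 2)) * ?r powr (q - 2) = ?r powr ((q - 1) * (p - 2) + (q - 2))"
      by (simp add: powr_add)
    \<comment> \<open>This identity singles out q = p / (p - 1): the powers of the radius cancel, so
      the flux is linear and regular at the center.\<close>
    also have "(q - 1) * (p - 2) + (q - 2) = 0" using p by (simp add: q_def field_simps)
    finally show ?thesis using y by (simp add: g_def)
  qed
  have dH: "((\<lambda>h. H (z + h *\<^sub>R (axis i 1, 0))) has_real_derivative g (z + h *\<^sub>R (axis i 1, 0)) $ i) (at h)" for z h i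
  proof -
    have "((\<lambda>h. norm ((fst z - x1) + h *\<^sub>R axis i 1) powr q) has_real_derivative
      q * norm ((fst z - x1) + h *\<^sub>R axis i 1) powr (q - 2) * (((fst z - x1) + h *\<^sub>R axis i 1) \<bullet> axis i 1)) (at h)"
      by (rule norm_powr_deriv[OF q])
    from DERIV_add[OF DERIV_const[of d] DERIV_cmult[OF DERIV_add[OF DERIV_cmult[OF this, of k] DERIV_const[of "c * snd z"]], of e]]
    show ?thesis by (simp add: H g_def inner_axis algebra_simps)
  qed
  have dHt: "((\<lambda>h. H (z + h *\<^sub>R (0, 1))) has_real_derivative (\<lambda>_. e * c) (z + h *\<^sub>R (0, 1))) (at h)" for z h
    unfolding H by (auto intro!: derivative_eq_intros)
  have dx: "((\<lambda>h. (fst (z + h *\<^sub>R (axis i 1, 0)) - x1) $ i) has_real_derivative (\<lambda>_. 1) (z + h *\<^sub>R (axis i 1, 0 :: real))) (at h)" for z h i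
    by (auto intro!: derivative_eq_intros)
  have "weak_solution p \<Theta> (\<lambda>z. ereal (H z))"
    unfolding weak_solution_def
  proof (intro allI impI, elim conjE)
    fix U :: "(real^'n) set" and t1 t2 :: real
    assume U: "open U" and t: "t1 < t2" and cc: "compactly_contained (U \<times> {t1<..<t2}) \<Theta>"
    let ?C = "U \<times> {t1<..<t2}"
    \<comment> \<open>Boundedness of \<open>U\<close> is obtained by projecting the compact closure
      of the cylinder; t1 < t2 makes the time interval nonempty.\<close>
    have "closure U \<times> {t1..t2} = closure ?C" by (rule closure_times_interval[OF t, symmetric])
    then have "compact (closure U \<times> {t1..t2})" using cc by (simp add: compactly_contained_def)
    then have "bounded (fst ` (closure U \<times> {t1..t2}))"
      by (intro bounded_fst compact_imp_bounded)
    then have Ub: "bounded U" using t closure_subset[of U] by (auto elim: bounded_subset)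
    have Cop: "open ?C" using U by (intro open_Times) auto
    have Cb: "bounded ?C" using Ub
      by (intro bounded_Times bounded_subset[OF compact_imp_bounded[OF compact_Icc[of t1 t2]]]) auto
    have pair: "continuous_on UNIV (\<lambda>x::real^'n. (x, t::real))" for t by (intro continuous_intros)
    have Hs: "continuous_on UNIV (\<lambda>x. H (x, t))" for t
      by (rule continuous_on_compose2[OF Hc pair]) auto
    have gs: "continuous_on UNIV (\<lambda>x. g (x, t))" for t
      by (rule continuous_on_compose2[OF gc pair]) auto
    have L2: "continuous_into_L2 U t1 t2 H"
      unfolding continuous_into_L2_def
    proof (intro conjI ballI)
      show "Lp_on 2 U (\<lambda>x. H (x, t))" for t by (rule Lp_on_continuous[OF U Ub Hs]) simp
      fix s
      have "(LINT x:U|lebesgue. (H (x, t) - H (x, s))\<^sup>2) = measure lebesgue U * (e * c * (t - s))\<^sup>2" for t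
      proof -
        have "(H (x, t) - H (x, s))\<^sup>2 = (e * c * (t - s))\<^sup>2" for x by (simp add: H algebra_simps)
        then show ?thesis by (simp add: set_lebesgue_integral_def)
      qed
      moreover have "((\<lambda>t. measure lebesgue U * (e * c * (t - s))\<^sup>2) \<longlongrightarrow> measure lebesgue U * (e * c * (s - s))\<^sup>2) (at s within {t1..t2})"
        by (intro tendsto_intros)
      ultimately show "((\<lambda>t. LINT x:U|lebesgue. (H (x, t) - H (x, s))\<^sup>2) \<longlongrightarrow> 0) (at s within {t1..t2})"
        by simp
    qed
    have W: "W1p_with_gradient p U (\<lambda>x. H (x, t)) (\<lambda>x. g (x, t))" for t
      unfolding W1p_with_gradient_def
    proof (intro conjI allI impI)
      show "Lp_on p U (\<lambda>x. H (x, t))" "Lp_on p U (\<lambda>x. g (x, t))"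
        using p by (auto intro!: Lp_on_continuous U Ub Hs gs)
      fix \<phi> :: "real^'n \<Rightarrow> real" and i assume \<phi>: "test_function U \<phi>"
      have b: "(axis i 1 :: real^'n) \<in> Basis" by simp
      note tf = test_function_facts[OF \<phi> b]
      have gis: "continuous_on UNIV (\<lambda>x. g (x, t) $ i)" by (intro continuous_intros gs)
      have "((\<lambda>h. H (x + h *\<^sub>R axis i 1, t)) has_real_derivative g (x + h *\<^sub>R axis i 1, t) $ i) (at h)" for x h
        using dH[of "(x, t)" i h] by simp
      from test_function_by_parts(3)[OF \<phi> b Hs gis this]
      have "(\<integral>x. H (x, t) * frechet_derivative \<phi> (at x) (axis i 1) \<partial>lborel) = - (\<integral>x. g (x, t) $ i * \<phi> x \<partial>lborel)" .
      then show "(LINT x:U|lebesgue. H (x, t) * frechet_derivative \<phi> (at x) (axis i 1)) = - (LINT x:U|lebesgue. g (x, t) $ i * \<phi> x)"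
        by (subst (1 2) set_integral_eq_lborel) (auto intro!: continuous_intros Hs gis tf)
    qed
    have S: "parabolic_Sobolev p U t1 t2 H g"
      unfolding parabolic_Sobolev_def using W p by (auto intro!: Lp_on_continuous Cop Cb Hc gc)
    have E: "(LINT z:?C|lebesgue. norm (g z) powr (p - 2) * (g z \<bullet> spatial_gradient \<phi> z)) -
              (LINT z:?C|lebesgue. H z * time_derivative \<phi> z) = 0" if \<phi>: "test_function ?C \<phi>" for \<phi>
    proof -
      have bi: "(axis i 1 :: real^'n, 0::real) \<in> Basis" for i by (simp add: Basis_prod_def)
      have bt: "(0 :: real^'n, 1::real) \<in> Basis" by (simp add: Basis_prod_def)
      note ti = test_function_facts[OF \<phi> bi] and tt = test_function_facts[OF \<phi> bt]
      have xc: "continuous_on UNIV (\<lambda>z::(real^'n) \<times> real. (fst z - x1) $ i)" for i by (intro continuous_intros)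
      note px = test_function_by_parts[OF \<phi> bi xc continuous_on_const dx]
      note pt = test_function_by_parts[OF \<phi> bt Hc continuous_on_const dHt]
      have "norm (g z) powr (p - 2) * (g z \<bullet> spatial_gradient \<phi> z) =
         (e * (k * q) powr (p - 1)) * (\<Sum>i\<in>UNIV. (fst z - x1) $ i * frechet_derivative \<phi> (at z) (axis i 1, 0))" for z
      proof -
        have "norm (g z) powr (p - 2) * (g z \<bullet> spatial_gradient \<phi> z) = (norm (g z) powr (p - 2) *\<^sub>R g z) \<bullet> spatial_gradient \<phi> z"
          by simp
        also have "\<dots> = (e * (k * q) powr (p - 1)) * ((fst z - x1) \<bullet> spatial_gradient \<phi> z)"
          unfolding flux by simp
        also have "(fst z - x1) \<bullet> spatial_gradient \<phi> z = (\<Sum>i\<in>UNIV. (fst z - x1) $ i * frechet_derivative \<phi> (at z) (axis i 1, 0))"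
          by (simp add: inner_vec_def spatial_gradient_def)
        finally show ?thesis .
      qed
      then have "(LINT z:?C|lebesgue. norm (g z) powr (p - 2) * (g z \<bullet> spatial_gradient \<phi> z)) =
        (LINT z:?C|lebesgue. (e * (k * q) powr (p - 1)) * (\<Sum>i\<in>UNIV. (fst z - x1) $ i * frechet_derivative \<phi> (at z) (axis i 1, 0)))"
        by simp
      also have "\<dots> = (\<integral>z. (e * (k * q) powr (p - 1)) * (\<Sum>i\<in>UNIV. (fst z - x1) $ i * frechet_derivative \<phi> (at z) (axis i 1, 0)) \<partial>lborel)"
        by (rule set_integral_eq_lborel) (auto intro!: continuous_intros ti simp: ti(4))
      \<comment> \<open>Each of the n directions contributes minus the integral of \<phi>, which
        produces the factor n in \<open>c\<close>.\<close>
      also have "\<dots> = (e * (k * q) powr (p - 1)) * (\<Sum>i\<in>(UNIV::'n set). - (\<integral>z. 1 * \<phi> z \<partial>lborel))"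
        by (simp only: integral_mult_right_zero Bochner_Integration.integral_sum[OF px(1)] px(3))
      also have "\<dots> = - (e * c * (\<integral>z. \<phi> z \<partial>lborel))" by (simp add: c_def)
      finally have 1: "(LINT z:?C|lebesgue. norm (g z) powr (p - 2) * (g z \<bullet> spatial_gradient \<phi> z)) = - (e * c * (\<integral>z. \<phi> z \<partial>lborel))" .
      have "(LINT z:?C|lebesgue. H z * time_derivative \<phi> z) = (\<integral>z. H z * frechet_derivative \<phi> (at z) (0, 1) \<partial>lborel)"
        unfolding time_derivative_def
        by (rule set_integral_eq_lborel) (auto intro!: continuous_intros tt Hc simp: tt(4))
      also have "\<dots> = - (e * c * (\<integral>z. \<phi> z \<partial>lborel))" unfolding pt(3) by simp
      finally show ?thesis using 1 by simp
    qed
    show "continuous_into_L2 U t1 t2 (\<lambda>z. real_of_ereal (ereal (H z))) \<and>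
       (\<forall>t\<in>{t1..t2}. AE x in lebesgue. x \<in> U \<longrightarrow> \<bar>ereal (H (x, t))\<bar> \<noteq> \<infinity>) \<and>
       (\<exists>g. parabolic_Sobolev p U t1 t2 (\<lambda>z. real_of_ereal (ereal (H z))) g \<and>
         (\<forall>\<phi>. test_function ?C \<phi> \<longrightarrow>
           (LINT z:?C|lebesgue. norm (g z) powr (p - 2) * (g z \<bullet> spatial_gradient \<phi> z)) -
           (LINT z:?C|lebesgue. real_of_ereal (ereal (H z)) * time_derivative \<phi> z) = 0))"
      using L2 S E by (auto intro!: exI[of _ g])
  qed
  then show ?thesis
    unfolding p_parabolic_def H_def[symmetric] using continuous_on_subset[OF Hc] by blast
qed

section \<open>Barriers and Perron solutions\<close>

lemma p_parabolic_subset: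
  assumes "p_parabolic p \<Theta> h" "S \<subseteq> \<Theta>"
  shows "p_parabolic p S h"
proof -
  have "compactly_contained A S \<Longrightarrow> compactly_contained A \<Theta>" for A
    using assms(2) by (auto simp: compactly_contained_def)
  then have "weak_solution p S (\<lambda>z. ereal (h z))"
    using assms(1) unfolding p_parabolic_def weak_solution_def by simp
  moreover have "continuous_on S h"
    using assms by (auto simp: p_parabolic_def intro: continuous_on_subset)
  ultimately show ?thesis by (simp add: p_parabolic_def)
qed

text \<open>Because w \<ge> M on the sphere |x| = s, the truncated function is continuous across it.
  For the comparison property \<open>h\<close> is compared with the constant \<open>M\<close>, and
  then with \<open>w\<close> in the part of the box inside the ball, where h \<le> M \<le> w on the
  new lateral boundary.\<close>

lemma p_superparabolic_min_radial:
  fixes \<Theta> :: "((real^'n) \<times> real) set" and d s M :: real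
  assumes p: "p > 2" and k: "k \<ge> 0"
  defines "w \<equiv> radial_solution p k 0 d 1"
  defines "W \<equiv> \<lambda>z. if norm (fst z) < s then min (w z) M else M"
  assumes sphere: "\<And>z. z \<in> \<Theta> \<Longrightarrow> norm (fst z) = s \<Longrightarrow> M \<le> w z"
  shows "p_superparabolic p \<Theta> (\<lambda>z. ereal (W z))"
proof -
  have wc: "continuous_on UNIV w" unfolding w_def by (rule continuous_radial_solution[OF p])
  have Wc: "continuous_on \<Theta> W"
  proof -
    let ?S = "{z \<in> \<Theta>. norm (fst z) \<le> s}" and ?T = "{z \<in> \<Theta>. s \<le> norm (fst z)}"
    have "continuous_on (?S \<union> ?T) (\<lambda>z. if norm (fst z) < s then min (w z) M else M)"
    proof (rule continuous_on_cases_local)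
      show "closedin (top_of_set (?S \<union> ?T)) ?S"
      proof -
        have eq: "(?S \<union> ?T) \<inter> {z. norm (fst z) \<le> s} = ?S" by auto
        have "closed {z::(real^'n) \<times> real. norm (fst z) \<le> s}"
          by (intro closed_Collect_le continuous_intros)
        from closedin_closed_Int[OF this, of "?S \<union> ?T"] show ?thesis unfolding eq .
      qed
      show "closedin (top_of_set (?S \<union> ?T)) ?T"
      proof -
        have eq: "(?S \<union> ?T) \<inter> {z. s \<le> norm (fst z)} = ?T" by auto
        have "closed {z::(real^'n) \<times> real. s \<le> norm (fst z)}"
          by (intro closed_Collect_le continuous_intros)
        from closedin_closed_Int[OF this, of "?S \<union> ?T"] show ?thesis unfolding eq .
      qed
      show "continuous_on ?S (\<lambda>z. min (w z) M)"
        by (intro continuous_intros continuous_on_subset[OF wc]) auto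
      show "min (w z) M = M"
        if "z \<in> ?S \<and> \<not> norm (fst z) < s \<or> z \<in> ?T \<and> norm (fst z) < s" for z
        using that sphere[of z] by auto
    qed simp
    moreover have "?S \<union> ?T = \<Theta>" by auto
    ultimately show ?thesis by (simp add: W_def)
  qed
  show ?thesis unfolding p_superparabolic_def
  proof (intro conjI ballI allI impI)
    show "ereal (W z) \<noteq> - \<infinity>" for z by simp
    show "openin (top_of_set \<Theta>) {z \<in> \<Theta>. c < ereal (W z)}" for c
    proof -
      have "continuous_on \<Theta> (\<lambda>z. ereal (W z))"
        using Wc by (rule continuous_on_ereal)
      from continuous_openin_preimage_gen[OF this, of "{c<..}"]
      show ?thesis by (simp add: vimage_def Int_def)
    qed
    show "\<Theta> \<subseteq> closure {z \<in> \<Theta>. ereal (W z) \<noteq> \<infinity>}"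
      by (simp add: closure_subset)
    fix a b :: "real^'n" and t1 t2 h z
    assume as: "(\<forall>i. a $ i < b $ i) \<and> t1 < t2 \<and>
        compactly_contained (box a b \<times> {t1<..<t2}) \<Theta> \<and>
        p_parabolic p (box a b \<times> {t1<..<t2}) h \<and>
        continuous_on (closure (box a b \<times> {t1<..<t2})) h \<and>
        (\<forall>z\<in>parabolic_boundary (box a b) t1 t2. ereal (h z) \<le> ereal (W z))"
      and z: "z \<in> box a b \<times> {t1<..<t2}"
    define Q where "Q = box a b"
    have t: "t1 < t2" and hp: "p_parabolic p (Q \<times> {t1<..<t2}) h"
      and hc: "continuous_on (closure Q \<times> {t1..t2}) h" and hW: "\<And>z. z \<in> parabolic_boundary Q t1 t2 \<Longrightarrow> h z \<le> W z"
      and Q\<Theta>: "closure Q \<times> {t1..t2} \<subseteq> \<Theta>"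
      using as closure_times_interval[of t1 t2 "box a b"] unfolding Q_def compactly_contained_def by auto
    have Q: "open Q" "bounded Q" by (auto simp: Q_def open_box bounded_box)
    have const: "radial_solution p 0 0 M 1 = (\<lambda>_::(real^'n) \<times> real. M)"
      using p by (simp add: radial_solution_def fun_eq_iff)
    have hM: "h y \<le> M" if "y \<in> Q \<times> {t1<..<t2}" for y
    proof -
      have "p_parabolic p (Q \<times> {t1<..<t2}) (\<lambda>_. M)"
        using p_parabolic_radial_solution[OF p, of 0 1 "Q \<times> {t1<..<t2}" 0 M] by (simp add: const)
      moreover have "h z \<le> M" if "z \<in> parabolic_boundary Q t1 t2" for z
        using hW[OF that] by (auto simp: W_def split: if_splits)
      ultimately show ?thesis
        using p_parabolic_comparison[OF p Q hp _ hc continuous_on_const _ that] by simp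
    qed
    obtain x0 t0 where z': "z = (x0, t0)" by (cases z)
    have x0: "x0 \<in> Q" "t1 < t0" "t0 < t2" using z z' by (auto simp: Q_def)
    have "h z \<le> w z" if s: "norm x0 < s"
    proof -
      define U where "U = Q \<inter> ball 0 s"
      \<comment> \<open>The bound h \<le> M is known in the open cylinder only, hence before
        \<open>t2\<close>, while the parabolic boundary of the smaller cylinder includes its final
        time. Ending at T2 < t2 makes the bound available there.\<close>
      define T2 where "T2 = (t0 + t2) / 2"
      have T2: "t0 < T2" "T2 < t2" "t1 < T2" using x0 by (auto simp: T2_def)
      have U: "open U" "bounded U" using Q by (auto simp: U_def intro: bounded_subset)
      have UQ: "closure U \<subseteq> closure Q" "closure U \<subseteq> cball 0 s"
      proof -
        show "closure U \<subseteq> closure Q" by (rule closure_mono) (auto simp: U_def)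
        show "closure U \<subseteq> cball 0 s" by (rule closure_minimal) (auto simp: U_def)
      qed
      have sub: "U \<times> {t1<..<T2} \<subseteq> Q \<times> {t1<..<t2}" using T2 by (auto simp: U_def)
      have le1: "h y \<le> w y" if "y \<in> parabolic_boundary Q t1 t2" "fst y \<in> closure U" "y \<in> \<Theta>" for y
      proof -
        have "norm (fst y) \<le> s" using that(2) UQ(2) by auto
        then have "W y \<le> w y" using sphere[OF that(3)] by (auto simp: W_def)
        then show ?thesis using hW[OF that(1)] by simp
      qed
      show "h z \<le> w z"
      proof (rule p_parabolic_comparison[OF p U])
        show "p_parabolic p (U \<times> {t1<..<T2}) h" by (rule p_parabolic_subset[OF hp sub])
        show "p_parabolic p (U \<times> {t1<..<T2}) w"
          unfolding w_def by (rule p_parabolic_radial_solution[OF p k]) simp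
        show "continuous_on (closure U \<times> {t1..T2}) h"
          by (rule continuous_on_subset[OF hc]) (use UQ T2 in auto)
        show "continuous_on (closure U \<times> {t1..T2}) w"
          by (rule continuous_on_subset[OF wc]) simp
        show "z \<in> U \<times> {t1<..<T2}" using x0 s T2 z' by (auto simp: U_def)
        fix y assume y: "y \<in> parabolic_boundary U t1 T2"
        obtain x r where xr: "y = (x, r)" by (cases y)
        have cl: "x \<in> closure U" "t1 \<le> r" "r \<le> T2"
          using y xr T2 by (auto simp: parabolic_boundary_def frontier_def)
        then have y\<Theta>: "y \<in> \<Theta>" using Q\<Theta> UQ xr T2 by auto
        show "h y \<le> w y"
        proof (cases "y \<in> parabolic_boundary Q t1 t2")
          case True
          then show ?thesis using le1 cl y\<Theta> xr by simp
        next
          case False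
          then have r: "r \<noteq> t1" using cl UQ xr by (auto simp: parabolic_boundary_def)
          then have "x \<in> frontier U" using y xr by (auto simp: parabolic_boundary_def)
          then have xU: "x \<notin> U" using U by (simp add: frontier_def interior_open)
          have "x \<notin> frontier Q" using False r cl T2 xr by (auto simp: parabolic_boundary_def)
          then have "x \<in> Q" using cl UQ Q by (auto simp: frontier_def interior_open)
          then have "norm x = s" using xU cl UQ by (fastforce simp: U_def)
          then have "M \<le> w y" using sphere[OF y\<Theta>] xr by simp
          moreover have "h y \<le> M" using \<open>x \<in> Q\<close> cl r T2 xr by (intro hM) auto
          ultimately show ?thesis by simp
        qed
      qed
    qed
    then show "ereal (h z) \<le> ereal (W z)"
      using hM[of z] z z' by (auto simp: W_def Q_def)
  qed
qed

text \<open>If every value were undercut, the open sets of points \<open>y\<close> with v z < v y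
  would cover \<open>A\<close>; in a finite subcover the point \<open>z\<close> of least value would
  remain uncovered.\<close>

lemma lsc_attains_inf:
  fixes v :: "'a::topological_space \<Rightarrow> real"
  assumes A: "compact A" "A \<noteq> {}" and lsc: "\<And>c. openin (top_of_set A) {y \<in> A. c < v y}"
  shows "\<exists>z\<in>A. \<forall>y\<in>A. v z \<le> v y"
proof (rule ccontr)
  assume n: "\<not> ?thesis"
  let ?C = "(\<lambda>z. {y \<in> A. v z < v y}) ` A"
  have "\<forall>c\<in>?C. openin (top_of_set A) c" using lsc by auto
  moreover have "A \<subseteq> \<Union> ?C" using n by (force simp: not_le)
  ultimately obtain D where D: "D \<subseteq> ?C" "finite D" "A \<subseteq> \<Union> D"
    using A(1) unfolding compact_eq_openin_cover by meson
  then obtain B where B: "B \<subseteq> A" "finite B" "D = (\<lambda>z. {y \<in> A. v z < v y}) ` B"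
    by (meson finite_subset_image)
  have "B \<noteq> {}" using D(3) B(3) A(2) by auto
  then obtain z where z: "z \<in> B" "\<forall>y\<in>B. v z \<le> v y"
    using B(2) by (metis (mono_tags, lifting) arg_min_if_finite(1) arg_min_if_finite(2) not_le)
  then have "z \<in> \<Union> D" using B D(3) by blast
  then obtain y where "y \<in> B" "v y < v z" using B(3) by auto
  then show False using z(2) by force
qed

text \<open>At an interior minimum of \<open>u - \<phi>\<close> the test function \<open>\<phi>\<close> can be pushed up to a radial solution
  that is more concave in space and grows strictly faster in time, so that it crosses \<open>u\<close> inside a
  small box only; this contradicts the comparison property of \<open>u\<close>.\<close>

lemma p_superparabolic_ge:
  fixes \<Theta> D :: "((real^'n) \<times> real) set" and a :: "real^'n \<Rightarrow> real" and \<gamma> :: real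
  assumes p: "p > 2" and u: "p_superparabolic p \<Theta> u" and \<Theta>: "open \<Theta>"
    and D: "open D" "bounded D" "D \<subseteq> \<Theta>" and a: "continuous_on UNIV a"
  defines "\<phi> \<equiv> \<lambda>z. - a (fst z) - \<gamma> * snd z"
  assumes strict: "\<And>x0 t0. (x0, t0) \<in> D \<Longrightarrow> \<exists>k x1. 0 \<le> k \<and> real CARD('n) * (k * (p / (p - 1))) powr (p - 1) < \<gamma> \<and>
      (\<forall>x. x \<noteq> x0 \<longrightarrow> k * norm (x0 - x1) powr (p / (p - 1)) - a x0 < k * norm (x - x1) powr (p / (p - 1)) - a x)"
    and bdry: "\<And>\<xi>. \<xi> \<in> frontier D \<Longrightarrow> ereal (\<phi> \<xi>) \<le> Liminf (at \<xi> within D) u"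
    and z: "z \<in> D"
  shows "ereal (\<phi> z) \<le> u z"
proof (rule ccontr)
  assume "\<not> ereal (\<phi> z) \<le> u z"
  then have uz: "u z < ereal (\<phi> z)" by simp
  have \<phi>c: "continuous_on UNIV \<phi>"
    unfolding \<phi>_def by (intro continuous_intros continuous_on_compose2[OF a]) auto
  have um: "u y \<noteq> - \<infinity>" if "y \<in> \<Theta>" for y using u that by (simp add: p_superparabolic_def)
  obtain r0 where r0: "u z < ereal r0" "ereal r0 < ereal (\<phi> z)" using ereal_dense2[OF uz] by blast
  \<comment> \<open>A level between the value of u - \<phi> at \<open>z\<close> and 0. Since \<rho>
    < 0, the boundary condition keeps the set \<open>A\<close> below away from the frontier of
    \<open>D\<close>, while \<open>z\<close> remains in it.\<close>
  define \<rho> where "\<rho> = r0 - \<phi> z"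
  have \<rho>: "\<rho> < 0" "u z < ereal (\<phi> z + \<rho>)" using r0 by (auto simp: \<rho>_def)
  define O' where "O' c = {y \<in> D. ereal (c + \<phi> y) < u y}" for c
  have O': "open (O' c)" for c
  proof -
    \<comment> \<open>Lower semicontinuity is given for constant levels; the moving level c + \<phi>
      is reached as a union over intermediate reals, which also avoids subtraction in
      \<open>ereal\<close>.\<close>
    have "O' c = D \<inter> (\<Union>r::real. {y \<in> \<Theta>. ereal r < u y} \<inter> {y. c + \<phi> y < r})"
    proof (intro equalityI subsetI)
      fix y assume y: "y \<in> O' c"
      then have "ereal (c + \<phi> y) < u y" by (simp add: O'_def)
      then obtain r where "ereal (c + \<phi> y) < ereal r" "ereal r < u y"
        using ereal_dense2 by blast
      then show "y \<in> D \<inter> (\<Union>r::real. {y \<in> \<Theta>. ereal r < u y} \<inter> {y. c + \<phi> y < r})"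
        using y D(3) by (auto simp: O'_def)
    next
      fix y assume "y \<in> D \<inter> (\<Union>r::real. {y \<in> \<Theta>. ereal r < u y} \<inter> {y. c + \<phi> y < r})"
      then obtain r where r: "y \<in> D" "ereal r < u y" "c + \<phi> y < r" by auto
      then have "ereal (c + \<phi> y) < u y" using less_trans[of "ereal (c + \<phi> y)" "ereal r"] by simp
      then show "y \<in> O' c" using r by (simp add: O'_def)
    qed
    moreover have "open {y \<in> \<Theta>. ereal r < u y}" for r
    proof -
      have "openin (top_of_set \<Theta>) {y \<in> \<Theta>. ereal r < u y}"
        using u by (simp add: p_superparabolic_def)
      then show ?thesis by (simp add: openin_open_eq[OF \<Theta>])
    qed
    moreover have "open {y. c + \<phi> y < r}" for r
      by (intro open_Collect_less continuous_intros \<phi>c)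
    ultimately show ?thesis using D(1) by (auto intro!: open_Int open_UN)
  qed
  define A where "A = {y \<in> D. u y \<le> ereal (\<rho> + \<phi> y)}"
  have AD: "A = D - O' \<rho>" by (auto simp: A_def O'_def)
  have zA: "z \<in> A" using \<rho>(2) z by (simp add: A_def add.commute)
  have "closed A"
  proof -
    have "\<xi> \<in> A" if \<xi>: "\<xi> \<in> closure A" for \<xi>
    proof (cases "\<xi> \<in> D")
      case True
      show ?thesis
      proof (rule ccontr)
        assume "\<xi> \<notin> A"
        then have "\<xi> \<in> O' \<rho>" using AD True by blast
        moreover have "O' \<rho> \<inter> A = {}" using AD by blast
        ultimately show False using \<xi> open_Int_closure_eq_empty[OF O'[of \<rho>], of A] by blast
      qed
    next
      case False
      have "\<xi> \<in> closure D" using \<xi> closure_mono[of A D] AD by blast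
      then have fr: "\<xi> \<in> frontier D" using False D(1) by (simp add: frontier_def interior_open)
      have "ereal (\<phi> \<xi> + \<rho> / 2) < Liminf (at \<xi> within D) u"
        using bdry[OF fr] \<rho>(1) by (intro less_le_trans[OF _ bdry[OF fr]]) simp
      then have ev1: "\<forall>\<^sub>F y in at \<xi> within D. ereal (\<phi> \<xi> + \<rho> / 2) < u y"
        by (rule less_LiminfD)
      have "(\<phi> \<longlongrightarrow> \<phi> \<xi>) (at \<xi> within D)"
        by (rule tendsto_within_subset[OF _ subset_UNIV]) (use \<phi>c in \<open>metis UNIV_I continuous_on_def\<close>)
      then have ev2: "\<forall>\<^sub>F y in at \<xi> within D. \<phi> y < \<phi> \<xi> - \<rho> / 2"
        using \<rho>(1) by (intro order_tendstoD(2)) auto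
      from ev1 ev2 have "\<forall>\<^sub>F y in at \<xi> within D. y \<notin> A"
      proof eventually_elim
        case (elim y)
        then have "ereal (\<rho> + \<phi> y) < u y"
          using less_trans[of "ereal (\<rho> + \<phi> y)" "ereal (\<phi> \<xi> + \<rho> / 2)" "u y"] by simp
        then show ?case by (auto simp: A_def not_le)
      qed
      then obtain V where V: "open V" "\<xi> \<in> V" "\<And>y. y \<in> V \<Longrightarrow> y \<noteq> \<xi> \<Longrightarrow> y \<in> D \<Longrightarrow> y \<notin> A"
        unfolding eventually_at_topological by blast
      then have "V \<inter> A = {}" using False AD by blast
      then have False using \<xi> V(2) open_Int_closure_eq_empty[OF V(1), of A] by blast
      then show ?thesis ..
    qed
    then have "closure A \<subseteq> A" by blast
    then show ?thesis by (simp add: closure_subset_eq)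
  qed
  moreover have "bounded A" using D(2) AD by (auto intro: bounded_subset)
  ultimately have cA: "compact A" by (simp add: compact_eq_bounded_closed)
  define v where "v y = real_of_ereal (u y) - \<phi> y" for y
  have uv: "u y = ereal (v y + \<phi> y)" if "y \<in> A" for y
  proof -
    have "u y \<noteq> \<infinity>" "u y \<noteq> -\<infinity>" using that um[of y] D(3) by (auto simp: A_def)
    then show ?thesis by (cases "u y") (auto simp: v_def)
  qed
  have "openin (top_of_set A) {y \<in> A. c < v y}" for c
  proof -
    have "c < v y \<longleftrightarrow> y \<in> O' c" if "y \<in> A" for y
    proof -
      have "y \<in> D" using that by (simp add: A_def)
      then show ?thesis unfolding O'_def using uv[OF that] by simp
    qed
    then have "{y \<in> A. c < v y} = A \<inter> O' c" by blast
    then show ?thesis using O' by (simp add: openin_open_Int)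
  qed
  then obtain z0 where z0: "z0 \<in> A" "\<And>y. y \<in> A \<Longrightarrow> v z0 \<le> v y"
    using lsc_attains_inf[OF cA] zA by blast
  \<comment> \<open>The least value of u - \<phi> on \<open>A\<close>. Outside \<open>A\<close> the
    difference exceeds \<rho> \<ge> m, so it is the minimum over all of \<open>D\<close>.\<close>
  define m where "m = v z0"
  have uge: "ereal (\<phi> y + m) \<le> u y" if "y \<in> D" for y
  proof (cases "y \<in> A")
    case True
    then show ?thesis using uv[OF True] z0(2)[OF True] by (simp add: m_def)
  next
    case False
    then have "ereal (\<rho> + \<phi> y) < u y" using that by (auto simp: A_def)
    moreover have "m \<le> \<rho>" using z0(1) uv[OF z0(1)] by (simp add: A_def m_def)
    then have "ereal (\<phi> y + m) \<le> ereal (\<rho> + \<phi> y)" by simp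
    ultimately show ?thesis by (meson le_less_trans less_imp_le)
  qed
  have uz0: "u z0 = ereal (\<phi> z0 + m)" using uv[OF z0(1)] by (simp add: m_def add.commute)
  obtain x0 t0 where xt: "z0 = (x0, t0)" by (cases z0)
  have z0D: "(x0, t0) \<in> D" using z0(1) xt by (simp add: A_def)
  obtain k x1 where k: "0 \<le> k" and ck: "real CARD('n) * (k * (p / (p - 1))) powr (p - 1) < \<gamma>"
    and min: "\<And>x. x \<noteq> x0 \<Longrightarrow> k * norm (x0 - x1) powr (p / (p - 1)) - a x0 < k * norm (x - x1) powr (p / (p - 1)) - a x"
    using strict[OF z0D] by blast
  define c where "c = real CARD('n) * (k * (p / (p - 1))) powr (p - 1)"
  define \<beta> where "\<beta> = \<gamma> - c"
  have \<beta>: "\<beta> > 0" using ck by (simp add: \<beta>_def c_def)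
  define N where "N x = k * norm (x - x1) powr (p / (p - 1))" for x
  define G where "G x = N x - a x - (N x0 - a x0)" for x
  have G0: "0 \<le> G x" "x \<noteq> x0 \<Longrightarrow> 0 < G x" for x
    using min[of x] by (cases "x = x0"; simp add: G_def N_def)+
  have "p / (p - 1) > 1" using p by (simp add: field_simps)
  then have Gc: "continuous_on UNIV G"
    unfolding G_def N_def by (intro continuous_intros continuous_on_compose2[OF norm_powr_continuous] a) auto
  obtain a1 b1 where ab: "cbox a1 b1 \<subseteq> D" "(x0, t0) \<in> box a1 b1"
    using open_contains_cbox[OF D(1) z0D] by metis
  obtain aa ta bb tb where ab': "a1 = (aa, ta)" "b1 = (bb, tb)" by (cases a1, cases b1)
  have inD: "cbox aa bb \<times> {ta..tb} \<subseteq> D" using ab(1) ab' by (simp add: cbox_Pair_eq)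
  have x0in: "x0 \<in> box aa bb" "ta < t0" "t0 < tb" using ab(2) ab' by (auto simp: mem_box Basis_prod_def)
  let ?Q = "box aa bb"
  have clQ: "closure ?Q = cbox aa bb" using x0in by (intro closure_box) auto
  have frQ: "frontier ?Q \<subseteq> cbox aa bb" using clQ by (auto simp: frontier_def)
  have "\<exists>\<kappa>>0. \<forall>x\<in>frontier ?Q. \<kappa> \<le> G x"
  proof (cases "frontier ?Q = {}")
    case True
    then show ?thesis by (auto intro: exI[of _ 1])
  next
    case False
    have "compact (frontier ?Q)" by (rule compact_frontier_bounded) (rule bounded_box)
    from continuous_attains_inf[OF this False continuous_on_subset[OF Gc]]
    obtain x where x: "x \<in> frontier ?Q" "\<forall>y\<in>frontier ?Q. G x \<le> G y" by auto
    have "x \<noteq> x0" using x(1) x0in by (auto simp: frontier_def interior_open open_box)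
    then show ?thesis using x G0(2) by blast
  qed
  then obtain \<kappa> where \<kappa>: "\<kappa> > 0" "\<And>x. x \<in> frontier ?Q \<Longrightarrow> \<kappa> \<le> G x" by blast
  \<comment> \<open>The last term makes 2 \<beta> r \<le> \<kappa>: on the lateral boundary the gain
    \<kappa> from the more concave profile pays for the lift \<beta> r and for the growth in
    time.\<close>
  define r where "r = min (min (t0 - ta) (tb - t0)) (\<kappa> / (2 * \<beta>))"
  have r: "r > 0" "ta \<le> t0 - r" "t0 + r \<le> tb" "2 * (\<beta> * r) \<le> \<kappa>"
  proof -
    show "r > 0" "ta \<le> t0 - r" "t0 + r \<le> tb" using x0in \<kappa> \<beta> by (auto simp: r_def)
    have "r \<le> \<kappa> / (2 * \<beta>)" by (simp add: r_def)
    then show "2 * (\<beta> * r) \<le> \<kappa>" using \<beta> by (simp add: field_simps)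
  qed
  \<comment> \<open>The lift \<beta> r is cancelled at the initial time t0 - r, but at the touching
    point, where G = 0, it remains in full and contradicts the comparison.\<close>
  define h where "h = radial_solution p k x1 (N x0 - a x0 - \<beta> * t0 + m + \<beta> * r) (-1)"
  have h: "h (x, t) = \<phi> (x, t) + m - G x + \<beta> * (t - t0) + \<beta> * r" for x t
    by (simp add: h_def radial_solution_def \<phi>_def G_def N_def \<beta>_def c_def algebra_simps)
  have sub: "closure (?Q \<times> {t0 - r<..<t0 + r}) \<subseteq> D"
    using closure_times_interval[of "t0 - r" "t0 + r" ?Q] clQ inD r by force
  have cc: "compactly_contained (?Q \<times> {t0 - r<..<t0 + r}) \<Theta>"
    unfolding compactly_contained_def
    using sub D by (auto simp: compact_eq_bounded_closed intro: bounded_subset)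
  have hpar: "p_parabolic p (?Q \<times> {t0 - r<..<t0 + r}) h"
    unfolding h_def by (rule p_parabolic_radial_solution[OF p k]) simp
  have hcont: "continuous_on (closure (?Q \<times> {t0 - r<..<t0 + r})) h"
    unfolding h_def by (rule continuous_on_subset[OF continuous_radial_solution[OF p]]) simp
  have hle: "ereal (h y) \<le> u y" if y: "y \<in> parabolic_boundary ?Q (t0 - r) (t0 + r)" for y
  proof -
    obtain x t where y': "y = (x, t)" by (cases y)
    have "x \<in> cbox aa bb" "t0 - r \<le> t" "t \<le> t0 + r"
      using y y' r frQ clQ by (auto simp: parabolic_boundary_def)
    then have yD: "y \<in> D" using inD y' r by auto
    have "h y \<le> \<phi> y + m"
    proof (cases "t = t0 - r")
      case True
      then have "\<beta> * (t - t0) = - (\<beta> * r)" by simp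
      then show ?thesis using G0(1)[of x] unfolding y' h by linarith
    next
      case False
      then have "x \<in> frontier ?Q" using y y' by (auto simp: parabolic_boundary_def)
      moreover have "\<beta> * (t - t0) \<le> \<beta> * r" using \<beta> \<open>t \<le> t0 + r\<close> by simp
      ultimately show ?thesis using \<kappa>(2)[of x] r(4) unfolding y' h by linarith
    qed
    then show ?thesis using uge[OF yD] by (meson ereal_less_eq(3) order.trans)
  qed
  have "\<forall>i. aa $ i < bb $ i" using x0in(1) unfolding mem_box_cart by (meson less_trans)
  moreover have "(x0, t0) \<in> ?Q \<times> {t0 - r<..<t0 + r}" using x0in r by simp
  moreover have "t0 - r < t0 + r" using r(1) by simp
  moreover have "(\<forall>i. aa $ i < bb $ i) \<and> t0 - r < t0 + r \<and>
      compactly_contained (?Q \<times> {t0 - r<..<t0 + r}) \<Theta> \<and> p_parabolic p (?Q \<times> {t0 - r<..<t0 + r}) h \<and>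
      continuous_on (closure (?Q \<times> {t0 - r<..<t0 + r})) h \<and>
      (\<forall>z\<in>parabolic_boundary ?Q (t0 - r) (t0 + r). ereal (h z) \<le> u z) \<longrightarrow>
      (\<forall>z\<in>?Q \<times> {t0 - r<..<t0 + r}. ereal (h z) \<le> u z)"
    using u unfolding p_superparabolic_def by blast
  ultimately have "ereal (h (x0, t0)) \<le> u (x0, t0)"
    using cc hpar hcont hle by blast
  then have "h (x0, t0) \<le> \<phi> (x0, t0) + m" using uz0 xt by simp
  moreover have "h (x0, t0) = \<phi> (x0, t0) + m + \<beta> * r" by (simp add: h G_def)
  ultimately show False using mult_pos_pos[OF \<beta> r(1)] by simp
qed

section \<open>Strict convexity of powers and profiles touching from below\<close>

lemma powr_gt_tangent_at_1:
  fixes q s :: real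
  assumes q: "q > 1" and s: "s \<ge> 0" "s \<noteq> 1"
  shows "1 + q * (s - 1) < s powr q"
proof -
  have c: "continuous_on {x..y} (\<lambda>s::real. s powr q)" if "0 \<le> x" for x y
    using q that by (intro continuous_on_powr' continuous_intros) auto
  have d: "((\<lambda>s::real. s powr q) has_real_derivative q * \<xi> powr (q - 1)) (at \<xi>)" if "\<xi> > 0" for \<xi>
    by (rule has_real_derivative_powr[OF that])
  then have diff: "(\<lambda>s::real. s powr q) differentiable (at \<xi>)" if "\<xi> > 0" for \<xi>
    using that unfolding real_differentiable_def by blast
  consider "s < 1" | "s > 1" using s by linarith
  then show ?thesis
  proof cases
    case 1
    have "\<exists>l \<xi>. s < \<xi> \<and> \<xi> < 1 \<and> DERIV (\<lambda>s. s powr q) \<xi> :> l \<and> 1 powr q - s powr q = (1 - s) * l"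
      by (rule MVT[OF 1 c[OF s(1)]]) (use s(1) in \<open>auto intro!: diff\<close>)
    then obtain l \<xi> where \<xi>: "s < \<xi>" "\<xi> < 1" "DERIV (\<lambda>s. s powr q) \<xi> :> l" "1 powr q - s powr q = (1 - s) * l"
      by blast
    have "l = q * \<xi> powr (q - 1)" using DERIV_unique[OF \<xi>(3) d] \<xi> s by simp
    moreover have "\<xi> powr (q - 1) < 1" using \<xi> s q powr_less_mono2[of "q - 1" \<xi> 1] by simp
    ultimately have "l < q" using q by simp
    then have "(1 - s) * l < (1 - s) * q" using 1 by simp
    then show ?thesis using \<xi>(4) by (simp add: algebra_simps)
  next
    case 2
    have "\<exists>l \<xi>. 1 < \<xi> \<and> \<xi> < s \<and> DERIV (\<lambda>s. s powr q) \<xi> :> l \<and> s powr q - 1 powr q = (s - 1) * l"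
      by (rule MVT[OF 2 c]) (auto intro!: diff)
    then obtain l \<xi> where \<xi>: "1 < \<xi>" "\<xi> < s" "DERIV (\<lambda>s. s powr q) \<xi> :> l" "s powr q - 1 powr q = (s - 1) * l"
      by blast
    have "l = q * \<xi> powr (q - 1)" using DERIV_unique[OF \<xi>(3) d] \<xi> by simp
    moreover have "\<xi> powr (q - 1) > 1" using \<xi> q powr_less_mono2[of "q - 1" 1 \<xi>] by simp
    ultimately have "l > q" using q by simp
    then have "(s - 1) * q < (s - 1) * l" using 2 by simp
    then show ?thesis using \<xi>(4) by (simp add: algebra_simps)
  qed
qed

text \<open>The tangent inequality at the mean \<open>m\<close>, rescaled from the point 1, is
  strict at both end points because neither equals \<open>m\<close>; the weighted sum of the tangent
  values is the value at \<open>m\<close>.\<close>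

lemma powr_strict_convex:
  fixes a b q \<tau> :: real
  assumes q: "q > 1" and ab: "0 \<le> a" "0 \<le> b" "a \<noteq> b" and \<tau>: "0 < \<tau>" "\<tau> < 1"
  shows "(\<tau> * a + (1 - \<tau>) * b) powr q < \<tau> * a powr q + (1 - \<tau>) * b powr q"
proof -
  define m where "m = \<tau> * a + (1 - \<tau>) * b"
  have m: "m > 0" 
  proof (cases "a = 0")
    case True
    then show ?thesis using ab \<tau> by (simp add: m_def)
  next
    case False
    then show ?thesis using ab \<tau> by (simp add: m_def add_pos_nonneg)
  qed
  have t: "m powr q * (1 + q * (y / m - 1)) < y powr q" if "y \<ge> 0" "y \<noteq> m" for y
  proof -
    have "1 + q * (y / m - 1) < (y / m) powr q"
      using that m by (intro powr_gt_tangent_at_1 q) auto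
    then have "m powr q * (1 + q * (y / m - 1)) < m powr q * (y / m) powr q" using m by simp
    also have "\<dots> = y powr q" using m that by (simp add: powr_divide)
    finally show ?thesis .
  qed
  have "m - a = (1 - \<tau>) * (b - a)" "m - b = \<tau> * (a - b)" by (simp_all add: m_def algebra_simps)
  then have "a \<noteq> m" "b \<noteq> m" using ab \<tau> by auto
  then have "\<tau> * (m powr q * (1 + q * (a / m - 1))) + (1 - \<tau>) * (m powr q * (1 + q * (b / m - 1))) < \<tau> * a powr q + (1 - \<tau>) * b powr q"
    using t ab \<tau> by (intro add_strict_mono mult_strict_left_mono) auto
  moreover have "\<tau> * (m powr q * (1 + q * (a / m - 1))) + (1 - \<tau>) * (m powr q * (1 + q * (b / m - 1))) =
     m powr q * (1 + q * ((\<tau> * a + (1 - \<tau>) * b) / m - 1))"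
    using m by (simp add: field_simps)
  moreover have "(\<tau> * a + (1 - \<tau>) * b) / m = 1" using m by (simp add: m_def)
  ultimately show ?thesis by (simp add: m_def)
qed

text \<open>Strictness has two sources: for equal norms a proper convex combination of distinct
  vectors has smaller norm, and for different norms the scalar power is strictly convex.\<close>

lemma norm_powr_strict_convex:
  fixes x y :: "'a::real_inner"
  assumes q: "q > 1" and xy: "x \<noteq> y" and \<tau>: "0 < \<tau>" "\<tau> < 1"
  shows "norm (\<tau> *\<^sub>R x + (1 - \<tau>) *\<^sub>R y) powr q < \<tau> * norm x powr q + (1 - \<tau>) * norm y powr q"
proof (cases "norm x = norm y")
  case True
  have "0 < (x - y) \<bullet> (x - y)" using xy by simp
  moreover have "x \<bullet> x = y \<bullet> y" using True by (metis power2_norm_eq_inner)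
  ultimately have "x \<bullet> y < y \<bullet> y" by (simp add: inner_diff_left inner_diff_right inner_commute)
  then have "2 * \<tau> * (1 - \<tau>) * (x \<bullet> y) < 2 * \<tau> * (1 - \<tau>) * (y \<bullet> y)" using \<tau> by simp
  then have "(\<tau> *\<^sub>R x + (1 - \<tau>) *\<^sub>R y) \<bullet> (\<tau> *\<^sub>R x + (1 - \<tau>) *\<^sub>R y) < \<tau> * \<tau> * (y \<bullet> y) + (1 - \<tau>) * (1 - \<tau>) * (y \<bullet> y) + 2 * \<tau> * (1 - \<tau>) * (y \<bullet> y)"
    using \<open>x \<bullet> x = y \<bullet> y\<close> by (simp add: inner_add_left inner_add_right inner_commute algebra_simps)
  also have "\<dots> = y \<bullet> y" by (simp add: algebra_simps)
  finally have "norm (\<tau> *\<^sub>R x + (1 - \<tau>) *\<^sub>R y) < norm y" by (simp add: norm_lt)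
  then have "norm (\<tau> *\<^sub>R x + (1 - \<tau>) *\<^sub>R y) powr q < norm y powr q"
    using q by (intro powr_less_mono2) auto
  then show ?thesis using True by (simp add: algebra_simps)
next
  case False
  have "norm (\<tau> *\<^sub>R x + (1 - \<tau>) *\<^sub>R y) \<le> \<tau> * norm x + (1 - \<tau>) * norm y"
    using norm_triangle_ineq[of "\<tau> *\<^sub>R x" "(1 - \<tau>) *\<^sub>R y"] \<tau> by simp
  then have "norm (\<tau> *\<^sub>R x + (1 - \<tau>) *\<^sub>R y) powr q \<le> (\<tau> * norm x + (1 - \<tau>) * norm y) powr q"
    using q by (intro powr_mono2) auto
  also have "\<dots> < \<tau> * norm x powr q + (1 - \<tau>) * norm y powr q"
    using False by (intro powr_strict_convex q \<tau>) auto
  finally show ?thesis .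
qed

text \<open>Rescaling the profile about the center \<open>(1 - \<tau>) x0\<close> keeps the gradient at \<open>x0\<close>, enlarges the
  second derivatives, and changes the time speed by the factor \<open>1 / \<tau>\<close> only.\<close>

lemma radial_touching:
  fixes x0 :: "real^'n"
  assumes p: "p > 2" and k: "k > 0" and \<gamma>: "real CARD('n) * (k * (p / (p - 1))) powr (p - 1) < \<gamma>"
  shows "\<exists>k' x1. 0 \<le> k' \<and> real CARD('n) * (k' * (p / (p - 1))) powr (p - 1) < \<gamma> \<and>
      (\<forall>x. x \<noteq> x0 \<longrightarrow> k' * norm (x0 - x1) powr (p / (p - 1)) - (k * norm x0 powr (p / (p - 1)) + C)
         < k' * norm (x - x1) powr (p / (p - 1)) - (k * norm x powr (p / (p - 1)) + C))"
proof -
  define q where "q = p / (p - 1)"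
  have q: "q > 1" using p by (simp add: q_def field_simps)
  define c where "c = real CARD('n) * (k * q) powr (p - 1)"
  have c: "0 < c" using k q by (simp add: c_def)
  have c': "c < \<gamma>" using \<gamma> by (simp add: c_def q_def)
  \<comment> \<open>The midpoint of c / \<gamma> and 1, so that the enlarged time speed c / \<tau>
    stays below \<gamma>.\<close>
  define \<tau> where "\<tau> = (c / \<gamma> + 1) / 2"
  have "c / \<gamma> < 1" "0 < c / \<gamma>" using c c' by auto
  moreover have "0 < (y + 1) / 2 \<and> (y + 1) / 2 < 1 \<and> y < (y + 1) / 2" if "y < 1" "0 < y" for y :: real
    using that by simp
  ultimately have \<tau>: "0 < \<tau>" "\<tau> < 1" "c / \<gamma> < \<tau>" unfolding \<tau>_def by blast+
  \<comment> \<open>With this factor k' |\<tau> y|^q = k \<tau> |y|^q, and its power p - 1 is 1 /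
    \<tau>.\<close>
  define k' where "k' = k * \<tau> powr (1 - q)"
  define x1 where "x1 = (1 - \<tau>) *\<^sub>R x0"
  have "(\<tau> powr (1 - q)) powr (p - 1) = 1 / \<tau>"
  proof -
    have "(1 - q) * (p - 1) = - 1" using p by (simp add: q_def field_simps)
    then show ?thesis using \<tau> by (simp add: powr_powr powr_minus_divide)
  qed
  then have "(k' * q) powr (p - 1) = (k * q) powr (p - 1) / \<tau>"
    using k q by (simp add: k'_def powr_mult mult.assoc mult.commute mult.left_commute)
  then have "real CARD('n) * (k' * q) powr (p - 1) = c / \<tau>" by (simp add: c_def)
  also have "c / \<tau> < \<gamma>" using \<tau> c c' by (simp add: field_simps)
  finally have 1: "real CARD('n) * (k' * q) powr (p - 1) < \<gamma>" .
  have scale: "k' * norm (x - x1) powr q = k * (\<tau> * norm (x0 + (1 / \<tau>) *\<^sub>R (x - x0)) powr q)" for x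
  proof -
    have "x - x1 = \<tau> *\<^sub>R (x0 + (1 / \<tau>) *\<^sub>R (x - x0))" using \<tau> by (simp add: x1_def algebra_simps)
    then have "norm (x - x1) powr q = \<tau> powr q * norm (x0 + (1 / \<tau>) *\<^sub>R (x - x0)) powr q"
      using \<tau> by (simp only: norm_scaleR) (simp add: powr_mult)
    moreover have "\<tau> powr (1 - q) * \<tau> powr q = \<tau>" using \<tau> by (simp flip: powr_add)
    ultimately show ?thesis by (simp add: k'_def mult.assoc[symmetric])
  qed
  have "k' * norm (x0 - x1) powr q - (k * norm x0 powr q + C) < k' * norm (x - x1) powr q - (k * norm x powr q + C)"
    if "x \<noteq> x0" for x
  proof -
    \<comment> \<open>Chosen so that x = \<tau> y + (1 - \<tau>) x0; the claim becomes strict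
      convexity of |x|^q on the segment from \<open>x0\<close> to this point.\<close>
    let ?y = "x0 + (1 / \<tau>) *\<^sub>R (x - x0)"
    have "?y \<noteq> x0" using that \<tau> by simp
    from norm_powr_strict_convex[OF q this \<tau>(1,2)]
    have "norm (\<tau> *\<^sub>R ?y + (1 - \<tau>) *\<^sub>R x0) powr q < \<tau> * norm ?y powr q + (1 - \<tau>) * norm x0 powr q" .
    moreover have "\<tau> *\<^sub>R ?y + (1 - \<tau>) *\<^sub>R x0 = x" using \<tau> by (simp add: algebra_simps)
    ultimately have "k * norm x powr q < k * (\<tau> * norm ?y powr q + (1 - \<tau>) * norm x0 powr q)" using k by simp
    then show ?thesis unfolding scale by (simp add: algebra_simps)
  qed
  then show ?thesis using 1 k unfolding q_def[symmetric]
    by (intro exI[of _ k'] exI[of _ x1]) (auto simp: k'_def)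
qed

text \<open>The profile is centered at \<open>x0\<close> itself, and \<open>k'\<close> is chosen so
  that its time speed is \<gamma> / 2.\<close>

lemma constant_touching:
  fixes x0 :: "real^'n"
  assumes p: "p > 2" and \<gamma>: "0 < \<gamma>"
  shows "\<exists>k' x1. 0 \<le> k' \<and> real CARD('n) * (k' * (p / (p - 1))) powr (p - 1) < \<gamma> \<and>
      (\<forall>x. x \<noteq> x0 \<longrightarrow> k' * norm (x0 - x1) powr (p / (p - 1)) - C < k' * norm (x - x1) powr (p / (p - 1)) - C)"
proof -
  define q where "q = p / (p - 1)"
  have q: "q > 1" using p by (simp add: q_def field_simps)
  define k' where "k' = (\<gamma> / (2 * real CARD('n))) powr (1 / (p - 1)) / q"
  have k': "k' > 0" using q \<gamma> by (simp add: k'_def)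
  have "(k' * q) powr (p - 1) = \<gamma> / (2 * real CARD('n))"
    using q \<gamma> p by (simp add: k'_def powr_powr)
  then have "real CARD('n) * (k' * q) powr (p - 1) < \<gamma>" using \<gamma> by simp
  then show ?thesis unfolding q_def[symmetric]
    using k' q by (intro exI[of _ k'] exI[of _ x0]) auto
qed

text \<open>Subparabolic functions are defined through negatives, so negation exchanges the Perron
  classes of f and -f and turns suprema into infima.\<close>

lemma lower_Perron_eq_uminus_upper_Perron:
  "lower_Perron p \<Theta> f \<xi> = - upper_Perron p \<Theta> (\<lambda>z. - f z) \<xi>"
proof -
  have mem: "v \<in> lower_class p \<Theta> f \<longleftrightarrow> (\<lambda>z. - v z) \<in> upper_class p \<Theta> (\<lambda>z. - f z)" for v
  proof -
    have "Limsup (at \<xi> within \<Theta>) v \<le> ereal (f \<xi>) \<longleftrightarrow> ereal (- f \<xi>) \<le> Liminf (at \<xi> within \<Theta>) (\<lambda>z. - v z)" for \<xi>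
      unfolding ereal_Liminf_uminus by (simp only: uminus_ereal.simps(1)[symmetric] ereal_minus_le_minus)
    then show ?thesis
      unfolding lower_class_def upper_class_def p_subparabolic_def by simp
  qed
  have "upper_class p \<Theta> (\<lambda>z. - f z) = (\<lambda>v z. - v z) ` lower_class p \<Theta> f"
  proof (intro equalityI subsetI)
    fix u assume "u \<in> upper_class p \<Theta> (\<lambda>z. - f z)"
    then have "(\<lambda>z. - u z) \<in> lower_class p \<Theta> f" by (simp add: mem)
    then show "u \<in> (\<lambda>v z. - v z) ` lower_class p \<Theta> f" by (intro image_eqI[of _ _ "\<lambda>z. - u z"]) auto
  qed (auto simp: mem)
  then have "upper_Perron p \<Theta> (\<lambda>z. - f z) \<xi> = (INF v\<in>lower_class p \<Theta> f. - v \<xi>)"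
    by (simp add: upper_Perron_def image_image)
  also have "\<dots> = - lower_Perron p \<Theta> f \<xi>"
    unfolding lower_Perron_def by (rule ereal_INF_uminus_eq)
  finally show ?thesis by simp
qed

section \<open>The domain, the barrier and the limit at the origin\<close>

context
  fixes p \<theta> :: real
  assumes p: "p > 2" and \<theta>: "\<theta> > 0"
begin

lemma open_Theta_domain: "open (Theta_domain p \<theta> :: ((real^'n) \<times> real) set)"
proof -
  have c: "continuous_on UNIV (\<lambda>z::(real^'n) \<times> real. norm (fst z) powr p)"
    using p by (intro continuous_on_compose2[OF norm_powr_continuous[of p]] continuous_intros) auto
  have eq: "Theta_domain p \<theta> = {z::(real^'n) \<times> real. 0 < - snd z} \<inter> {z. - snd z < \<theta> * norm (fst z) powr p} \<inter> {z. \<theta> * norm (fst z) powr p < \<theta>}"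
    by (auto simp: Theta_domain_def)
  show ?thesis unfolding eq by (intro open_Int open_Collect_less continuous_intros c)
qed

lemma closure_Theta_domain:
  "closure (Theta_domain p \<theta> :: ((real^'n) \<times> real) set) \<subseteq>
    {z. 0 \<le> - snd z \<and> - snd z \<le> \<theta> * norm (fst z) powr p \<and> \<theta> * norm (fst z) powr p \<le> \<theta>}"
proof (rule closure_minimal)
  have c: "continuous_on UNIV (\<lambda>z::(real^'n) \<times> real. norm (fst z) powr p)"
    using p by (intro continuous_on_compose2[OF norm_powr_continuous[of p]] continuous_intros) auto
  have eq: "{z::(real^'n) \<times> real. 0 \<le> - snd z \<and> - snd z \<le> \<theta> * norm (fst z) powr p \<and> \<theta> * norm (fst z) powr p \<le> \<theta>} =
    {z. 0 \<le> - snd z} \<inter> {z. - snd z \<le> \<theta> * norm (fst z) powr p} \<inter> {z. \<theta> * norm (fst z) powr p \<le> \<theta>}" by auto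
  show "closed {z::(real^'n) \<times> real. 0 \<le> - snd z \<and> - snd z \<le> \<theta> * norm (fst z) powr p \<and> \<theta> * norm (fst z) powr p \<le> \<theta>}"
    unfolding eq by (intro closed_Int closed_Collect_le continuous_intros c)
qed (use \<theta> in \<open>auto simp: Theta_domain_def\<close>)

lemma bounded_Theta_domain: "bounded (Theta_domain p \<theta> :: ((real^'n) \<times> real) set)"
proof -
  have "(Theta_domain p \<theta> :: ((real^'n) \<times> real) set) \<subseteq> cball 0 1 \<times> {-\<theta>..0}"
  proof
    fix z :: "(real^'n) \<times> real" assume z: "z \<in> Theta_domain p \<theta>"
    obtain x t where xt: "z = (x, t)" by (cases z)
    have *: "0 < - t" "- t < \<theta> * norm x powr p" "\<theta> * norm x powr p < \<theta>" using z xt by (auto simp: Theta_domain_def)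
    have "norm x \<le> 1"
    proof (rule ccontr)
      assume "\<not> norm x \<le> 1"
      then have "1 \<le> norm x powr p" using p by (intro ge_one_powr_ge_zero) auto
      then show False using *(3) \<theta> by simp
    qed
    then show "z \<in> cball 0 1 \<times> {-\<theta>..0}" using * xt by simp
  qed
  moreover have "bounded (cball (0::real^'n) 1 \<times> {-\<theta>..0})" by (intro bounded_Times bounded_cball compact_imp_bounded compact_Icc)
  ultimately show ?thesis by (rule bounded_subset[rotated])
qed

text \<open>The slope \<open>k\<close> is chosen so that the value of the radial solution on the lateral boundary
  \<open>-t = \<theta> |x|\<^sup>p\<close> attains its maximum, which is exactly the constant of the theorem, at \<open>|x| = s\<close>.\<close>

lemma barrier_parameters:
  fixes s :: real
  assumes s: "s > 0"
  defines "M \<equiv> (p - 2) / p * (1 / (real CARD('n) * p * \<theta>)) powr (1 / (p - 2))"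
  obtains k c where "k > 0" "c = real CARD('n::finite) * (k * (p / (p - 1))) powr (p - 1)" "c > 0"
    "k * s powr (p / (p - 1)) - c * (\<theta> * s powr p) = M"
    "\<And>r. 0 \<le> r \<Longrightarrow> r \<le> s \<Longrightarrow> c * (\<theta> * r powr p) \<le> k * r powr (p / (p - 1))"
proof -
  define q where "q = p / (p - 1)"
  have q: "q > 1" "q \<le> p" using p by (auto simp: q_def field_simps)
  define n where "n = real CARD('n)"
  have n: "n > 0" by (simp add: n_def)
  \<comment> \<open>The maximizing value of k q r^q on the lateral boundary; \<open>k\<close> is
    then determined by asking that it be attained at r = s.\<close>
  define B where "B = (1 / (n * p * \<theta>)) powr (1 / (p - 2))"
  have B: "B > 0" using p \<theta> n by (simp add: B_def)
  define \<kappa> where "\<kappa> = B / q"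
  have \<kappa>: "\<kappa> > 0" using B q by (simp add: \<kappa>_def)
  define k where "k = \<kappa> / s powr q"
  define c where "c = n * (k * q) powr (p - 1)"
  have k: "k > 0" using \<kappa> s by (simp add: k_def)
  have c: "c > 0" using k q n by (simp add: c_def)
  have kq: "k * q = B / s powr q" using q by (simp add: k_def \<kappa>_def)
  have "(k * q) powr (p - 1) = B powr (p - 1) / s powr p"
  proof -
    have "q * (p - 1) = p" using p by (simp add: q_def)
    then show ?thesis unfolding kq using B s by (simp add: powr_divide powr_powr)
  qed
  moreover have "B powr (p - 1) = B / (n * p * \<theta>)"
  proof -
    have "B powr (p - 1) = B * B powr (p - 2)" using powr_mult_base[of B "p - 2"] B by simp
    moreover have "B powr (p - 2) = 1 / (n * p * \<theta>)" using p \<theta> n by (simp add: B_def powr_powr)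
    ultimately show ?thesis by simp
  qed
  ultimately have cs: "c * (\<theta> * s powr p) = B / p"
    using s n p \<theta> by (simp add: c_def)
  have ks: "k * s powr q = B * (p - 1) / p" using s p by (simp add: k_def \<kappa>_def q_def)
  have 1: "k * s powr q - c * (\<theta> * s powr p) = M"
    unfolding cs ks M_def n_def[symmetric] B_def[symmetric] using p by (simp add: field_simps)
  \<comment> \<open>Relative to the values at \<open>s\<close>, the claim compares (r/s)^p with
    (r/s)^q, where q \<le> p and r/s \<le> 1, and the coefficients B / p and B (p - 1) / p, where p
    > 2.\<close>
  have 2: "c * (\<theta> * r powr p) \<le> k * r powr q" if r: "0 \<le> r" "r \<le> s" for r
  proof -
    have rs: "0 \<le> r / s" "r / s \<le> 1" using r s by auto
    have "(r / s) powr p \<le> (r / s) powr q"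
    proof (cases "r = 0")
      case False
      then show ?thesis using rs r s q by (intro powr_mono') auto
    qed simp
    then have "B / p * (r / s) powr p \<le> B * (p - 1) / p * (r / s) powr q"
      using B p by (intro mult_mono) (auto simp: field_simps)
    then have "c * (\<theta> * s powr p) * (r / s) powr p \<le> k * s powr q * (r / s) powr q"
      unfolding cs ks .
    then show ?thesis using r s by (simp add: powr_divide)
  qed
  show ?thesis
    by (rule that[of k c]) (use k c 1 2 in \<open>simp_all add: q_def c_def n_def\<close>)
qed

text \<open>Upper estimate: the barrier raised by \<epsilon> belongs to the upper class and is close
  to its value at the origin. Lower estimate, for every member of the class: a crude bound f (0, 0)
  - M - \<epsilon> in the whole domain supplies values on the sphere |x| = s, after which the
  negative radial function is compared in \<open>D\<close>. Each strict enlargement of a time speed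
  costs one \<epsilon>.\<close>

lemma upper_Perron_eventually:
  fixes f :: "(real^'n) \<times> real \<Rightarrow> real"
  defines "\<Theta> \<equiv> Theta_domain p \<theta>"
  assumes f: "continuous (at (0, 0) within frontier \<Theta>) f"
    and fM: "\<And>\<xi>. \<xi> \<in> frontier \<Theta> \<Longrightarrow>
      \<bar>f \<xi> - f (0, 0)\<bar> \<le> (p - 2) / p * (1 / (real CARD('n) * p * \<theta>)) powr (1 / (p - 2))"
    and \<epsilon>: "\<epsilon> > 0"
  shows "\<forall>\<^sub>F z in at (0, 0) within \<Theta>. ereal (f (0, 0) - 3 * \<epsilon>) \<le> upper_Perron p \<Theta> f z \<and>
     upper_Perron p \<Theta> f z \<le> ereal (f (0, 0) + 2 * \<epsilon>)"
proof -
  define M where "M = (p - 2) / p * (1 / (real CARD('n) * p * \<theta>)) powr (1 / (p - 2))"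
  define q where "q = p / (p - 1)"
  have q: "q > 1" using p by (auto simp: q_def field_simps)
  let ?f0 = "f (0, 0)"
  have \<Theta>op: "open \<Theta>" and \<Theta>bd: "bounded \<Theta>" unfolding \<Theta>_def by (rule open_Theta_domain bounded_Theta_domain)+
  have in\<Theta>: "0 < - snd z" "- snd z < \<theta> * norm (fst z) powr p" "\<theta> * norm (fst z) powr p < \<theta>" if "z \<in> \<Theta>" for z
    using that by (auto simp: \<Theta>_def Theta_domain_def)
  have cl\<Theta>: "0 \<le> - snd z" "- snd z \<le> \<theta> * norm (fst z) powr p" "\<theta> * norm (fst z) powr p \<le> \<theta>" if "z \<in> closure \<Theta>" for z
    using that closure_Theta_domain unfolding \<Theta>_def by blast+
  obtain \<delta> where \<delta>: "\<delta> > 0" "\<And>\<xi>. \<xi> \<in> frontier \<Theta> \<Longrightarrow> norm \<xi> < \<delta> \<Longrightarrow> \<bar>f \<xi> - ?f0\<bar> < \<epsilon>"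
    using f[unfolded continuous_within_eps_delta, rule_format, OF \<epsilon>] by (auto simp: dist_real_def dist_norm zero_prod_def[symmetric])
  \<comment> \<open>For |x| \<le> s \<le> 1 points of the closure have |t| \<le> \<theta> |x|^p
    \<le> \<theta> s, so their norm is at most s (1 + \<theta>) < \<delta>.\<close>
  define s where "s = min 1 (\<delta> / (2 * (1 + \<theta>)))"
  have s: "s > 0" "s \<le> 1" using \<delta> \<theta> by (auto simp: s_def)
  have near: "\<bar>f \<xi> - ?f0\<bar> < \<epsilon>" if \<xi>: "\<xi> \<in> frontier \<Theta>" "norm (fst \<xi>) \<le> s" for \<xi>
  proof (rule \<delta>(2)[OF \<xi>(1)])
    have cl: "\<xi> \<in> closure \<Theta>" using \<xi> by (simp add: frontier_def)
    have "norm (fst \<xi>) powr p \<le> norm (fst \<xi>) powr 1"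
    proof (cases "fst \<xi> = 0")
      case False
      then show ?thesis using \<xi>(2) s p by (intro powr_mono') auto
    qed (use p in simp)
    then have "\<theta> * norm (fst \<xi>) powr p \<le> \<theta> * s" using \<theta> \<xi>(2) by simp
    then have "norm (snd \<xi>) \<le> \<theta> * s" using cl\<Theta>(1,2)[OF cl] by simp
    moreover have "norm \<xi> \<le> norm (fst \<xi>) + norm (snd \<xi>)"
      using norm_Pair_le[of "fst \<xi>" "snd \<xi>"] by simp
    ultimately have "norm \<xi> \<le> s * (1 + \<theta>)" using \<xi>(2) by (simp add: algebra_simps)
    also have "\<dots> \<le> \<delta> / (2 * (1 + \<theta>)) * (1 + \<theta>)" using \<theta> by (intro mult_right_mono) (auto simp: s_def)
    also have "\<dots> < \<delta>" using \<theta> \<delta>(1) by (simp add: field_simps add_pos_pos)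
    finally show "norm \<xi> < \<delta>" .
  qed
  obtain k c where k: "k > 0" and c: "c = real CARD('n) * (k * q) powr (p - 1)" "c > 0"
    and atS: "k * s powr q - c * (\<theta> * s powr p) = M"
    and below: "\<And>r. 0 \<le> r \<Longrightarrow> r \<le> s \<Longrightarrow> c * (\<theta> * r powr p) \<le> k * r powr q"
    using barrier_parameters[OF s(1), where 'n='n] unfolding M_def q_def by metis
  have nonneg: "0 \<le> k * norm (fst z) powr q + c * snd z" if "z \<in> closure \<Theta>" "norm (fst z) \<le> s" for z
  proof -
    have "c * - snd z \<le> c * (\<theta> * norm (fst z) powr p)" using cl\<Theta>(2)[OF that(1)] c by (intro mult_left_mono) auto
    also have "\<dots> \<le> k * norm (fst z) powr q" using that(2) by (intro below) auto
    finally show ?thesis by simp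
  qed
  have geM: "M \<le> k * norm (fst z) powr q + c * snd z" if "z \<in> closure \<Theta>" "norm (fst z) = s" for z
  proof -
    have "c * - snd z \<le> c * (\<theta> * s powr p)" using cl\<Theta>(2)[OF that(1)] that(2) c by (intro mult_left_mono) auto
    then show ?thesis using atS that(2) by simp
  qed
  have M0: "0 \<le> M" using p by (simp add: M_def)
  have cls: "z \<in> closure \<Theta>" if "z \<in> \<Theta>" for z using that closure_subset by blast
  define W where "W z = (if norm (fst z) < s then min (radial_solution p k 0 (?f0 + \<epsilon>) 1 z) (?f0 + \<epsilon> + M) else ?f0 + \<epsilon> + M)" for z :: "(real^'n) \<times> real"
  have rad: "radial_solution p k 0 (?f0 + \<epsilon>) 1 z = ?f0 + \<epsilon> + (k * norm (fst z) powr q + c * snd z)" for z :: "(real^'n) \<times> real"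
    by (simp add: radial_solution_def c q_def)
  have Wsup: "p_superparabolic p \<Theta> (\<lambda>z. ereal (W z))"
    unfolding W_def
  proof (rule p_superparabolic_min_radial[OF p])
    show "0 \<le> k" using k by simp
    show "?f0 + \<epsilon> + M \<le> radial_solution p k 0 (?f0 + \<epsilon>) 1 z" if "z \<in> \<Theta>" "norm (fst z) = s" for z
      using geM[OF cls[OF that(1)] that(2)] by (simp add: rad)
  qed
  have Wge: "?f0 + \<epsilon> \<le> W z" if "z \<in> \<Theta>" for z
    using nonneg[OF cls[OF that]] M0 by (simp add: W_def rad)
  have "(\<lambda>z. ereal (W z)) \<in> upper_class p \<Theta> f"
    unfolding upper_class_def
  proof (intro CollectI conjI ballI Wsup)
    fix \<xi> assume \<xi>: "\<xi> \<in> frontier \<Theta>"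
    show "ereal (f \<xi>) \<le> Liminf (at \<xi> within \<Theta>) (\<lambda>z. ereal (W z))"
    proof (rule Liminf_bounded)
      show "\<forall>\<^sub>F z in at \<xi> within \<Theta>. ereal (f \<xi>) \<le> ereal (W z)"
      proof (cases "norm (fst \<xi>) \<le> s")
        case True
        have "f \<xi> \<le> W z" if "z \<in> \<Theta>" for z using near[OF \<xi> True] Wge[OF that] by simp
        then show ?thesis by (auto simp: eventually_at_filter)
      next
        case False
        have "((\<lambda>z. norm (fst z)) \<longlongrightarrow> norm (fst \<xi>)) (at \<xi> within \<Theta>)"
          by (intro tendsto_intros)
        then have "\<forall>\<^sub>F z in at \<xi> within \<Theta>. s < norm (fst z)" using False by (intro order_tendstoD(1)) auto
        then show ?thesis
        proof eventually_elim
          case (elim z)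
          then have "W z = ?f0 + \<epsilon> + M" by (simp add: W_def)
          then show ?case using fM[OF \<xi>] \<epsilon> unfolding M_def[symmetric] by simp
        qed
      qed
    qed
  qed
  then have up: "upper_Perron p \<Theta> f z \<le> ereal (W z)" for z
    unfolding upper_Perron_def by (rule INF_lower)
  define D where "D = \<Theta> \<inter> {z. norm (fst z) < s}"
  have Dop: "open D" unfolding D_def by (intro open_Int \<Theta>op open_Collect_less continuous_intros)
  have D: "bounded D" "D \<subseteq> \<Theta>" using \<Theta>bd by (auto simp: D_def intro: bounded_subset)
  have low: "ereal (?f0 - 2 * \<epsilon> - k * norm (fst z) powr q) \<le> u z"
    if u: "u \<in> upper_class p \<Theta> f" and z: "z \<in> D" for u z
  proof -
    have us: "p_superparabolic p \<Theta> u" and ub: "\<And>\<xi>. \<xi> \<in> frontier \<Theta> \<Longrightarrow> ereal (f \<xi>) \<le> Liminf (at \<xi> within \<Theta>) u"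
      using u by (auto simp: upper_class_def)
    have u1: "ereal (?f0 - M - \<epsilon>) \<le> u y" if y: "y \<in> \<Theta>" for y
    proof -
      \<comment> \<open>Times in the closure satisfy |t| \<le> \<theta>, so this slope changes the
        comparison function by at most \<epsilon>, and it leaves room for a strictly smaller time
        speed in the touching profile.\<close>
      define \<gamma> where "\<gamma> = \<epsilon> / \<theta>"
      have \<gamma>: "\<gamma> > 0" "\<gamma> * \<theta> = \<epsilon>" using \<epsilon> \<theta> by (auto simp: \<gamma>_def)
      have "ereal (- (M - ?f0 + \<epsilon>) - \<gamma> * snd y) \<le> u y"
      proof (rule p_superparabolic_ge[OF p us \<Theta>op \<Theta>op \<Theta>bd order_refl continuous_on_const _ _ y])
        show "\<exists>k x1. 0 \<le> k \<and> real CARD('n) * (k * (p / (p - 1))) powr (p - 1) < \<gamma> \<and>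
          (\<forall>x. x \<noteq> x0 \<longrightarrow> k * norm (x0 - x1) powr (p / (p - 1)) - (M - ?f0 + \<epsilon>) < k * norm (x - x1) powr (p / (p - 1)) - (M - ?f0 + \<epsilon>))" for x0 :: "real^'n"
          by (rule constant_touching[OF p \<gamma>(1)])
        fix \<xi> assume \<xi>: "\<xi> \<in> frontier \<Theta>"
        then have cl: "\<xi> \<in> closure \<Theta>" by (simp add: frontier_def)
        have "\<gamma> * - snd \<xi> \<le> \<gamma> * \<theta>" using cl\<Theta>[OF cl] \<gamma> by (intro mult_left_mono) auto
        then have "- (M - ?f0 + \<epsilon>) - \<gamma> * snd \<xi> \<le> f \<xi>"
          using fM[OF \<xi>] \<gamma>(2) unfolding M_def[symmetric] by (simp add: abs_le_iff)
        then show "ereal (- (M - ?f0 + \<epsilon>) - \<gamma> * snd \<xi>) \<le> Liminf (at \<xi> within \<Theta>) u"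
          using ub[OF \<xi>] by (meson ereal_less_eq(3) order.trans)
      qed
      moreover have "0 \<le> \<gamma> * - snd y" using in\<Theta>(1)[OF y] \<gamma> by (intro mult_nonneg_nonneg) auto
      then have "ereal (?f0 - M - \<epsilon>) \<le> ereal (- (M - ?f0 + \<epsilon>) - \<gamma> * snd y)" by simp
      ultimately show ?thesis by (rule order.trans[rotated])
    qed
    \<comment> \<open>The time speed exceeds \<open>c\<close> by \<epsilon> / \<theta>, which over
      the height of the domain again costs \<epsilon>; the second \<epsilon> in \<open>C\<close>
      absorbs the oscillation of \<open>f\<close> near the origin.\<close>
    define \<gamma> where "\<gamma> = c + \<epsilon> / \<theta>"
    have \<gamma>: "\<gamma> > c" "(\<gamma> - c) * \<theta> = \<epsilon>" using \<epsilon> \<theta> by (auto simp: \<gamma>_def)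
    define C where "C = 2 * \<epsilon> - ?f0"
    let ?a = "\<lambda>x::real^'n. k * norm x powr (p / (p - 1)) + C"
    have "ereal (- ?a (fst z) - \<gamma> * snd z) \<le> u z"
    proof (rule p_superparabolic_ge[OF p us \<Theta>op Dop D _ _ _ z])
      show "continuous_on UNIV ?a"
        using q unfolding q_def by (intro continuous_intros continuous_on_compose2[OF norm_powr_continuous]) auto
      show "\<exists>k' x1. 0 \<le> k' \<and> real CARD('n) * (k' * (p / (p - 1))) powr (p - 1) < \<gamma> \<and>
          (\<forall>x. x \<noteq> x0 \<longrightarrow> k' * norm (x0 - x1) powr (p / (p - 1)) - ?a x0 < k' * norm (x - x1) powr (p / (p - 1)) - ?a x)" for x0 :: "real^'n"
        by (rule radial_touching[OF p k]) (use \<gamma>(1) c q_def in simp)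
      fix \<xi> assume \<xi>: "\<xi> \<in> frontier D"
      have clD: "\<xi> \<in> closure D" using \<xi> by (simp add: frontier_def)
      then have cl: "\<xi> \<in> closure \<Theta>" using closure_mono[OF D(2)] by blast
      have "closure D \<subseteq> {z. norm (fst z) \<le> s}"
        by (rule closure_minimal) (auto simp: D_def intro!: closed_Collect_le continuous_intros)
      then have ns: "norm (fst \<xi>) \<le> s" using clD by blast
      have "(\<gamma> - c) * - snd \<xi> \<le> (\<gamma> - c) * \<theta>" using cl\<Theta>[OF cl] \<gamma> by (intro mult_left_mono) auto
      then have \<phi>: "- ?a (fst \<xi>) - \<gamma> * snd \<xi> \<le> ?f0 - \<epsilon> - (k * norm (fst \<xi>) powr q + c * snd \<xi>)"
        unfolding \<gamma>(2) by (simp add: C_def q_def algebra_simps)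
      show "ereal (- ?a (fst \<xi>) - \<gamma> * snd \<xi>) \<le> Liminf (at \<xi> within D) u"
      proof (cases "\<xi> \<in> \<Theta>")
        case False
        then have fr: "\<xi> \<in> frontier \<Theta>" using cl \<Theta>op by (simp add: frontier_def interior_open)
        have "- ?a (fst \<xi>) - \<gamma> * snd \<xi> \<le> f \<xi>" using \<phi> nonneg[OF cl ns] near[OF fr ns] by linarith
        then have "ereal (- ?a (fst \<xi>) - \<gamma> * snd \<xi>) \<le> Liminf (at \<xi> within \<Theta>) u"
          using ub[OF fr] by (meson ereal_less_eq(3) order.trans)
        \<comment> \<open>Approaching through a smaller set can only raise the lower limit.\<close>
        also have "\<dots> \<le> Liminf (at \<xi> within D) u"
          unfolding Liminf_def
          by (rule SUP_subset_mono) (use at_le[OF D(2), of \<xi>] in \<open>auto simp: le_filter_def\<close>)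
        finally show ?thesis .
      next
        case True
        \<comment> \<open>Here \<xi> lies on the sphere inside the domain, where no boundary data
          exist. The crude bound \<open>u1\<close> takes their place, since the comparison function
          has dropped by \<open>M\<close> there.\<close>
        have "\<xi> \<notin> D" using \<xi> Dop by (simp add: frontier_def interior_open)
        then have "norm (fst \<xi>) = s" using True ns by (auto simp: D_def)
        then have "- ?a (fst \<xi>) - \<gamma> * snd \<xi> \<le> ?f0 - M - \<epsilon>" using \<phi> geM[OF cl] by linarith
        then have "ereal (- ?a (fst \<xi>) - \<gamma> * snd \<xi>) \<le> u y" if "y \<in> D" for y
          using u1[of y] that D(2) by (meson ereal_less_eq(3) order.trans subsetD)
        then show ?thesis by (intro Liminf_bounded) (auto simp: eventually_at_filter)
      qed
    qed
    moreover have "0 \<le> \<gamma> * - snd z" using in\<Theta>(1)[of z] D(2) z \<gamma> c by (intro mult_nonneg_nonneg) auto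
    then have "ereal (?f0 - 2 * \<epsilon> - k * norm (fst z) powr q) \<le> ereal (- ?a (fst z) - \<gamma> * snd z)"
      by (simp add: C_def q_def)
    ultimately show ?thesis by (rule order.trans[rotated])
  qed
  have fin: "ereal (?f0 - 2 * \<epsilon> - k * norm (fst z) powr q) \<le> upper_Perron p \<Theta> f z" if "z \<in> D" for z
    unfolding upper_Perron_def by (rule INF_greatest) (rule low[OF _ that])
  have "((\<lambda>z::(real^'n) \<times> real. norm (fst z)) \<longlongrightarrow> norm (fst (0::real^'n, 0::real))) (at (0, 0) within \<Theta>)"
    by (intro tendsto_intros)
  then have t0: "((\<lambda>z::(real^'n) \<times> real. norm (fst z)) \<longlongrightarrow> 0) (at (0, 0) within \<Theta>)" by simp
  have "((\<lambda>z::(real^'n) \<times> real. k * norm (fst z) powr q) \<longlongrightarrow> k * 0 powr q) (at (0, 0) within \<Theta>)"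
    using q by (intro tendsto_intros t0) auto
  then have "\<forall>\<^sub>F z in at (0, 0) within \<Theta>. k * norm (fst z) powr q < \<epsilon>"
    using \<epsilon> by (intro order_tendstoD(2)) auto
  moreover have "\<forall>\<^sub>F z in at (0, 0) within \<Theta>. norm (fst z) < s"
    using order_tendstoD(2)[OF t0 s(1)] .
  moreover have "\<forall>\<^sub>F z in at (0, 0) within \<Theta>. z \<in> \<Theta>" by (simp add: eventually_at_filter)
  ultimately show ?thesis
  proof eventually_elim
    case (elim z)
    then have "z \<in> D" by (simp add: D_def)
    have "ereal (?f0 - 3 * \<epsilon>) \<le> ereal (?f0 - 2 * \<epsilon> - k * norm (fst z) powr q)" using elim by simp
    then have 1: "ereal (?f0 - 3 * \<epsilon>) \<le> upper_Perron p \<Theta> f z" using fin[OF \<open>z \<in> D\<close>] by (rule order.trans)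
    have "c * snd z \<le> 0" using in\<Theta>(1)[of z] elim c by (simp add: mult_le_0_iff)
    then have "W z \<le> ?f0 + 2 * \<epsilon>" using elim by (simp add: W_def rad)
    then have 2: "upper_Perron p \<Theta> f z \<le> ereal (?f0 + 2 * \<epsilon>)" using up[of z] by (meson ereal_less_eq(3) order.trans)
    show ?case using 1 2 by simp
  qed
qed

lemma upper_Perron_tendsto:
  fixes f :: "(real^'n) \<times> real \<Rightarrow> real"
  defines "\<Theta> \<equiv> Theta_domain p \<theta>"
  assumes f: "continuous (at (0, 0) within frontier \<Theta>) f"
    and fM: "\<And>\<xi>. \<xi> \<in> frontier \<Theta> \<Longrightarrow>
      \<bar>f \<xi> - f (0, 0)\<bar> \<le> (p - 2) / p * (1 / (real CARD('n) * p * \<theta>)) powr (1 / (p - 2))"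
  shows "(upper_Perron p \<Theta> f \<longlongrightarrow> ereal (f (0, 0))) (at (0, 0) within \<Theta>)"
proof (rule order_tendstoI)
  note ev = upper_Perron_eventually[of f, folded \<Theta>_def, OF f fM]
  fix a assume "a < ereal (f (0, 0))"
  then obtain r where r: "a < ereal r" "ereal r < ereal (f (0, 0))" using ereal_dense2 by blast
  define \<epsilon> where "\<epsilon> = (f (0, 0) - r) / 3"
  have "\<epsilon> > 0" "f (0, 0) - 3 * \<epsilon> = r" using r by (auto simp: \<epsilon>_def field_simps)
  then show "\<forall>\<^sub>F z in at (0, 0) within \<Theta>. a < upper_Perron p \<Theta> f z"
    using ev[of \<epsilon>] r(1) by (auto elim!: eventually_mono intro: less_le_trans)
next
  note ev = upper_Perron_eventually[of f, folded \<Theta>_def, OF f fM]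
  fix a assume "ereal (f (0, 0)) < a"
  then obtain r where r: "ereal r < a" "ereal (f (0, 0)) < ereal r" using ereal_dense2 by blast
  define \<epsilon> where "\<epsilon> = (r - f (0, 0)) / 2"
  have "\<epsilon> > 0" "f (0, 0) + 2 * \<epsilon> = r" using r by (auto simp: \<epsilon>_def field_simps)
  then show "\<forall>\<^sub>F z in at (0, 0) within \<Theta>. upper_Perron p \<Theta> f z < a"
    using ev[of \<epsilon>] r(1) by (auto elim!: eventually_mono intro: le_less_trans)
qed

end

theorem corollary1p8:
  fixes l p \<theta> :: real and f :: "(real^'n) \<times> real \<Rightarrow> real"
  assumes "l = p" and "p > 2" and "\<theta> > 0"
    and "continuous (at (0, 0) within frontier (Theta_domain l \<theta>)) f"
    and "\<forall>\<xi>\<in>frontier (Theta_domain l \<theta>).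
      \<bar>f \<xi> - f (0, 0)\<bar> \<le> (p - 2) / p * (1 / (real CARD('n) * p * \<theta>)) powr (1 / (p - 2))"
  shows "(lower_Perron p (Theta_domain l \<theta>) f \<longlongrightarrow> ereal (f (0, 0)))
           (at (0, 0) within Theta_domain l \<theta>) \<and>
         (upper_Perron p (Theta_domain l \<theta>) f \<longlongrightarrow> ereal (f (0, 0)))
           (at (0, 0) within Theta_domain l \<theta>)"
proof
  let ?\<Theta> = "Theta_domain p \<theta> :: ((real^'n) \<times> real) set"
  note c = assms(4)[unfolded \<open>l = p\<close>] and b = assms(5)[unfolded \<open>l = p\<close>]
  show "(upper_Perron p (Theta_domain l \<theta>) f \<longlongrightarrow> ereal (f (0, 0))) (at (0, 0) within Theta_domain l \<theta>)"
    unfolding \<open>l = p\<close> by (rule upper_Perron_tendsto[OF assms(2,3) c]) (use b in blast)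
  \<comment> \<open>Both hypotheses on \<open>f\<close> are invariant under a change of sign, so the
    upper result for -f gives the lower one for f.\<close>
  have "(upper_Perron p ?\<Theta> (\<lambda>z. - f z) \<longlongrightarrow> ereal (- f (0, 0))) (at (0, 0) within ?\<Theta>)"
  proof (rule upper_Perron_tendsto[OF assms(2,3)])
    show "continuous (at (0, 0) within frontier ?\<Theta>) (\<lambda>z. - f z)"
      by (rule continuous_minus[OF c])
    show "\<bar>- f \<xi> - - f (0, 0)\<bar> \<le> (p - 2) / p * (1 / (real CARD('n) * p * \<theta>)) powr (1 / (p - 2))"
      if "\<xi> \<in> frontier ?\<Theta>" for \<xi>
      using b that by (simp add: abs_minus_commute)
  qed
  then have "((\<lambda>z. - upper_Perron p ?\<Theta> (\<lambda>z. - f z) z) \<longlongrightarrow> - ereal (- f (0, 0))) (at (0, 0) within ?\<Theta>)"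
    by (rule tendsto_uminus_ereal)
  then show "(lower_Perron p (Theta_domain l \<theta>) f \<longlongrightarrow> ereal (f (0, 0))) (at (0, 0) within Theta_domain l \<theta>)"
    unfolding \<open>l = p\<close> lower_Perron_eq_uminus_upper_Perron[abs_def] by simp
qed

end
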